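(* Let $n\ge 3$, $k\ge 1$, and let $P_1,\dots,P_k$ be tangential hyperbolic $n$-gons with given total inradius $\sum_{i=1}^k r(P_i)=T$. Then $$\sum_{i=1}^k \mathrm{Area}(P_i)\;\geq\; k(n-2)\pi - 2nk\,\cos^{-1}\!\left(\sin(\pi/n)\,\cosh(T/k)\right),$$ with equality if and only if all $P_i$ are isometric to a regular $n$-gon of inradius $T/k$.
   Context: A hyperbolic $n$-gon is a polygon with $n$ geodesic sides in the hyperbolic plane of constant curvature $-1$; all of its vertices are assumed to lie in the hyperbolic plane (no ideal vertices). A polygon is tangential if all its sides are tangent to the same circle (its incircle); $r(P)$ denotes the (hyperbolic) radius of the incircle. $\mathrm{Area}(P)$ is the hyperbolic area of $P$. A polygon is regular if all its sides are equal and all its interior angles are equal. *)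

theory Defs
  imports "HOL-Analysis.Analysis"
begin

text \<open>
  The hyperbolic plane of curvature \<open>-1\<close> in the Beltrami--Klein model: the open unit disc of
  the Euclidean plane, whose geodesics are the Euclidean chords. Hence the geodesic segment between
  two points is their Euclidean \<open>closed_segment\<close>, and points are collinear in the hyperbolic sense
  iff they are so in the Euclidean sense. The model is not conformal: angles, lengths and areas
  are those of the Riemannian metric \<open>hmetric\<close>.
\<close>

definition hplane :: "complex set" where
  "hplane = ball 0 1"

definition hmetric :: "complex \<Rightarrow> complex \<Rightarrow> complex \<Rightarrow> real" where
  "hmetric x u v = inner u v / (1 - (norm x)\<^sup>2) + inner x u * inner x v / (1 - (norm x)\<^sup>2)\<^sup>2"

definition hdist :: "complex \<Rightarrow> complex \<Rightarrow> real" where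
  "hdist x y = arcosh ((1 - inner x y) / (sqrt (1 - (norm x)\<^sup>2) * sqrt (1 - (norm y)\<^sup>2)))"

definition hline :: "complex \<Rightarrow> complex \<Rightarrow> complex set" where
  "hline a b = affine hull {a, b} \<inter> hplane"

definition hcircle :: "complex \<Rightarrow> real \<Rightarrow> complex set" where
  "hcircle c r = {x \<in> hplane. hdist c x = r}"

text \<open>The angle in \<open>[0, \<pi>]\<close> at \<open>x\<close> between the geodesics issuing from \<open>x\<close> in directions \<open>u\<close>, \<open>v\<close>.\<close>

definition hangle :: "complex \<Rightarrow> complex \<Rightarrow> complex \<Rightarrow> real" where
  "hangle x u v = arccos (hmetric x u v / (sqrt (hmetric x u u) * sqrt (hmetric x v v)))"

text \<open>The density is the square root of the determinant of \<open>hmetric x\<close>, whose eigenvalues are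
  \<open>1 / (1 - |x|\<^sup>2)\<close> and \<open>1 / (1 - |x|\<^sup>2)\<^sup>2\<close>.\<close>

definition harea :: "complex set \<Rightarrow> real" where
  "harea S = (LINT x:S|lborel. (1 - (norm x)\<^sup>2) powr (-3/2))"

definition hisometry :: "(complex \<Rightarrow> complex) \<Rightarrow> bool" where
  "hisometry f \<longleftrightarrow> bij_betw f hplane hplane \<and>
     (\<forall>x\<in>hplane. \<forall>y\<in>hplane. hdist (f x) (f y) = hdist x y)"


text \<open>A polygon is given by the cyclic list of its vertices; indices are read modulo its length.\<close>

definition vertex :: "complex list \<Rightarrow> nat \<Rightarrow> complex" where
  "vertex P i = P ! (i mod length P)"

definition side :: "complex list \<Rightarrow> nat \<Rightarrow> complex set" where
  "side P i = closed_segment (vertex P i) (vertex P (Suc i))"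

text \<open>A simple polygon: distinct sides meet only in common endpoints. The last condition excludes
  straight angles, so that the polygon really has \<open>n\<close> vertices. Convexity is not assumed.\<close>

definition hyp_ngon :: "nat \<Rightarrow> complex list \<Rightarrow> bool" where
  "hyp_ngon n P \<longleftrightarrow> n \<ge> 3 \<and> length P = n \<and> distinct P \<and> set P \<subseteq> hplane \<and>
     (\<forall>i<n. \<forall>j<n. i \<noteq> j \<longrightarrow>
        side P i \<inter> side P j \<subseteq> {vertex P i, vertex P (Suc i)} \<inter> {vertex P j, vertex P (Suc j)}) \<and>
     (\<forall>i<n. \<not> collinear {vertex P i, vertex P (Suc i), vertex P (Suc (Suc i))})"

definition boundary :: "complex list \<Rightarrow> complex set" where
  "boundary P = (\<Union>i<length P. side P i)"

text \<open>The bounded component of the complement of the boundary lies in the convex hull of the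
  vertices, hence in the disc, so taking \<open>inside\<close> in the whole plane is harmless.\<close>

definition region :: "complex list \<Rightarrow> complex set" where
  "region P = boundary P \<union> inside (boundary P)"

definition Area :: "complex list \<Rightarrow> real" where
  "Area P = harea (region P)"

text \<open>A side is tangent to a circle if its geodesic line meets the circle in exactly one point and
  that point belongs to the side itself.\<close>

definition incircle :: "complex list \<Rightarrow> complex \<Rightarrow> real \<Rightarrow> bool" where
  "incircle P c r \<longleftrightarrow> c \<in> hplane \<and> r > 0 \<and>
     (\<forall>i<length P. \<exists>p\<in>side P i. hline (vertex P i) (vertex P (Suc i)) \<inter> hcircle c r = {p})"

definition tangential :: "complex list \<Rightarrow> bool" where
  "tangential P \<longleftrightarrow> (\<exists>c r. incircle P c r)"

definition inradius :: "complex list \<Rightarrow> real" where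
  "inradius P = (THE r. \<exists>c. incircle P c r)"

text \<open>With \<open>u\<close>, \<open>w\<close> pointing to the two neighbours of a vertex, \<open>u + w\<close> points into the smaller of
  the two sectors they bound; the interior angle is reflex iff that sector is locally outside.\<close>

definition interior_angle :: "complex list \<Rightarrow> nat \<Rightarrow> real" where
  "interior_angle P i =
    (let x = vertex P i;
         u = vertex P (i + length P - 1) - x;
         w = vertex P (Suc i) - x
     in if \<forall>\<^sub>F t in at_right 0. x + t *\<^sub>R (u + w) \<in> region P
        then hangle x u w else 2 * pi - hangle x u w)"

definition regular :: "complex list \<Rightarrow> bool" where
  "regular P \<longleftrightarrow>
     (\<forall>i<length P. \<forall>j<length P.
        hdist (vertex P i) (vertex P (Suc i)) = hdist (vertex P j) (vertex P (Suc j)) \<and>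
        interior_angle P i = interior_angle P j)"

definition isometric :: "complex list \<Rightarrow> complex list \<Rightarrow> bool" where
  "isometric P Q \<longleftrightarrow> (\<exists>f. hisometry f \<and> f ` region P = region Q)"

end

theory Submission
  imports Defs
begin

text \<open>
  Move the centre of the incircle to the origin of the Klein disc. The incircle becomes a Euclidean
  circle, the polygon a Euclidean circumscribed polygon that, being simple, winds around it once, and
  it is cut into right-angled triangles with angles \<open>\<theta> i\<close> at the origin, two for each vertex. Gauss--Bonnet
  for these triangles gives
  \<open>Area P = 2 * (\<Sum>i<n. arcsin (cosh r * sin (\<theta> i))) - 2 * pi\<close> with \<open>(\<Sum>i<n. \<theta> i) = pi\<close>.
  As \<open>arcsin (C * sin x)\<close> is strictly convex in \<open>x\<close> for \<open>C > 1\<close>, the area is least when all \<open>\<theta> i\<close> are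
  \<open>pi / n\<close>; as \<open>arcsin (sin (pi / n) * cosh r)\<close> is strictly convex in \<open>r\<close>, the total area is then least
  when all inradii agree.
\<close>

section \<open>Strict convexity\<close>

text \<open>Three definitions shape the work. A polygon is only assumed simple and its
  \<open>region\<close> is defined topologically, so the identification of \<open>region\<close>
  with the convex hull has to be extracted from the incircle: each side line supports the polygon
  once the points of tangency are known to wind around the centre exactly once. An isometry is only
  a distance-preserving bijection; its projective form, and with it continuity and the invariance of
  angles and area, comes from the fact that \<open>hdist\<close> depends on the form
  \<open>1 - inner x y\<close> alone, which an isometry changes by a factor
  \<open>w x * w y\<close>. Finally \<open>inradius\<close> is a definite description, so the radius
  of an incircle must be shown to be unique; this uses the interior angles, which do not depend on
  the choice of a circle. The constant C of the convexity argument is \<open>cosh r\<close> because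
  the incircle has Euclidean radius \<open>tanh r\<close> and
  \<open>1 / sqrt (1 - (tanh r)^2) = cosh r\<close>.\<close>

lemma tangent_line_strictly_below:
  fixes f f' :: "real \<Rightarrow> real"
  assumes S: "convex S" "x \<in> S" "y \<in> S" "x \<noteq> y"
    and f: "\<And>x. x \<in> S \<Longrightarrow> (f has_real_derivative f' x) (at x)"
    and f': "\<And>x y. x \<in> S \<Longrightarrow> y \<in> S \<Longrightarrow> x < y \<Longrightarrow> f' x < f' y"
  shows "f y + f' y * (x - y) < f x"
proof -
  have seg: "z \<in> S" if "min x y \<le> z" "z \<le> max x y" for z
  proof -
    have "closed_segment x y \<subseteq> S"
      using S by (simp add: closed_segment_subset)
    then show ?thesis
      using that by (auto simp: closed_segment_eq_real_ivl min_def max_def split: if_splits)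
  qed
  show ?thesis
  proof (cases "x < y")
    case True
    obtain z where z: "x < z" "z < y" "f y - f x = (y - x) * f' z"
      using MVT2[OF True, of f f'] f seg by auto
    have "f' z < f' y"
      using z S seg f' by auto
    then have "(y - x) * f' z < (y - x) * f' y"
      using True by simp
    then show ?thesis
      using z by (simp add: algebra_simps)
  next
    case False
    then have less: "y < x" using S by simp
    obtain z where z: "y < z" "z < x" "f x - f y = (x - y) * f' z"
      using MVT2[OF less, of f f'] f seg by auto
    have "f' y < f' z"
      using z S seg f' by auto
    then have "(x - y) * f' y < (x - y) * f' z"
      using less by simp
    then show ?thesis
      using z by (simp add: algebra_simps)
  qed
qed

text \<open>Subtract the tangent at the mean \<open>m\<close>: the linear parts cancel in the sum,
  and there remain the defects \<open>d i\<close>, which are nonnegative and vanish only for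
  \<open>x i = m\<close>. Convexity of \<open>S\<close> places \<open>m\<close> in \<open>S\<close>;
  this later yields \<open>C * sin (pi / n) < 1\<close> and
  \<open>s * cosh (T / k) < 1\<close>.\<close>

lemma strict_Jensen_mean:
  fixes f f' :: "real \<Rightarrow> real"
  assumes S: "convex S" and I: "finite I" "I \<noteq> {}" "\<And>i. i \<in> I \<Longrightarrow> x i \<in> S"
    and f: "\<And>x. x \<in> S \<Longrightarrow> (f has_real_derivative f' x) (at x)"
    and f': "\<And>x y. x \<in> S \<Longrightarrow> y \<in> S \<Longrightarrow> x < y \<Longrightarrow> f' x < f' y"
    and m: "m = (\<Sum>i\<in>I. x i) / card I"
  shows "m \<in> S" "card I * f m \<le> (\<Sum>i\<in>I. f (x i))"
    "(\<Sum>i\<in>I. f (x i)) = card I * f m \<longleftrightarrow> (\<forall>i\<in>I. x i = m)"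
proof -
  have card: "real (card I) > 0"
    using I by (simp add: card_gt_0_iff)
  have "(\<Sum>i\<in>I. (1 / card I) *\<^sub>R x i) \<in> S"
    using I S card by (intro convex_sum) auto
  then show mS: "m \<in> S"
    by (simp add: m sum_divide_distrib)
  define d where "d i = f (x i) - (f m + f' m * (x i - m))" for i
  have d: "d i > 0" if "i \<in> I" "x i \<noteq> m" for i
    using tangent_line_strictly_below[OF S, of "x i" m f f'] that I mS f f' by (simp add: d_def)
  have d0: "d i = 0" if "x i = m" for i
    using that by (simp add: d_def)
  have nonneg: "d i \<ge> 0" if "i \<in> I" for i
    using d[OF that] d0[of i] by (cases "x i = m") auto
  have "(\<Sum>i\<in>I. f' m * (x i - m)) = 0"
    using card by (simp flip: sum_distrib_left add: sum_subtractf m)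
  then have sum: "(\<Sum>i\<in>I. f (x i)) - card I * f m = (\<Sum>i\<in>I. d i)"
    by (simp add: d_def sum_subtractf sum.distrib)
  have "(\<Sum>i\<in>I. d i) \<ge> 0"
    using nonneg by (rule sum_nonneg)
  then show "card I * f m \<le> (\<Sum>i\<in>I. f (x i))"
    using sum by linarith
  have "(\<Sum>i\<in>I. d i) = 0 \<longleftrightarrow> (\<forall>i\<in>I. d i = 0)"
    using I nonneg by (simp add: sum_nonneg_eq_0_iff)
  also have "\<dots> \<longleftrightarrow> (\<forall>i\<in>I. x i = m)"
    using d d0 by (metis less_irrefl)
  finally show "(\<Sum>i\<in>I. f (x i)) = card I * f m \<longleftrightarrow> (\<forall>i\<in>I. x i = m)"
    using sum by linarith
qed

section \<open>The functions arcsin (C sin x) and arcsin (s cosh x) on their convex domains\<close>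

lemma convex_sublevel_mono:
  fixes g :: "real \<Rightarrow> real"
  assumes "convex S" and mono: "\<And>x y. x \<in> S \<Longrightarrow> y \<in> S \<Longrightarrow> x \<le> y \<Longrightarrow> g x \<le> g y"
  shows "convex {x \<in> S. g x < a}"
proof -
  have S: "is_interval S"
    using assms by (simp add: is_interval_convex_1)
  show ?thesis
    unfolding is_interval_convex_1[symmetric] is_interval_1
    using S mono unfolding is_interval_1 by (smt (verit) mem_Collect_eq)
qed

lemma arcsin_mult_sin_deriv:
  assumes C: "C > 1" and "0 < x" "x < pi/2" "C * sin x < 1"
  shows "((\<lambda>x. arcsin (C * sin x)) has_real_derivative C * cos x / sqrt (1 - (C * sin x)\<^sup>2)) (at x)"
proof -
  have "sin x > 0" using assms by (intro sin_gt_zero) auto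
  then have "C * sin x > 0" using C by simp
  then show ?thesis
    using assms by (auto intro!: derivative_eq_intros simp: field_simps)
qed

text \<open>Divided by C and squared, the derivative is \<open>(1 - u) / (1 - C^2 * u)\<close> with
  \<open>u = (sin x)^2\<close>; this increases in u because \<open>C^2 > 1\<close>.\<close>

lemma arcsin_mult_sin_deriv_mono:
  assumes C: "C > 1" and x: "0 < x" and xy: "x < y" and y: "y < pi/2" "C * sin y < 1"
  shows "C * cos x / sqrt (1 - (C * sin x)\<^sup>2) < C * cos y / sqrt (1 - (C * sin y)\<^sup>2)"
proof -
  have s: "0 < sin x" "sin x < sin y"
    using assms by (auto intro!: sin_gt_zero sin_monotone_2pi)
  have c: "cos x > 0" "cos y > 0"
    using assms by (auto intro!: cos_gt_zero_pi)
  define u v where "u = (sin x)\<^sup>2" and "v = (sin y)\<^sup>2"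
  have uv: "0 < u" "u < v"
    using s by (auto simp: u_def v_def intro!: power_strict_mono)
  have "(C * sin y)\<^sup>2 < 1"
    using y s C by (intro power_less_one_iff[THEN iffD2]) auto
  then have v: "C\<^sup>2 * v < 1" by (simp add: v_def power_mult_distrib)
  have "C\<^sup>2 * u < C\<^sup>2 * v"
    using uv C by simp
  then have u: "C\<^sup>2 * u < 1" using v by simp
  have C2: "C\<^sup>2 > 1" using C by (simp add: one_less_power)
  have "(C\<^sup>2 - 1) * u < (C\<^sup>2 - 1) * v"
    using C2 uv by simp
  then have "(1 - u) * (1 - C\<^sup>2 * v) < (1 - v) * (1 - C\<^sup>2 * u)"
    by (simp add: algebra_simps)
  then have *: "(1 - u) / (1 - C\<^sup>2 * u) < (1 - v) / (1 - C\<^sup>2 * v)"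
    using u v by (simp add: divide_simps mult.commute)
  have "cos x / sqrt (1 - (C * sin x)\<^sup>2) = sqrt ((1 - u) / (1 - C\<^sup>2 * u))"
    using c by (simp add: real_sqrt_divide u_def power_mult_distrib flip: cos_squared_eq)
  moreover have "cos y / sqrt (1 - (C * sin y)\<^sup>2) = sqrt ((1 - v) / (1 - C\<^sup>2 * v))"
    using c by (simp add: real_sqrt_divide v_def power_mult_distrib flip: cos_squared_eq)
  ultimately have "cos x / sqrt (1 - (C * sin x)\<^sup>2) < cos y / sqrt (1 - (C * sin y)\<^sup>2)"
    using * by simp
  then show ?thesis
    using C by (simp add: mult_less_cancel_left_pos flip: times_divide_eq_right)
qed

lemma convex_arcsin_mult_sin_domain:
  "convex {x. 0 < x \<and> x < pi/2 \<and> C * sin x < (1::real)}" if "C > 1"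
proof -
  have "convex {x \<in> {0<..<pi/2}. C * sin x < 1}"
    using that by (intro convex_sublevel_mono) (auto intro!: sin_monotone_2pi_le)
  then show ?thesis by (simp add: conj_assoc)
qed

lemma arcsin_mult_cosh_deriv:
  assumes s: "0 < s" and "0 < x" "s * cosh x < 1"
  shows "((\<lambda>x. arcsin (s * cosh x)) has_real_derivative s * sinh x / sqrt (1 - (s * cosh x)\<^sup>2)) (at x)"
proof -
  have "s * cosh x > 0" using s by simp
  then have "- 1 < s * cosh x" by linarith
  then show ?thesis
    using assms by (auto intro!: derivative_eq_intros simp: field_simps)
qed

text \<open>The numerator increases while the denominator decreases and stays positive.\<close>

lemma arcsin_mult_cosh_deriv_mono:
  assumes s: "0 < s" and x: "0 < x" and xy: "x < y" and y: "s * cosh y < (1::real)"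
  shows "s * sinh x / sqrt (1 - (s * cosh x)\<^sup>2) < s * sinh y / sqrt (1 - (s * cosh y)\<^sup>2)"
proof -
  have c: "cosh x < cosh y" using x xy by (intro cosh_real_strict_mono) auto
  have "(s * cosh x)\<^sup>2 < (s * cosh y)\<^sup>2"
    using s c by (intro power_strict_mono) auto
  moreover have "(s * cosh y)\<^sup>2 < 1"
    using y s by (intro power_less_one_iff[THEN iffD2]) auto
  ultimately have "0 < sqrt (1 - (s * cosh y)\<^sup>2)" "sqrt (1 - (s * cosh y)\<^sup>2) < sqrt (1 - (s * cosh x)\<^sup>2)"
    by auto
  moreover have "0 < s * sinh x" "s * sinh x < s * sinh y"
    using s x xy by (auto simp: sinh_real_strict_mono)
  ultimately show ?thesis
    by (intro frac_less) auto
qed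

lemma convex_arcsin_mult_cosh_domain:
  "convex {x. 0 < x \<and> s * cosh x < (1::real)}" if "s > 0"
proof -
  have "convex {x \<in> {0<..}. s * cosh x < 1}"
    using that by (intro convex_sublevel_mono) (auto simp: cosh_real_nonneg_le_iff)
  then show ?thesis by simp
qed

section \<open>Isometries of the Klein disc\<close>

text \<open>Minus the Lorentzian product of the vectors (1, x) and (1, y) of Minkowski space; the
  Klein disc is the central projection of the hyperboloid.\<close>

definition lform :: "complex \<Rightarrow> complex \<Rightarrow> real" where
  "lform x y = 1 - inner x y"

lemma lform_0 [simp]: "lform 0 y = 1" "lform y 0 = 1"
  by (simp_all add: lform_def)

lemma lform_self: "lform x x = 1 - (norm x)\<^sup>2"
  by (simp add: lform_def power2_norm_eq_inner)

lemma hplane_iff: "x \<in> hplane \<longleftrightarrow> norm x < 1"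
  by (simp add: hplane_def)

lemma zero_in_hplane [simp]: "0 \<in> hplane"
  by (simp add: hplane_iff)

lemma convex_hplane: "convex hplane" and open_hplane: "open hplane"
  by (auto simp: hplane_def)

lemma lform_pos:
  assumes "x \<in> hplane" "y \<in> hplane" shows "lform x y > 0"
proof -
  have "inner x y \<le> norm x * norm y" by (rule norm_cauchy_schwarz)
  also have "\<dots> < 1"
    using assms mult_strict_mono'[of "norm x" 1 "norm y" 1] by (simp add: hplane_iff)
  finally show ?thesis by (simp add: lform_def)
qed

text \<open>The gap between \<open>(1 - norm x * norm y)^2\<close> and
  \<open>lform x x * lform y y\<close> is the square of \<open>norm x - norm y\<close>. The
  inequality makes the argument of \<open>arcosh\<close> in \<open>hdist\<close> at least 1, so that
  \<open>cosh\<close> undoes it.\<close>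

lemma reversed_Cauchy_Schwarz:
  assumes "x \<in> hplane" "y \<in> hplane"
  shows "sqrt (lform x x) * sqrt (lform y y) \<le> lform x y"
proof -
  have "lform x x * lform y y \<le> (1 - norm x * norm y)\<^sup>2"
    using zero_le_power2[of "norm x - norm y"]
    by (simp add: lform_self power2_eq_square algebra_simps)
  also have "\<dots> \<le> (lform x y)\<^sup>2"
  proof (rule power_mono)
    show "1 - norm x * norm y \<le> lform x y"
      using norm_cauchy_schwarz[of x y] by (simp add: lform_def)
    show "0 \<le> 1 - norm x * norm y"
      using assms mult_mono[of "norm x" 1 "norm y" 1] by (simp add: hplane_iff)
  qed
  finally show ?thesis
    using lform_pos[OF assms] by (metis real_le_lsqrt real_sqrt_mult less_imp_le real_sqrt_le_mono real_sqrt_unique)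
qed

lemma cosh_hdist:
  assumes "x \<in> hplane" "y \<in> hplane"
  shows "cosh (hdist x y) = lform x y / (sqrt (lform x x) * sqrt (lform y y))"
proof -
  have "sqrt (lform x x) * sqrt (lform y y) > 0"
    using assms lform_pos by simp
  then have "lform x y / (sqrt (lform x x) * sqrt (lform y y)) \<ge> 1"
    using reversed_Cauchy_Schwarz[OF assms] by simp
  moreover have "hdist x y = arcosh (lform x y / (sqrt (lform x x) * sqrt (lform y y)))"
    by (simp add: hdist_def lform_self) (simp add: lform_def)
  ultimately show ?thesis
    by simp
qed

lemma hdist_nonneg:
  assumes "x \<in> hplane" "y \<in> hplane" shows "hdist x y \<ge> 0"
proof -
  have "sqrt (lform x x) * sqrt (lform y y) > 0"
    using assms lform_pos by simp
  then have "lform x y / (sqrt (lform x x) * sqrt (lform y y)) \<ge> 1"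
    using reversed_Cauchy_Schwarz[OF assms] by simp
  moreover have "hdist x y = arcosh (lform x y / (sqrt (lform x x) * sqrt (lform y y)))"
    by (simp add: hdist_def lform_self) (simp add: lform_def)
  ultimately show ?thesis
    by simp
qed

text \<open>In two secant directions the metric is, up to sign and scale, a 2 by 2 minor of the Gram
  matrix of the form. As geodesics are chords, the sides at a vertex have such directions.\<close>

lemma hmetric_eq_lform:
  assumes "x \<in> hplane"
  shows "hmetric x (y - x) (z - x) = (lform x y * lform x z - lform y z * lform x x) / (lform x x)\<^sup>2"
proof -
  have q: "lform x x > 0" using assms lform_pos by simp
  have 1: "inner (y - x) (z - x) = lform x y + lform x z - lform y z - lform x x"
    by (simp add: lform_def inner_diff algebra_simps inner_commute)
  have 2: "inner x (y - x) = lform x x - lform x y" "inner x (z - x) = lform x x - lform x z"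
    by (simp_all add: lform_def inner_diff)
  show ?thesis
    unfolding hmetric_def lform_self[symmetric] 1 2
    using q by (simp add: field_simps power2_eq_square)
qed

lemma hmetric_scaleR:
  "hmetric x (a *\<^sub>R u) (b *\<^sub>R v) = a * b * hmetric x u v"
  by (simp add: hmetric_def add_divide_distrib algebra_simps)

lemma hangle_scaleR:
  assumes "a > 0" "b > 0"
  shows "hangle x (a *\<^sub>R u) (b *\<^sub>R v) = hangle x u v"
proof -
  have "sqrt (a * a * s) = a * sqrt s" "sqrt (b * b * s) = b * sqrt s" for s
    using assms by (simp_all add: real_sqrt_mult)
  then show ?thesis
    using assms by (simp add: hangle_def hmetric_scaleR)
qed

text \<open>The weights cancel in the quotient that gives \<open>cosh (hdist x y)\<close>.\<close>

lemma hisometryI: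
  assumes bij: "bij_betw f hplane hplane"
    and w: "\<And>x. x \<in> hplane \<Longrightarrow> w x > 0"
    and L: "\<And>x y. x \<in> hplane \<Longrightarrow> y \<in> hplane \<Longrightarrow> lform x y = w x * w y * lform (f x) (f y)"
  shows "hisometry f"
proof -
  have "hdist (f x) (f y) = hdist x y" if "x \<in> hplane" "y \<in> hplane" for x y
  proof -
    have f: "f x \<in> hplane" "f y \<in> hplane"
      using that bij by (auto simp: bij_betw_def)
    have "sqrt (lform z z) = w z * sqrt (lform (f z) (f z))" if "z \<in> hplane" for z
      using that w[OF that] L[OF that that] by (simp add: real_sqrt_mult)
    then have "cosh (hdist (f x) (f y)) = cosh (hdist x y)"
      using that f L[OF that] w[OF that(1)] w[OF that(2)] by (simp add: cosh_hdist)
    then show ?thesis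
      using f that hdist_nonneg by (metis cosh_real_nonneg_le_iff order_antisym order_refl)
  qed
  then show ?thesis using bij by (simp add: hisometry_def)
qed

lemma hisometry_in: "hisometry f \<Longrightarrow> x \<in> hplane \<Longrightarrow> f x \<in> hplane"
  by (auto simp: hisometry_def bij_betw_def)

lemma hisometry_inj: "hisometry f \<Longrightarrow> inj_on f hplane"
  by (auto simp: hisometry_def bij_betw_def)

lemma hisometry_surj: "hisometry f \<Longrightarrow> y \<in> hplane \<Longrightarrow> \<exists>x\<in>hplane. f x = y"
  unfolding hisometry_def bij_betw_def by (metis imageE)

text \<open>Converse of \<open>hisometryI\<close>: the weight is forced to be the ratio of the
  Minkowski norms of x and f x. Afterwards an isometry can be treated like a linear map of Minkowski
  space followed by rescaling.\<close>

lemma hisometry_weight: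
  assumes f: "hisometry f"
  obtains w where "\<And>x. x \<in> hplane \<Longrightarrow> w x > 0"
    "\<And>x y. x \<in> hplane \<Longrightarrow> y \<in> hplane \<Longrightarrow> lform x y = w x * w y * lform (f x) (f y)"
proof
  let ?w = "\<lambda>x. sqrt (lform x x) / sqrt (lform (f x) (f x))"
  show "?w x > 0" if "x \<in> hplane" for x
    using that lform_pos hisometry_in[OF f] by simp
  show "lform x y = ?w x * ?w y * lform (f x) (f y)" if xy: "x \<in> hplane" "y \<in> hplane" for x y
  proof -
    have "cosh (hdist (f x) (f y)) = cosh (hdist x y)"
      using f xy by (simp add: hisometry_def)
    then have eq: "lform (f x) (f y) / (sqrt (lform (f x) (f x)) * sqrt (lform (f y) (f y)))
        = lform x y / (sqrt (lform x x) * sqrt (lform y y))"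
      using xy hisometry_in[OF f] by (simp add: cosh_hdist)
    have pos: "sqrt (lform z z) > 0" "sqrt (lform (f z) (f z)) > 0" if "z \<in> hplane" for z
      using that hisometry_in[OF f that] lform_pos by auto
    have "l = a / c * (b / d) * m" if "m / (c * d) = l / (a * b)" "a > 0" "b > 0" "c > 0" "d > 0"
      for a b c d l m :: real
      using that by (simp add: field_simps)
    from this[OF eq pos(1)[OF xy(1)] pos(1)[OF xy(2)] pos(2)[OF xy(1)] pos(2)[OF xy(2)]]
    show ?thesis .
  qed
qed

section \<open>Isometries as projective maps: chords, hulls, circles, angles\<close>

lemma hisometry_compose:
  assumes "hisometry f" "hisometry g" shows "hisometry (\<lambda>x. g (f x))"
proof -
  have "bij_betw (g \<circ> f) hplane hplane"
    using assms by (meson bij_betw_trans hisometry_def)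
  then show ?thesis
    using assms hisometry_in[OF assms(1)] by (simp add: hisometry_def o_def)
qed

lemma hisometry_inverse:
  assumes "hisometry f"
  obtains g where "hisometry g" "\<And>x. x \<in> hplane \<Longrightarrow> g (f x) = x" "\<And>x. x \<in> hplane \<Longrightarrow> f (g x) = x"
proof
  let ?g = "inv_into hplane f"
  have b: "bij_betw f hplane hplane" using assms by (simp add: hisometry_def)
  have g: "bij_betw ?g hplane hplane" using b by (rule bij_betw_inv_into)
  show 1: "f (?g x) = x" if "x \<in> hplane" for x
    using b that by (simp add: bij_betw_inv_into_right)
  show "?g (f x) = x" if "x \<in> hplane" for x
    using b that by (simp add: bij_betw_inv_into_left)
  show "hisometry ?g"
    unfolding hisometry_def
  proof (intro conjI ballI g)
    fix x y assume xy: "x \<in> hplane" "y \<in> hplane"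
    then have "?g x \<in> hplane" "?g y \<in> hplane" using g by (auto simp: bij_betw_def)
    then have "hdist (f (?g x)) (f (?g y)) = hdist (?g x) (?g y)"
      using assms by (simp add: hisometry_def)
    then show "hdist (?g x) (?g y) = hdist x y"
      using xy 1 by simp
  qed
qed

text \<open>The weighted equality \<open>w z * (1 - f z \<bullet> q) = (1 - t) * w x * (1 - f x \<bullet> q) + t * w y * (1 - f y \<bullet> q)\<close>
  holds for every \<open>q = f u\<close> in the disc, so it can be compared coefficientwise in \<open>q\<close>.\<close>

lemma hisometry_in_segment:
  assumes f: "hisometry f" and xy: "x \<in> hplane" "y \<in> hplane" and z: "z \<in> closed_segment x y"
  shows "f z \<in> closed_segment (f x) (f y)"
proof -
  obtain w where w: "\<And>x. x \<in> hplane \<Longrightarrow> w x > 0"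
    and L: "\<And>x y. x \<in> hplane \<Longrightarrow> y \<in> hplane \<Longrightarrow> lform x y = w x * w y * lform (f x) (f y)"
    using hisometry_weight[OF f] by metis
  obtain t where t: "0 \<le> t" "t \<le> 1" and zt: "z = (1 - t) *\<^sub>R x + t *\<^sub>R y"
    using z by (auto simp: in_segment)
  have zh: "z \<in> hplane"
    using z xy convex_hplane by (meson closed_segment_subset subsetD)
  have eq: "w z * lform (f z) q = (1 - t) * w x * lform (f x) q + t * w y * lform (f y) q" if "q \<in> hplane" for q
  proof -
    obtain u where u: "u \<in> hplane" "f u = q"
      using hisometry_surj[OF f \<open>q \<in> hplane\<close>] by auto
    have "lform z u = (1 - t) * lform x u + t * lform y u"
      by (simp add: zt lform_def inner_add_left algebra_simps)
    then have "w u * (w z * lform (f z) q) = w u * ((1 - t) * w x * lform (f x) q + t * w y * lform (f y) q)"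
      unfolding L[OF zh u(1)] L[OF xy(1) u(1)] L[OF xy(2) u(1)] u(2) by (simp add: algebra_simps)
    then show ?thesis using w[OF u(1)] by simp
  qed
  have wz: "w z = (1 - t) * w x + t * w y"
    using eq[of 0] by simp
  define v where "v = w z *\<^sub>R f z - ((1 - t) * w x) *\<^sub>R f x - (t * w y) *\<^sub>R f y"
  have v0: "inner v q = 0" if "q \<in> hplane" for q
  proof -
    have "w z - w z * inner (f z) q
        = (1 - t) * w x + t * w y - (1 - t) * w x * inner (f x) q - t * w y * inner (f y) q"
      using eq[OF that] by (simp add: lform_def right_diff_distrib)
    then show ?thesis
      using wz by (simp add: v_def inner_diff_left)
  qed
  have "inner v 1 = 0" "inner v \<i> = 0"
    using v0[of "1/2"] v0[of "\<i>/2"] by (simp_all add: hplane_iff norm_divide inner_complex_def)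
  then have "v = 0" by (simp add: inner_complex_def complex_eq_iff)
  then have "w z *\<^sub>R f z = ((1 - t) * w x) *\<^sub>R f x + (t * w y) *\<^sub>R f y"
    by (simp add: v_def algebra_simps)
  then have "inverse (w z) *\<^sub>R (w z *\<^sub>R f z) = inverse (w z) *\<^sub>R (((1 - t) * w x) *\<^sub>R f x + (t * w y) *\<^sub>R f y)"
    by simp
  then have fz: "f z = ((1 - t) * w x / w z) *\<^sub>R f x + (t * w y / w z) *\<^sub>R f y"
    using w[OF zh] by (simp add: scaleR_add_right divide_inverse mult.commute)
  have "(1 - t) * w x / w z = 1 - t * w y / w z"
    using w[OF zh] wz by (simp add: field_simps)
  moreover have "0 \<le> t * w y / w z"
    using t w zh xy by (simp add: less_imp_le)
  moreover have "t * w y / w z \<le> 1"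
    using w[OF zh] wz t w[OF xy(1)] by (simp add: divide_simps)
  ultimately show ?thesis
    unfolding in_segment fz by metis
qed

lemma hisometry_segment:
  assumes f: "hisometry f" and xy: "x \<in> hplane" "y \<in> hplane"
  shows "f ` closed_segment x y = closed_segment (f x) (f y)"
proof
  show "f ` closed_segment x y \<subseteq> closed_segment (f x) (f y)"
    using hisometry_in_segment[OF assms] by auto
  obtain g where g: "hisometry g" "\<And>x. x \<in> hplane \<Longrightarrow> g (f x) = x" "\<And>x. x \<in> hplane \<Longrightarrow> f (g x) = x"
    using hisometry_inverse[OF f] by metis
  have fxy: "f x \<in> hplane" "f y \<in> hplane" using hisometry_in[OF f] xy by auto
  show "closed_segment (f x) (f y) \<subseteq> f ` closed_segment x y"
  proof
    fix z assume z: "z \<in> closed_segment (f x) (f y)"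
    then have "z \<in> hplane"
      using fxy convex_hplane by (meson closed_segment_subset subsetD)
    moreover have "g z \<in> closed_segment x y"
      using hisometry_in_segment[OF g(1) fxy z] g(2) xy by simp
    ultimately show "z \<in> f ` closed_segment x y"
      using g(3) by (metis imageI)
  qed
qed

lemma hisometry_in_segment_iff:
  assumes f: "hisometry f" and "x \<in> hplane" "y \<in> hplane" "z \<in> hplane"
  shows "f z \<in> closed_segment (f x) (f y) \<longleftrightarrow> z \<in> closed_segment x y"
proof -
  have "closed_segment x y \<subseteq> hplane"
    using assms convex_hplane by (simp add: closed_segment_subset)
  then show ?thesis
    using hisometry_segment[OF assms(1-3)] hisometry_inj[OF f] assms(4) inj_on_image_mem_iff by metis
qed

lemma hisometry_collinear_iff:
  assumes f: "hisometry f" and "x \<in> hplane" "y \<in> hplane" "z \<in> hplane"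
  shows "collinear {f x, f y, f z} \<longleftrightarrow> collinear {x, y, z}"
  using assms by (simp add: collinear_between_cases between_mem_segment hisometry_in_segment_iff)

lemma hisometry_convex_image:
  assumes f: "hisometry f" and C: "C \<subseteq> hplane" "convex C"
  shows "convex (f ` C)"
  unfolding convex_contains_segment
proof (intro ballI)
  fix a b assume "a \<in> f ` C" "b \<in> f ` C"
  then obtain x y where xy: "x \<in> C" "y \<in> C" "a = f x" "b = f y" by auto
  then have "closed_segment a b = f ` closed_segment x y"
    using hisometry_segment[OF f] C by auto
  moreover have "closed_segment x y \<subseteq> C"
    using xy C by (simp add: closed_segment_subset)
  ultimately show "closed_segment a b \<subseteq> f ` C" by auto
qed

text \<open>One inclusion is minimality of the hull, since images of convex sets are convex; the
  other is the same inclusion for the inverse isometry.\<close>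

lemma hisometry_convex_hull:
  assumes f: "hisometry f" and S: "S \<subseteq> hplane"
  shows "f ` (convex hull S) = convex hull (f ` S)"
proof -
  have sub: "convex hull (h ` A) \<subseteq> h ` (convex hull A)" if "hisometry h" "A \<subseteq> hplane" for h A
  proof (rule hull_minimal)
    show "h ` A \<subseteq> h ` (convex hull A)" using hull_subset[of A convex] by blast
    show "convex (h ` (convex hull A))"
      using that convex_hplane by (intro hisometry_convex_image) (auto simp: hull_minimal)
  qed
  obtain g where g: "hisometry g" "\<And>x. x \<in> hplane \<Longrightarrow> g (f x) = x" "\<And>x. x \<in> hplane \<Longrightarrow> f (g x) = x"
    using hisometry_inverse[OF f] by metis
  have fS: "f ` S \<subseteq> hplane" using S hisometry_in[OF f] by auto
  have "g ` f ` S = S"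
    using S g(2) by (force simp: image_image)
  then have "convex hull S \<subseteq> g ` (convex hull (f ` S))"
    using sub[OF g(1) fS] by simp
  then have "f ` (convex hull S) \<subseteq> f ` g ` (convex hull (f ` S))" by blast
  also have "\<dots> = convex hull (f ` S)"
    using g(3) hull_minimal[OF fS, of convex] convex_hplane by (force simp: image_image)
  finally show ?thesis using sub[OF f S] by blast
qed

lemma hline_eq:
  assumes "a \<noteq> b"
  shows "hline a b = {x \<in> hplane. collinear {a, b, x}}"
  using assms by (auto simp: hline_def collinear_3_affine_hull)

lemma hisometry_hline:
  assumes f: "hisometry f" and ab: "a \<in> hplane" "b \<in> hplane" "a \<noteq> b"
  shows "hline (f a) (f b) = f ` hline a b"
proof -
  have ne: "f a \<noteq> f b" using ab hisometry_inj[OF f] by (auto dest: inj_onD)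
  show ?thesis
    unfolding hline_eq[OF ab(3)] hline_eq[OF ne]
    using hisometry_collinear_iff[OF f ab(1,2)] hisometry_surj[OF f] hisometry_in[OF f]
    by (auto simp: image_iff) metis
qed

lemma hisometry_hcircle:
  assumes f: "hisometry f" and c: "c \<in> hplane"
  shows "hcircle (f c) r = f ` hcircle c r"
proof -
  have "hdist (f c) (f x) = hdist c x" if "x \<in> hplane" for x
    using f c that by (simp add: hisometry_def)
  then show ?thesis
    unfolding hcircle_def using hisometry_surj[OF f] hisometry_in[OF f] by (auto simp: image_iff) metis
qed

text \<open>The values of the form against \<open>u0\<close>, \<open>u1\<close>, \<open>u2\<close>,
  the points with images 0, 1/2 and i/2, determine f x: the first gives the weight, the others the
  two coordinates. So f is a quotient of affine functions with nonvanishing denominator.\<close>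

lemma hisometry_continuous:
  assumes f: "hisometry f"
  shows "continuous_on hplane f"
proof -
  obtain w where w: "\<And>x. x \<in> hplane \<Longrightarrow> w x > 0"
    and L: "\<And>x y. x \<in> hplane \<Longrightarrow> y \<in> hplane \<Longrightarrow> lform x y = w x * w y * lform (f x) (f y)"
    using hisometry_weight[OF f] by metis
  obtain u0 where u0: "u0 \<in> hplane" "f u0 = 0" using hisometry_surj[OF f, of 0] by auto
  obtain u1 where u1: "u1 \<in> hplane" "f u1 = 1/2"
    using hisometry_surj[OF f, of "1/2"] by (auto simp: hplane_iff)
  obtain u2 where u2: "u2 \<in> hplane" "f u2 = \<i>/2"
    using hisometry_surj[OF f, of "\<i>/2"] by (auto simp: hplane_iff norm_divide)
  have pos: "w u0 > 0" "w u1 > 0" "w u2 > 0" using w u0 u1 u2 by auto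
  have wx: "w x = lform x u0 / w u0" if "x \<in> hplane" for x
    using L[OF that u0(1)] u0 pos by simp
  have L0: "lform x u0 > 0" if "x \<in> hplane" for x using lform_pos that u0 by auto
  define F where "F x = Complex (2 - 2 * (lform x u1 / w u1) / (lform x u0 / w u0))
     (2 - 2 * (lform x u2 / w u2) / (lform x u0 / w u0))" for x
  have "f x = F x" if "x \<in> hplane" for x
    using L[OF that u1(1)] L[OF that u2(1)] u1 u2 pos w[OF that]
    by (simp add: F_def complex_eq_iff flip: wx[OF that])
       (simp add: lform_def inner_complex_def field_simps)
  moreover have "continuous_on hplane F"
    unfolding F_def lform_def using L0 pos
    by (intro continuous_intros) (force simp: lform_def)+
  ultimately show ?thesis by (simp cong: continuous_on_cong)
qed

text \<open>Metric values change by the factor \<open>w p * w q / (w x)^2\<close>, a product of one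
  contribution for each direction, which drops out of the cosine.\<close>

lemma hisometry_hangle:
  assumes f: "hisometry f" and xyz: "x \<in> hplane" "y \<in> hplane" "z \<in> hplane"
  shows "hangle (f x) (f y - f x) (f z - f x) = hangle x (y - x) (z - x)"
proof -
  obtain w where w: "\<And>x. x \<in> hplane \<Longrightarrow> w x > 0"
    and L: "\<And>x y. x \<in> hplane \<Longrightarrow> y \<in> hplane \<Longrightarrow> lform x y = w x * w y * lform (f x) (f y)"
    using hisometry_weight[OF f] by metis
  have pos: "w x > 0" "w y > 0" "w z > 0" "lform (f x) (f x) > 0"
    using w xyz hisometry_in[OF f] lform_pos by auto
  have *: "hmetric x (p - x) (q - x) = w p * w q / (w x)\<^sup>2 * hmetric (f x) (f p - f x) (f q - f x)"
    if "p \<in> hplane" "q \<in> hplane" for p q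
  proof -
    have alg: "(a * b * l * (a * c * m) - b * c * n * (a * a * k)) / (a * a * k)\<^sup>2
        = b * c / a\<^sup>2 * ((l * m - n * k) / k\<^sup>2)" if "a > 0" "k > 0" for a b c k l m n :: real
      using that by (simp add: field_simps power2_eq_square)
    show ?thesis
      unfolding hmetric_eq_lform[OF xyz(1)] hmetric_eq_lform[OF hisometry_in[OF f xyz(1)]]
        L[OF xyz(1) xyz(1)] L[OF xyz(1) that(1)] L[OF xyz(1) that(2)] L[OF that]
      by (rule alg[OF pos(1,4)])
  qed
  have s: "sqrt (w p * w p / (w x)\<^sup>2 * m) = w p / w x * sqrt m" if "p \<in> hplane" for p m
    using pos w[OF that] by (simp add: real_sqrt_mult real_sqrt_divide)
  show ?thesis
    unfolding hangle_def *[OF xyz(2,2)] *[OF xyz(3,3)] *[OF xyz(2,3)] s[OF xyz(2)] s[OF xyz(3)]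
    using pos by (simp add: power2_eq_square)
qed

section \<open>Explicit isometries: reflection, rotations, boosts\<close>

lemma hisometry_cnj: "hisometry cnj"
proof (rule hisometryI[of _ "\<lambda>_. 1"])
  show "bij_betw cnj hplane hplane"
    by (rule bij_betw_byWitness[of _ cnj]) (auto simp: hplane_iff)
qed (auto simp: lform_def inner_complex_def)

lemma inner_cis_mult: "inner (cis t * x) (cis t * y) = inner x y"
proof -
  have "inner (cis t * x) (cis t * y) = ((cos t)\<^sup>2 + (sin t)\<^sup>2) * inner x y"
    unfolding inner_complex_def by (simp add: algebra_simps power2_eq_square del: sin_cos_squared_add sin_cos_squared_add2 sin_cos_squared_add3)
  then show ?thesis by simp
qed

lemma hisometry_rotation: "hisometry (\<lambda>x. cis t * x)"
proof (rule hisometryI[of _ "\<lambda>_. 1"])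
  show "bij_betw (\<lambda>x. cis t * x) hplane hplane"
    by (rule bij_betw_byWitness[of _ "\<lambda>x. cis (-t) * x"])
       (auto simp: hplane_iff norm_mult cis_mult simp flip: mult.assoc)
qed (auto simp: lform_def inner_cis_mult)

text \<open>The Lorentz boost along the real axis in projective coordinates; it moves the real point
  b to the origin.\<close>

definition boost :: "real \<Rightarrow> complex \<Rightarrow> complex" where
  "boost b x = Complex ((Re x - b) / (1 - b * Re x)) (sqrt (1 - b\<^sup>2) * Im x / (1 - b * Re x))"

lemma boost_denom_pos:
  assumes "\<bar>b\<bar> < 1" "x \<in> hplane" shows "1 - b * Re x > 0"
proof -
  have "\<bar>Re x\<bar> < 1" using assms abs_Re_le_cmod[of x] by (simp add: hplane_iff)
  then have "\<bar>b\<bar> * \<bar>Re x\<bar> < 1" using assms mult_strict_mono'[of "\<bar>b\<bar>" 1 "\<bar>Re x\<bar>" 1] by simp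
  then have "\<bar>b * Re x\<bar> < 1" by (simp add: abs_mult)
  then show ?thesis by linarith
qed

lemma lform_boost:
  assumes b: "\<bar>b\<bar> < 1" and xy: "x \<in> hplane" "y \<in> hplane"
  shows "lform (boost b x) (boost b y) = (1 - b\<^sup>2) * lform x y / ((1 - b * Re x) * (1 - b * Re y))"
proof -
  have b2: "b\<^sup>2 < 1" using b by (simp add: abs_square_less_1)
  then have s: "sqrt (1 - b\<^sup>2) * sqrt (1 - b\<^sup>2) = 1 - b\<^sup>2" by simp
  have pos: "1 - b * Re x > 0" "1 - b * Re y > 0"
    using boost_denom_pos b xy by auto
  have *: "1 - (p / d * (q / e) + s * i / d * (s * j / e)) = (d * e - p * q - (s * s) * i * j) / (d * e)"
    if "d > 0" "e > 0" for d e p q s i j :: real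
    using that by (simp add: field_simps)
  have "lform (boost b x) (boost b y) = ((1 - b * Re x) * (1 - b * Re y) - (Re x - b) * (Re y - b)
      - (sqrt (1 - b\<^sup>2) * sqrt (1 - b\<^sup>2)) * Im x * Im y) / ((1 - b * Re x) * (1 - b * Re y))"
    using *[OF pos] by (simp add: lform_def boost_def inner_complex_def)
  also have "\<dots> = (1 - b\<^sup>2) * lform x y / ((1 - b * Re x) * (1 - b * Re y))"
    unfolding s by (simp add: lform_def inner_complex_def power2_eq_square algebra_simps)
  finally show ?thesis .
qed

lemma boost_in_hplane:
  assumes b: "\<bar>b\<bar> < 1" and x: "x \<in> hplane" shows "boost b x \<in> hplane"
proof -
  have "b\<^sup>2 < 1" using b by (simp add: abs_square_less_1)
  then have "lform (boost b x) (boost b x) > 0"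
    using boost_denom_pos[OF b x] lform_pos[OF x x] by (simp add: lform_boost[OF b x x])
  then show ?thesis by (simp add: lform_self hplane_iff abs_square_less_1[of "norm _", simplified])
qed

lemma boost_inverse:
  assumes b: "\<bar>b\<bar> < 1" and x: "x \<in> hplane" shows "boost (- b) (boost b x) = x"
proof -
  define d where "d = 1 - b * Re x"
  have d: "d > 0" using boost_denom_pos[OF b x] by (simp add: d_def)
  have b2: "1 - b\<^sup>2 > 0" using b by (simp add: abs_square_less_1)
  have D: "1 + b * (Re x - b) / d = (1 - b\<^sup>2) / d"
    using d by (simp add: divide_simps) (simp add: d_def power2_eq_square algebra_simps)
  have N: "(Re x - b) / d + b = Re x * (1 - b\<^sup>2) / d"
    using d by (simp add: divide_simps) (simp add: d_def power2_eq_square algebra_simps)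
  have s: "sqrt (1 - b\<^sup>2) * (sqrt (1 - b\<^sup>2) * i) = (1 - b\<^sup>2) * i" for i
    using b2 by (simp flip: mult.assoc)
  show ?thesis
    unfolding boost_def d_def[symmetric] using d b2 by (simp add: complex_eq_iff D N s)
qed

lemma hisometry_boost:
  assumes b: "\<bar>b\<bar> < 1" shows "hisometry (boost b)"
proof (rule hisometryI[of _ "\<lambda>x. (1 - b * Re x) / sqrt (1 - b\<^sup>2)"])
  have b2: "b\<^sup>2 < 1" using b by (simp add: abs_square_less_1)
  show "bij_betw (boost b) hplane hplane"
    using boost_inverse[of b] boost_inverse[of "- b"] boost_in_hplane[of b] boost_in_hplane[of "- b"] b
    by (intro bij_betw_byWitness[of _ "boost (- b)"]) auto
  show "(1 - b * Re x) / sqrt (1 - b\<^sup>2) > 0" if "x \<in> hplane" for x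
    using boost_denom_pos[OF b that] b2 by simp
  show "lform x y = (1 - b * Re x) / sqrt (1 - b\<^sup>2) * ((1 - b * Re y) / sqrt (1 - b\<^sup>2)) * lform (boost b x) (boost b y)"
    if "x \<in> hplane" "y \<in> hplane" for x y
  proof -
    have s: "sqrt (1 - b\<^sup>2) * sqrt (1 - b\<^sup>2) = 1 - b\<^sup>2" using b2 by simp
    show ?thesis
      unfolding lform_boost[OF b that] times_divide_times_eq s
      using boost_denom_pos[OF b that(1)] boost_denom_pos[OF b that(2)] b2 by simp
  qed
qed

lemma boost_centre: "boost b (of_real b) = 0"
  by (simp add: boost_def complex_eq_iff)

text \<open>With the centre fixed all weights are 1: \<open>w 0\<close> is positive with square 1,
  and comparison with 0 gives \<open>w x\<close>. So inner products are preserved and f restricts an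
  orthogonal linear map, whose columns are read off at 1/2 and i/2.\<close>

lemma hisometry_fixing_0:
  assumes f: "hisometry f" and f0: "f 0 = 0"
  obtains a b where "norm a = 1" "norm b = 1" "inner a b = 0"
    "\<And>x. x \<in> hplane \<Longrightarrow> f x = Re x *\<^sub>R a + Im x *\<^sub>R b"
proof -
  obtain w where w: "\<And>x. x \<in> hplane \<Longrightarrow> w x > 0"
    and L: "\<And>x y. x \<in> hplane \<Longrightarrow> y \<in> hplane \<Longrightarrow> lform x y = w x * w y * lform (f x) (f y)"
    using hisometry_weight[OF f] by metis
  have "(w 0)\<^sup>2 = 1" using L[of 0 0] f0 by (simp add: power2_eq_square)
  then have w0: "w 0 = 1" using w[of 0] by (simp add: power2_eq_1_iff)
  have w1: "w x = 1" if "x \<in> hplane" for x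
    using L[OF zero_in_hplane that] f0 w0 by simp
  have I: "inner (f x) (f y) = inner x y" if "x \<in> hplane" "y \<in> hplane" for x y
    using L[OF that] that w1 by (simp add: lform_def)
  have h: "1/2 \<in> hplane" "\<i>/2 \<in> hplane" by (auto simp: hplane_iff norm_divide)
  define a b where "a = 2 *\<^sub>R f (1/2)" and "b = 2 *\<^sub>R f (\<i>/2)"
  have i: "inner a a = 1" "inner b b = 1" "inner a b = 0"
    unfolding a_def b_def inner_scaleR_left inner_scaleR_right I[OF h(1) h(1)] I[OF h(1) h(2)] I[OF h(2) h(2)]
    by (simp_all add: inner_complex_def)
  have "f x = Re x *\<^sub>R a + Im x *\<^sub>R b" if x: "x \<in> hplane" for x
  proof -
    have xi: "inner (f x) a = Re x" "inner (f x) b = Im x" "inner (f x) (f x) = (Re x)\<^sup>2 + (Im x)\<^sup>2"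
      unfolding a_def b_def inner_scaleR_right I[OF x h(1)] I[OF x h(2)] I[OF x x]
      by (simp_all add: inner_complex_def power2_eq_square)
    \<comment> \<open>The squared distance from the expected value vanishes when expanded in the
      preserved inner products.\<close>
    have "inner (f x - Re x *\<^sub>R a - Im x *\<^sub>R b) (f x - Re x *\<^sub>R a - Im x *\<^sub>R b) = 0"
      using xi i by (simp add: inner_diff inner_commute[of a "f x"] inner_commute[of b "f x"] inner_commute[of b a]
          power2_eq_square algebra_simps)
    then have "f x - Re x *\<^sub>R a - Im x *\<^sub>R b = 0"
      by (simp only: inner_eq_zero_iff)
    then show ?thesis by (simp add: algebra_simps)
  qed
  moreover have "norm a = 1" "norm b = 1" using i by (simp_all add: norm_eq_sqrt_inner)
  ultimately show ?thesis using that i by blast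
qed

section \<open>Hyperbolic area\<close>

definition hdensity :: "complex \<Rightarrow> real" where
  "hdensity x = (1 - (norm x)\<^sup>2) powr (-3/2)"

lemma powr_minus_three_halves: "u > 0 \<Longrightarrow> u powr (-3/2) = 1 / (u * sqrt u)" for u :: real
proof -
  assume u: "u > 0"
  have "u powr (-3/2) = u powr (- 1 + - (1/2))" by simp
  also have "\<dots> = u powr - 1 * u powr - (1/2)" by (simp only: powr_add)
  also have "\<dots> = 1 / (u * sqrt u)"
    using u by (simp add: powr_minus powr_half_sqrt divide_simps)
  finally show ?thesis .
qed

lemma hdensity_eq: "x \<in> hplane \<Longrightarrow> hdensity x = 1 / (lform x x * sqrt (lform x x))"
  using lform_pos[of x x] powr_minus_three_halves[of "lform x x"] by (simp add: hdensity_def lform_self)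

lemma hdensity_nonneg: "hdensity x \<ge> 0"
  by (simp add: hdensity_def)

lemma hdensity_measurable [measurable]: "hdensity \<in> borel_measurable borel"
  unfolding hdensity_def by measurable

lemma continuous_on_hdensity: "continuous_on hplane hdensity"
  unfolding hdensity_def
  by (intro continuous_intros) (auto simp: hplane_iff abs_square_eq_1)

text \<open>\<open>integral_change_of_variables\<close> and \<open>det\<close> speak of vectors and
  matrices; this linear identification carries plane integrals over to
  \<open>real^2\<close>.\<close>

definition complex_of_vec :: "real^2 \<Rightarrow> complex" where
  "complex_of_vec y = Complex (y $ 1) (y $ 2)"

definition vec_of_complex :: "complex \<Rightarrow> real^2" where
  "vec_of_complex z = vector [Re z, Im z]"

lemma vec_complex_inverse [simp]:
  "complex_of_vec (vec_of_complex z) = z" "vec_of_complex (complex_of_vec y) = y"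
  by (simp_all add: complex_of_vec_def vec_of_complex_def vec_eq_iff forall_2)

lemma bounded_linear_complex_of_vec: "bounded_linear complex_of_vec"
  by (rule linear_conv_bounded_linear[THEN iffD1], rule linearI)
     (auto simp: complex_of_vec_def complex_eq_iff)

lemma bounded_linear_vec_of_complex: "bounded_linear vec_of_complex"
  by (rule linear_conv_bounded_linear[THEN iffD1], rule linearI)
     (auto simp: vec_of_complex_def vec_eq_iff forall_2)

lemma complex_of_vec_vimage: "complex_of_vec -` S = vec_of_complex ` S"
  by (auto simp: image_iff) (metis vec_complex_inverse)

lemma lborel_complex_eq_distr_vec: "(lborel :: complex measure) = distr lborel borel complex_of_vec"
proof (rule lborel_eqI)
  have [measurable]: "complex_of_vec \<in> borel_measurable borel"
    by (intro borel_measurable_continuous_onI linear_continuous_on bounded_linear_complex_of_vec)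
  fix l u :: complex assume le: "\<And>b. b \<in> Basis \<Longrightarrow> l \<bullet> b \<le> u \<bullet> b"
  have le': "Re l \<le> Re u" "Im l \<le> Im u"
    using le[of 1] le[of \<i>] by (auto simp: Basis_complex_def)
  have "complex_of_vec -` box l u = box (vec_of_complex l) (vec_of_complex u)"
    by (auto simp: box_def Basis_complex_def complex_of_vec_def vec_of_complex_def Basis_vec_def inner_axis forall_2)
  then have "emeasure (distr lborel borel complex_of_vec) (box l u) = emeasure lborel (box (vec_of_complex l) (vec_of_complex u))"
    by (simp add: emeasure_distr)
  also have "\<dots> = (\<Prod>b\<in>Basis. (vec_of_complex u - vec_of_complex l) \<bullet> b)"
    using le' by (intro emeasure_lborel_box) (auto simp: Basis_vec_def inner_axis vec_of_complex_def UNIV_2)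
  also have "(\<Prod>b\<in>Basis. (vec_of_complex u - vec_of_complex l) \<bullet> b) = (Re u - Re l) * (Im u - Im l)"
  proof -
    have B: "(Basis :: (real^2) set) = {axis 1 1, axis 2 1}"
      by (auto simp: Basis_vec_def UNIV_2)
    show ?thesis
      by (simp add: B axis_eq_axis inner_axis vec_of_complex_def)
  qed
  also have "\<dots> = (\<Prod>b\<in>Basis. (u - l) \<bullet> b)"
    by (simp add: Basis_complex_def)
  finally show "emeasure (distr lborel borel complex_of_vec) (box l u) = (\<Prod>b\<in>Basis. (u - l) \<bullet> b)" .
qed simp

lemma harea_eq_integral_vec:
  assumes S: "compact S" "S \<subseteq> hplane"
  shows "(\<lambda>y. hdensity (complex_of_vec y)) absolutely_integrable_on vec_of_complex ` S"
    "harea S = integral (vec_of_complex ` S) (\<lambda>y. hdensity (complex_of_vec y))"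
proof -
  let ?d = "\<lambda>y. hdensity (complex_of_vec y)" and ?S = "vec_of_complex ` S"
  have meas[measurable]: "complex_of_vec \<in> borel_measurable borel"
    by (intro borel_measurable_continuous_onI linear_continuous_on bounded_linear_complex_of_vec)
  have [measurable]: "S \<in> sets borel" using S by (simp add: borel_compact)
  have cS: "compact ?S"
    by (intro compact_continuous_image linear_continuous_on bounded_linear_vec_of_complex S)
  have "continuous_on ?S ?d"
    using S by (intro continuous_on_compose2[OF continuous_on_hdensity]
        linear_continuous_on bounded_linear_complex_of_vec) auto
  then have int: "set_integrable lborel ?S ?d"
    unfolding set_integrable_def using cS by (intro borel_integrable_compact)
  then show "?d absolutely_integrable_on ?S"
    unfolding set_integrable_def by (rule integrable_completion[THEN iffD2, rotated])
      (use cS[THEN borel_compact] in measurable)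
  have "harea S = (\<integral>x. indicator S x *\<^sub>R hdensity x \<partial>lborel)"
    by (simp add: harea_def set_lebesgue_integral_def hdensity_def)
  also have "\<dots> = (\<integral>y. indicator S (complex_of_vec y) *\<^sub>R hdensity (complex_of_vec y) \<partial>lborel)"
    by (subst lborel_complex_eq_distr_vec, subst integral_distr) auto
  also have "\<dots> = (LINT y:?S|lborel. ?d y)"
  proof -
    have "indicator S (complex_of_vec y) = (indicator ?S y :: real)" for y
      using complex_of_vec_vimage[of S] by (auto simp: indicator_def)
    then show ?thesis by (simp add: set_lebesgue_integral_def)
  qed
  also have "\<dots> = integral ?S ?d"
    using int by (rule set_borel_integral_eq_integral)
  finally show "harea S = integral ?S ?d" .
qed

text \<open>The difference of products in the last hypothesis is the Jacobian determinant of g in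
  the basis 1, i. The hypothesis says that g preserves the hyperbolic area element
  pointwise.\<close>

lemma harea_change_of_variables:
  assumes S: "compact S" "S \<subseteq> hplane" and g: "g ` S \<subseteq> hplane" "inj_on g S"
    and der: "\<And>x. x \<in> S \<Longrightarrow> (g has_derivative g' x) (at x)"
    and dens: "\<And>x. x \<in> S \<Longrightarrow>
      \<bar>Re (g' x 1) * Im (g' x \<i>) - Re (g' x \<i>) * Im (g' x 1)\<bar> * hdensity (g x) = hdensity x"
  shows "harea (g ` S) = harea S"
proof -
  let ?S = "vec_of_complex ` S"
  define G where "G y = vec_of_complex (g (complex_of_vec y))" for y
  define G' where "G' y v = vec_of_complex (g' (complex_of_vec y) (complex_of_vec v))" for y v
  \<comment> \<open>The change of variables is for vector-valued integrands, hence the values in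
    \<open>real^1\<close>.\<close>
  define f :: "real^2 \<Rightarrow> real^1" where "f y = vec (hdensity (complex_of_vec y))" for y
  have cg: "compact (g ` S)"
    using S der by (intro compact_continuous_image)
      (auto intro!: continuous_at_imp_continuous_on has_derivative_continuous)
  have GS: "G ` ?S = vec_of_complex ` g ` S"
    by (auto simp: G_def image_image)
  have cS: "compact ?S"
    by (intro compact_continuous_image linear_continuous_on bounded_linear_vec_of_complex S)
  have d: "(G has_derivative G' y) (at y within ?S)" if "y \<in> ?S" for y
  proof -
    have 1: "(complex_of_vec has_derivative complex_of_vec) (at y within ?S)"
      by (rule bounded_linear_imp_has_derivative[OF bounded_linear_complex_of_vec])
    have 2: "(g has_derivative g' (complex_of_vec y)) (at (complex_of_vec y))"
      using that der by auto
    have 3: "(vec_of_complex has_derivative vec_of_complex) (at z)" for z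
      by (rule bounded_linear_imp_has_derivative[OF bounded_linear_vec_of_complex])
    have "((\<lambda>y. g (complex_of_vec y)) has_derivative (\<lambda>v. g' (complex_of_vec y) (complex_of_vec v))) (at y within ?S)"
      by (rule has_derivative_compose[OF 1 2])
    from has_derivative_compose[OF this 3] show ?thesis
      by (simp add: G_def[abs_def] G'_def[abs_def])
  qed
  have inj: "inj_on G ?S"
    using g(2) by (auto simp: inj_on_def G_def) (metis vec_complex_inverse(1))
  have det: "\<bar>det (matrix (G' y))\<bar> *\<^sub>R f (G y) = f y" if y: "y \<in> ?S" for y
  proof -
    have e: "complex_of_vec (axis 1 1) = 1" "complex_of_vec (axis 2 1) = \<i>"
      by (simp_all add: complex_of_vec_def complex_eq_iff axis_def)
    have "det (matrix (G' y)) = Re (g' (complex_of_vec y) 1) * Im (g' (complex_of_vec y) \<i>)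
        - Re (g' (complex_of_vec y) \<i>) * Im (g' (complex_of_vec y) 1)"
      by (simp add: det_2 matrix_def G'_def e) (simp add: vec_of_complex_def)
    then show ?thesis
      using dens[of "complex_of_vec y"] y by (auto simp: f_def G_def vec_eq_iff)
  qed
  have fint: "f absolutely_integrable_on G ` ?S"
    using harea_eq_integral_vec(1)[OF cg g(1)] by (simp add: GS absolutely_integrable_on_1_iff f_def)
  have "integral (G ` ?S) f = integral ?S (\<lambda>y. \<bar>det (matrix (G' y))\<bar> *\<^sub>R f (G y))"
    using lmeasurable_compact[OF cS] d inj fint by (intro integral_change_of_variables) (auto dest: fmeasurableD)
  also have "\<dots> = integral ?S f"
    by (intro integral_cong det)
  finally have "integral (G ` ?S) f = integral ?S f" .
  then show ?thesis
    using harea_eq_integral_vec(2)[OF S] harea_eq_integral_vec(2)[OF cg g(1)]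
    by (simp add: GS integral_on_1_eq f_def vec_eq_iff)
qed

section \<open>Invariance of the hyperbolic area\<close>

lemma boost_has_derivative:
  assumes "1 - b * Re x \<noteq> 0"
  shows "(boost b has_derivative (\<lambda>v. Complex ((1 - b\<^sup>2) * Re v / (1 - b * Re x)\<^sup>2)
     (sqrt (1 - b\<^sup>2) * (Im v / (1 - b * Re x) + b * Im x * Re v / (1 - b * Re x)\<^sup>2)))) (at x)"
proof -
  have d: "((\<lambda>x. 1 - b * Re x) has_derivative (\<lambda>v. 0 - b * Re v)) (at x)"
    by (intro has_derivative_diff has_derivative_const has_derivative_mult_right has_derivative_Re has_derivative_ident)
  have "((\<lambda>x. Re x - b) has_derivative (\<lambda>v. Re v - 0)) (at x)"
    by (intro has_derivative_diff has_derivative_const has_derivative_Re has_derivative_ident)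
  from has_derivative_divide'[OF this d assms]
  have 1: "((\<lambda>x. (Re x - b) / (1 - b * Re x)) has_derivative (\<lambda>v. (1 - b\<^sup>2) * Re v / (1 - b * Re x)\<^sup>2)) (at x)"
    by (rule has_derivative_eq_rhs) (simp add: fun_eq_iff power2_eq_square algebra_simps)
  have "((\<lambda>x. sqrt (1 - b\<^sup>2) * Im x) has_derivative (\<lambda>v. sqrt (1 - b\<^sup>2) * Im v)) (at x)"
    by (intro has_derivative_mult_right has_derivative_Im has_derivative_ident)
  from has_derivative_divide'[OF this d assms]
  have 2: "((\<lambda>x. sqrt (1 - b\<^sup>2) * Im x / (1 - b * Re x)) has_derivative
     (\<lambda>v. sqrt (1 - b\<^sup>2) * (Im v / (1 - b * Re x) + b * Im x * Re v / (1 - b * Re x)\<^sup>2))) (at x)"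
  proof (rule has_derivative_eq_rhs)
    have "(s * i * e - s * j * (0 - b * r)) / (e * e) = s * (i / e + b * j * r / e\<^sup>2)" if "e \<noteq> 0" for s i e j r :: real
      using that by (simp add: divide_simps power2_eq_square) (simp add: algebra_simps)
    from this[OF assms] show "(\<lambda>v. (sqrt (1 - b\<^sup>2) * Im v * (1 - b * Re x) - sqrt (1 - b\<^sup>2) * Im x * (0 - b * Re v)) /
       ((1 - b * Re x) * (1 - b * Re x))) = (\<lambda>v. sqrt (1 - b\<^sup>2) * (Im v / (1 - b * Re x) + b * Im x * Re v / (1 - b * Re x)\<^sup>2))"
      by (intro ext)
  qed
  show ?thesis
    unfolding boost_def[abs_def] Complex_eq
    by (intro has_derivative_add has_derivative_mult_right has_derivative_of_real 1 2)
qed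

text \<open>The derivative is triangular with determinant \<open>q * sqrt q / e^3\<close>, while the
  form at the image point is \<open>q * lform x x / e^2\<close>; its power -3/2 contributes exactly
  the inverse factor.\<close>

lemma harea_boost:
  assumes b: "\<bar>b\<bar> < 1" and S: "compact S" "S \<subseteq> hplane"
  shows "harea (boost b ` S) = harea S"
proof (rule harea_change_of_variables[OF S])
  show "boost b ` S \<subseteq> hplane" using boost_in_hplane[OF b] S by auto
  show "inj_on (boost b) S"
    using hisometry_inj[OF hisometry_boost[OF b]] S by (meson inj_on_subset)
  fix x assume "x \<in> S"
  then have x: "x \<in> hplane" using S by auto
  have d: "1 - b * Re x > 0" by (rule boost_denom_pos[OF b x])
  show "(boost b has_derivative (\<lambda>v. Complex ((1 - b\<^sup>2) * Re v / (1 - b * Re x)\<^sup>2)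
     (sqrt (1 - b\<^sup>2) * (Im v / (1 - b * Re x) + b * Im x * Re v / (1 - b * Re x)\<^sup>2)))) (at x)"
    using d by (intro boost_has_derivative) simp
  define e q where "e = 1 - b * Re x" and "q = 1 - b\<^sup>2"
  have pos: "e > 0" "q > 0" "lform x x > 0"
    using d b lform_pos[OF x x] by (auto simp: e_def q_def abs_square_less_1)
  have L: "lform (boost b x) (boost b x) = q * lform x x / (e * e)"
    using lform_boost[OF b x x] by (simp add: e_def q_def)
  have s: "sqrt (q * lform x x / (e * e)) = sqrt q * sqrt (lform x x) / e"
    using pos by (simp add: real_sqrt_mult real_sqrt_divide)
  show "\<bar>Re (Complex ((1 - b\<^sup>2) * Re 1 / (1 - b * Re x)\<^sup>2)
     (sqrt (1 - b\<^sup>2) * (Im 1 / (1 - b * Re x) + b * Im x * Re 1 / (1 - b * Re x)\<^sup>2))) *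
     Im (Complex ((1 - b\<^sup>2) * Re \<i> / (1 - b * Re x)\<^sup>2)
     (sqrt (1 - b\<^sup>2) * (Im \<i> / (1 - b * Re x) + b * Im x * Re \<i> / (1 - b * Re x)\<^sup>2))) -
     Re (Complex ((1 - b\<^sup>2) * Re \<i> / (1 - b * Re x)\<^sup>2)
     (sqrt (1 - b\<^sup>2) * (Im \<i> / (1 - b * Re x) + b * Im x * Re \<i> / (1 - b * Re x)\<^sup>2))) *
     Im (Complex ((1 - b\<^sup>2) * Re 1 / (1 - b * Re x)\<^sup>2)
     (sqrt (1 - b\<^sup>2) * (Im 1 / (1 - b * Re x) + b * Im x * Re 1 / (1 - b * Re x)\<^sup>2)))\<bar> *
     hdensity (boost b x) = hdensity x"
    using pos unfolding hdensity_eq[OF x] hdensity_eq[OF boost_in_hplane[OF b x]] e_def[symmetric] q_def[symmetric] L s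
    by (simp add: abs_mult divide_simps power2_eq_square)
qed

lemma harea_hisometry_fixing_0:
  assumes f: "hisometry f" "f 0 = 0" and S: "compact S" "S \<subseteq> hplane"
  shows "harea (f ` S) = harea S"
proof -
  obtain a b where ab: "norm a = 1" "norm b = 1" "inner a b = 0"
    and f_eq: "\<And>x. x \<in> hplane \<Longrightarrow> f x = Re x *\<^sub>R a + Im x *\<^sub>R b"
    using hisometry_fixing_0[OF f] by blast
  define h where "h x = Re x *\<^sub>R a + Im x *\<^sub>R b" for x
  have fh: "f x = h x" if "x \<in> S" for x using that S f_eq by (auto simp: h_def)
  have fS: "f ` S = h ` S" using fh by auto
  have "harea (h ` S) = harea S"
  proof (rule harea_change_of_variables[OF S])
    show "h ` S \<subseteq> hplane" using hisometry_in[OF f(1)] S unfolding fS[symmetric] by auto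
    show "inj_on h S"
      using hisometry_inj[OF f(1)] S fh by (metis inj_on_cong inj_on_subset)
    fix x assume x: "x \<in> S"
    show "(h has_derivative h) (at x)"
      unfolding h_def[abs_def] by (intro has_derivative_add has_derivative_scaleR_left has_derivative_Re has_derivative_Im has_derivative_ident)
    have i: "(Re a)\<^sup>2 + (Im a)\<^sup>2 = 1" "(Re b)\<^sup>2 + (Im b)\<^sup>2 = 1" "Re a * Re b + Im a * Im b = 0"
      using ab by (auto simp: cmod_def inner_complex_def)
    \<comment> \<open>Lagrange's identity: an orthonormal pair has determinant 1 or -1.\<close>
    have "(Re a * Im b - Re b * Im a)\<^sup>2 = ((Re a)\<^sup>2 + (Im a)\<^sup>2) * ((Re b)\<^sup>2 + (Im b)\<^sup>2) - (Re a * Re b + Im a * Im b)\<^sup>2"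
      by (simp add: power2_eq_square algebra_simps)
    then have "(Re a * Im b - Re b * Im a)\<^sup>2 = 1" using i by simp
    then have "\<bar>Re a * Im b - Re b * Im a\<bar> = 1"
      by (metis abs_1 power2_eq_1_iff abs_minus_cancel)
    then have det: "\<bar>Re (h 1) * Im (h \<i>) - Re (h \<i>) * Im (h 1)\<bar> = 1"
      by (simp add: h_def)
    have "lform x x = lform (h x) (h x)"
    proof -
      have "hdist (f 0) (f x) = hdist 0 x"
        using f(1) S(2) x zero_in_hplane unfolding hisometry_def by blast
      then have "cosh (hdist 0 (h x)) = cosh (hdist 0 x)" using f(2) fh[OF x] by simp
      moreover have "x \<in> hplane" "h x \<in> hplane"
        using x S hisometry_in[OF f(1), of x] fh[OF x] by auto
      ultimately have "1 / sqrt (lform (h x) (h x)) = 1 / sqrt (lform x x)"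
        by (simp add: cosh_hdist)
      then show ?thesis by simp
    qed
    then have "hdensity (h x) = hdensity x"
      by (simp add: lform_self hdensity_def)
    then show "\<bar>Re (h 1) * Im (h \<i>) - Re (h \<i>) * Im (h 1)\<bar> * hdensity (h x) = hdensity x"
      by (simp add: det)
  qed
  then show ?thesis by (simp add: fS)
qed

lemma hisometry_compact_image:
  assumes "hisometry f" "compact S" "S \<subseteq> hplane"
  shows "compact (f ` S)" "f ` S \<subseteq> hplane"
  using assms hisometry_in[OF assms(1)]
  by (auto intro!: compact_continuous_image continuous_on_subset[OF hisometry_continuous])

text \<open>A rotation brings c to the nonnegative real axis and a boost takes it from there to
  0.\<close>

lemma ex_hisometry_to_0:
  assumes c: "c \<in> hplane"
  obtains g where "hisometry g" "g c = 0"
    "\<And>S. compact S \<Longrightarrow> S \<subseteq> hplane \<Longrightarrow> harea (g ` S) = harea S"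
proof -
  define R where "R = (\<lambda>x. cis (- Arg c) * x)"
  have R: "hisometry R" unfolding R_def by (rule hisometry_rotation)
  have b: "\<bar>norm c\<bar> < 1" using c by (simp add: hplane_iff)
  have "R c = cis (- Arg c) * (of_real (norm c) * cis (Arg c))"
    using rcis_cmod_Arg[of c] by (simp add: R_def rcis_def)
  also have "\<dots> = of_real (norm c) * (cis (- Arg c) * cis (Arg c))" by (simp only: mult_ac)
  also have "\<dots> = of_real (norm c)" by (simp add: cis_mult)
  finally have Rc: "R c = of_real (norm c)" .
  show ?thesis
  proof
    show "hisometry (\<lambda>x. boost (norm c) (R x))"
      by (rule hisometry_compose[OF R hisometry_boost[OF b]])
    show "boost (norm c) (R c) = 0" by (simp only: Rc boost_centre)
    fix S assume S: "compact S" "S \<subseteq> hplane"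
    have "harea ((\<lambda>x. boost (norm c) (R x)) ` S) = harea (boost (norm c) ` R ` S)"
      by (simp add: image_image)
    also have "\<dots> = harea (R ` S)"
      by (rule harea_boost[OF b hisometry_compact_image[OF R S]])
    also have "\<dots> = harea S"
      by (rule harea_hisometry_fixing_0[OF R _ S]) (simp add: R_def)
    finally show "harea ((\<lambda>x. boost (norm c) (R x)) ` S) = harea S" .
  qed
qed

text \<open>Derivatives are known for boosts and for isometries fixing 0. In general compose f with
  the map g that takes f 0 back to 0: both g and the composition preserve area.\<close>

lemma harea_hisometry:
  assumes f: "hisometry f" and S: "compact S" "S \<subseteq> hplane"
  shows "harea (f ` S) = harea S"
proof -
  obtain g where g: "hisometry g" "g (f 0) = 0"
    and area: "\<And>S. compact S \<Longrightarrow> S \<subseteq> hplane \<Longrightarrow> harea (g ` S) = harea S"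
    using ex_hisometry_to_0[OF hisometry_in[OF f zero_in_hplane]] by blast
  have "harea (f ` S) = harea (g ` f ` S)"
    using area[OF hisometry_compact_image[OF f S]] by simp
  also have "g ` f ` S = (\<lambda>x. g (f x)) ` S" by (simp add: image_image)
  also have "harea \<dots> = harea S"
    by (rule harea_hisometry_fixing_0[OF hisometry_compose[OF f g(1)] g(2) S])
  finally show ?thesis .
qed

section \<open>The area of a right-angled triangle by iterated integration\<close>

definition hmeasure :: "complex measure" where
  "hmeasure = density lborel (\<lambda>x. ennreal (hdensity x))"

lemma sets_hmeasure [simp]: "sets hmeasure = sets borel" and space_hmeasure [simp]: "space hmeasure = UNIV"
  by (simp_all add: hmeasure_def)

text \<open>As a measure, the area can be computed by Tonelli with no prior integrability;
  \<open>enn2real\<close> then returns to the Bochner integral.\<close>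

lemma harea_eq_measure:
  assumes [measurable]: "S \<in> sets borel" shows "harea S = measure hmeasure S"
proof -
  have "harea S = (\<integral>x. hdensity x * indicator S x \<partial>lborel)"
    by (simp add: harea_def set_lebesgue_integral_def hdensity_def mult.commute)
  also have "\<dots> = enn2real (\<integral>\<^sup>+x. ennreal (hdensity x * indicator S x) \<partial>lborel)"
    by (rule integral_eq_nn_integral) (auto simp: hdensity_nonneg)
  also have "(\<integral>\<^sup>+x. ennreal (hdensity x * indicator S x) \<partial>lborel) = emeasure hmeasure S"
    unfolding hmeasure_def
    by (subst emeasure_density) (auto intro!: nn_integral_cong simp: ennreal_mult' hdensity_nonneg ennreal_indicator)
  finally show ?thesis by (simp add: measure_def)
qed

lemma measurable_Complex: "(\<lambda>(x, y). Complex x y) \<in> borel_measurable (lborel \<Otimes>\<^sub>M lborel)"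
proof -
  have "(\<lambda>(x, y). Complex x y) \<in> borel_measurable borel"
    unfolding Complex_eq split_beta by (intro borel_measurable_continuous_onI continuous_intros)
  then show ?thesis unfolding lborel_prod by simp
qed

lemma lborel_complex_eq_distr_pair:
  "(lborel :: complex measure) = distr (lborel \<Otimes>\<^sub>M lborel) borel (\<lambda>(x, y). Complex x y)"
proof (rule lborel_eqI)
  have [measurable]: "(\<lambda>(x, y). Complex x y) \<in> borel_measurable (lborel \<Otimes>\<^sub>M lborel)"
    by (rule measurable_Complex)
  fix l u :: complex assume le: "\<And>b. b \<in> Basis \<Longrightarrow> l \<bullet> b \<le> u \<bullet> b"
  have le': "Re l \<le> Re u" "Im l \<le> Im u"
    using le[of 1] le[of \<i>] by (auto simp: Basis_complex_def)
  have "(\<lambda>(x, y). Complex x y) -` box l u = {Re l<..<Re u} \<times> {Im l<..<Im u}"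
    by (auto simp: box_def Basis_complex_def)
  then have "emeasure (distr (lborel \<Otimes>\<^sub>M lborel) borel (\<lambda>(x, y). Complex x y)) (box l u)
      = emeasure (lborel \<Otimes>\<^sub>M lborel) ({Re l<..<Re u} \<times> {Im l<..<Im u})"
    by (simp add: emeasure_distr space_pair_measure)
  also have "\<dots> = ennreal ((Re u - Re l) * (Im u - Im l))"
    using le' by (simp add: lborel.emeasure_pair_measure_Times ennreal_mult')
  also have "(Re u - Re l) * (Im u - Im l) = (\<Prod>b\<in>Basis. (u - l) \<bullet> b)"
    by (simp add: Basis_complex_def)
  finally show "emeasure (distr (lborel \<Otimes>\<^sub>M lborel) borel (\<lambda>(x, y). Complex x y)) (box l u)
      = (\<Prod>b\<in>Basis. (u - l) \<bullet> b)" .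
qed simp

lemma emeasure_hmeasure_iterated:
  assumes [measurable]: "S \<in> sets borel"
  shows "emeasure hmeasure S
    = (\<integral>\<^sup>+x. \<integral>\<^sup>+y. ennreal (hdensity (Complex x y)) * indicator S (Complex x y) \<partial>lborel \<partial>lborel)"
proof -
  have [measurable]: "(\<lambda>(x, y). Complex x y) \<in> borel_measurable (lborel \<Otimes>\<^sub>M lborel)"
    by (rule measurable_Complex)
  have "emeasure hmeasure S = (\<integral>\<^sup>+x. ennreal (hdensity x) * indicator S x \<partial>lborel)"
    by (simp add: hmeasure_def emeasure_density)
  also have "\<dots> = (\<integral>\<^sup>+p. ennreal (hdensity (case p of (x, y) \<Rightarrow> Complex x y)) * indicator S (case p of (x, y) \<Rightarrow> Complex x y)
      \<partial>(lborel \<Otimes>\<^sub>M lborel))"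
    by (subst lborel_complex_eq_distr_pair, subst nn_integral_distr) auto
  also have "\<dots> = (\<integral>\<^sup>+x. \<integral>\<^sup>+y. ennreal (hdensity (Complex x y)) * indicator S (Complex x y) \<partial>lborel \<partial>lborel)"
    by (subst lborel.nn_integral_fst[symmetric]) auto
  finally show ?thesis .
qed

text \<open>Two right-angled triangles with common leg from 0 to \<rho>, with angle a at the origin
  below the real axis and angle b above it. Turned by \<open>cis (\<phi> i)\<close>, this will be
  the triangle spanned by the centre and side i.\<close>

definition sector_triangle :: "real \<Rightarrow> real \<Rightarrow> real \<Rightarrow> complex set" where
  "sector_triangle \<rho> a b =
    {z. 0 \<le> Re z \<and> Re z \<le> \<rho> \<and> - (Re z * tan a) \<le> Im z \<and> Im z \<le> Re z * tan b}"

text \<open>Gauss--Bonnet for the right-angled triangle with angle \<open>t\<close> at the origin whose adjacent leg has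
  Klein length \<open>\<rho>\<close>: its third angle is \<open>arccos (sin t / sqrt (1 - \<rho>\<^sup>2))\<close>.\<close>

definition right_triangle_area :: "real \<Rightarrow> real \<Rightarrow> real" where
  "right_triangle_area \<rho> t = arcsin (sin t / sqrt (1 - \<rho>\<^sup>2)) - t"

text \<open>On a vertical line the density is \<open>(k - y^2) powr (-3/2)\<close> with constant
  \<open>k = 1 - x^2\<close>, which has an elementary antiderivative.\<close>

lemma hdensity_fibre_deriv:
  assumes "y\<^sup>2 < 1 - x\<^sup>2"
  shows "((\<lambda>y. y / ((1 - x\<^sup>2) * sqrt (1 - x\<^sup>2 - y\<^sup>2))) has_real_derivative hdensity (Complex x y)) (at y)"
proof -
  define k where "k = 1 - x\<^sup>2"
  define s where "s = sqrt (k - y\<^sup>2)"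
  have u: "k - y\<^sup>2 > 0" using assms by (simp add: k_def)
  then have s: "s > 0" "s * s = k - y\<^sup>2" by (auto simp: s_def)
  have k: "k > 0" using u zero_le_power2[of y] by linarith
  have norm: "(norm (Complex x y))\<^sup>2 = 1 - (k - y\<^sup>2)"
    by (simp add: cmod_power2 k_def)
  have h: "hdensity (Complex x y) = 1 / (s * s * s)"
    using powr_minus_three_halves[OF u] by (simp add: hdensity_def norm s(2)) (simp add: s_def)
  have "((\<lambda>y. y / (k * sqrt (k - y\<^sup>2))) has_real_derivative
      (1 * (k * s) - y * (k * ((0 - 2 * y) * (inverse s / 2)))) / ((k * s) * (k * s))) (at y)"
    unfolding s_def using u k
    by (auto intro!: derivative_eq_intros simp: field_simps)
  also have "(1 * (k * s) - y * (k * ((0 - 2 * y) * (inverse s / 2)))) / ((k * s) * (k * s)) = 1 / (s * s * s)"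
  proof -
    have "(1 * (k * s) - y * (k * ((0 - 2 * y) * (inverse s / 2)))) / ((k * s) * (k * s)) = (s * s + y\<^sup>2) / (k * (s * s * s))"
      using s(1) k by (simp add: divide_simps power2_eq_square) (simp add: algebra_simps)
    also have "\<dots> = 1 / (s * s * s)" using s k by simp
    finally show ?thesis .
  qed
  finally show ?thesis
    by (simp add: h k_def)
qed

text \<open>The derivative on the right is the mass of the vertical fibre from 0 to
  \<open>x * tan t\<close>, so the arcsine performs the second integration. The bound
  \<open>x < cos t\<close> keeps \<open>sin t\<close> below \<open>sqrt (1 - x^2)\<close>.\<close>

lemma arcsin_sector_deriv:
  assumes t: "0 < t" "t < pi/2" and x: "0 \<le> x" "x < cos t"
  shows "((\<lambda>x. arcsin (sin t / sqrt (1 - x\<^sup>2))) has_real_derivative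
     x * tan t / ((1 - x\<^sup>2) * sqrt (1 - x\<^sup>2 - (x * tan t)\<^sup>2))) (at x)"
proof -
  define q where "q = sqrt (1 - x\<^sup>2)"
  define S C where "S = sin t" and "C = cos t"
  have S: "S > 0" and C: "C > 0" using t by (auto simp: S_def C_def sin_gt_zero cos_gt_zero)
  have SC: "S\<^sup>2 + C\<^sup>2 = 1" by (simp add: S_def C_def)
  have xC: "x\<^sup>2 < C\<^sup>2" using x by (auto simp: C_def intro: power_strict_mono)
  then have q2: "1 - x\<^sup>2 > 0" using SC zero_le_power2[of S] by linarith
  then have q: "q > 0" "q * q = 1 - x\<^sup>2" by (auto simp: q_def)
  have Sq: "S < q"
    using xC SC S unfolding q_def by (intro real_less_rsqrt) linarith
  then have Sq': "S / q < 1" "S / q > -1" using q S by (auto simp: less_divide_eq)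
  \<comment> \<open>The radical from the derivative of arcsin and the radical of the fibre mass are
    both multiples of this p.\<close>
  define p where "p = sqrt (C\<^sup>2 - x\<^sup>2)"
  have p: "p > 0" "p * p = C\<^sup>2 - x\<^sup>2" using xC by (auto simp: p_def)
  have e1: "sqrt (1 - (S / q)\<^sup>2) = p / q"
  proof -
    have "1 - (S / q)\<^sup>2 = (q * q - S\<^sup>2) / (q * q)"
      using q(1) by (simp add: power_divide power2_eq_square divide_simps)
    also have "q * q - S\<^sup>2 = C\<^sup>2 - x\<^sup>2" using q SC by simp
    finally show ?thesis using q(1) by (simp add: real_sqrt_divide p_def)
  qed
  have e2: "sqrt (1 - x\<^sup>2 - (x * tan t)\<^sup>2) = p / C"
  proof -
    have "1 - x\<^sup>2 - (x * tan t)\<^sup>2 = (C\<^sup>2 - x\<^sup>2 * (C\<^sup>2 + S\<^sup>2)) / C\<^sup>2"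
      using C by (simp add: tan_def power_mult_distrib power_divide divide_simps flip: S_def C_def)
        (simp add: algebra_simps)
    also have "C\<^sup>2 - x\<^sup>2 * (C\<^sup>2 + S\<^sup>2) = C\<^sup>2 - x\<^sup>2" using SC by (simp add: add.commute)
    finally show ?thesis using C by (simp add: real_sqrt_divide p_def)
  qed
  have "((\<lambda>x. S / sqrt (1 - x\<^sup>2)) has_real_derivative S * x / (q * q * q)) (at x)"
    using q2 q(1) unfolding q_def
    by (auto intro!: derivative_eq_intros simp: divide_simps)
  then have "((\<lambda>x. arcsin (S / sqrt (1 - x\<^sup>2))) has_real_derivative inverse (sqrt (1 - (S / q)\<^sup>2)) * (S * x / (q * q * q))) (at x)"
    using DERIV_chain2[OF DERIV_arcsin, of "\<lambda>x. S / sqrt (1 - x\<^sup>2)" x] Sq' unfolding q_def by blast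
  also have "inverse (sqrt (1 - (S / q)\<^sup>2)) * (S * x / (q * q * q)) = x * tan t / ((1 - x\<^sup>2) * sqrt (1 - x\<^sup>2 - (x * tan t)\<^sup>2))"
    unfolding e1 e2 unfolding q(2)[symmetric] tan_def S_def[symmetric] C_def[symmetric]
    using p(1) q(1) C by (simp add: divide_simps)
  finally show ?thesis by (simp add: S_def)
qed

lemma emeasure_sector_triangle:
  assumes a: "0 < a" "a < pi/2" and b: "0 < b" "b < pi/2" and \<rho>: "0 < \<rho>" "\<rho> < cos a" "\<rho> < cos b"
  shows "emeasure hmeasure (sector_triangle \<rho> a b) = ennreal (right_triangle_area \<rho> a + right_triangle_area \<rho> b)"
proof -
  define h where "h t x = x * tan t / ((1 - x\<^sup>2) * sqrt (1 - x\<^sup>2 - (x * tan t)\<^sup>2))" for t x :: real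
  define H where "H t x = arcsin (sin t / sqrt (1 - x\<^sup>2))" for t x :: real
  have small: "(x * tan t)\<^sup>2 < 1 - x\<^sup>2" if "0 \<le> x" "x < cos t" "0 < t" "t < pi/2" for x t
  proof -
    have c: "cos t > 0" using that by (simp add: cos_gt_zero)
    have "x\<^sup>2 < (cos t)\<^sup>2" using that by (intro power_strict_mono) auto
    then have "x\<^sup>2 / (cos t)\<^sup>2 < 1" using c by simp
    moreover have "x\<^sup>2 / (cos t)\<^sup>2 = x\<^sup>2 + (x * tan t)\<^sup>2"
      using tan_sec[of t] c by (simp add: power_mult_distrib divide_inverse power_inverse flip: distrib_left[of "x\<^sup>2" 1, simplified])
    ultimately show ?thesis by linarith
  qed
  have tan_pos: "tan a > 0" "tan b > 0" using a b by (auto simp: tan_gt_zero)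
  have [measurable]: "sector_triangle \<rho> a b \<in> sets borel"
    unfolding sector_triangle_def by measurable
  have h_nonneg: "h t x \<ge> 0" if "0 \<le> x" "x < cos t" "0 < t" "t < pi/2" for x t
  proof -
    have "(x * tan t)\<^sup>2 < 1 - x\<^sup>2" using small that by blast
    moreover from this have "1 - x\<^sup>2 > 0" using zero_le_power2[of "x * tan t"] by linarith
    moreover have "tan t > 0" using that by (simp add: tan_gt_zero)
    ultimately show ?thesis using that by (simp add: h_def)
  qed
  have inner: "(\<integral>\<^sup>+y. ennreal (hdensity (Complex x y)) * indicator (sector_triangle \<rho> a b) (Complex x y) \<partial>lborel)
      = ennreal (h a x + h b x) * indicator {0..\<rho>} x" for x
  proof (cases "0 \<le> x \<and> x \<le> \<rho>")
    case False
    then have "indicator (sector_triangle \<rho> a b) (Complex x y) = (0::ennreal)" for y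
      by (auto simp: sector_triangle_def indicator_def)
    then show ?thesis using False by (auto simp: indicator_def)
  next
    case True
    then have x: "0 \<le> x" "x < cos a" "x < cos b" using \<rho> by auto
    define F where "F y = y / ((1 - x\<^sup>2) * sqrt (1 - x\<^sup>2 - y\<^sup>2))" for y
    have le: "- (x * tan a) \<le> x * tan b"
      using True tan_pos by (simp add: add_nonneg_nonneg neg_le_iff_le order_trans[of _ 0])
    have sq: "y\<^sup>2 < 1 - x\<^sup>2" if "y \<in> {- (x * tan a)..x * tan b}" for y
    proof (cases "y \<ge> 0")
      case True
      then have "y\<^sup>2 \<le> (x * tan b)\<^sup>2" using that by (intro power_mono) auto
      then show ?thesis using small[OF x(1,3) b] by linarith
    next
      case False
      then have "(- y)\<^sup>2 \<le> (x * tan a)\<^sup>2" using that by (intro power_mono) auto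
      then show ?thesis using small[OF x(1,2) a] by simp
    qed
    have [measurable]: "(\<lambda>y. hdensity (Complex x y)) \<in> borel_measurable borel"
      unfolding Complex_eq by measurable
    have "(\<integral>\<^sup>+y. ennreal (hdensity (Complex x y)) * indicator (sector_triangle \<rho> a b) (Complex x y) \<partial>lborel)
        = (\<integral>\<^sup>+y. ennreal (hdensity (Complex x y)) * indicator {- (x * tan a)..x * tan b} y \<partial>lborel)"
      using True by (intro nn_integral_cong) (auto simp: sector_triangle_def indicator_def)
    also have "\<dots> = ennreal (F (x * tan b) - F (- (x * tan a)))"
      using hdensity_fibre_deriv[OF sq] le
      by (intro nn_integral_FTC_Icc) (auto simp: F_def[abs_def] hdensity_nonneg)
    also have "F (x * tan b) - F (- (x * tan a)) = h a x + h b x"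
      by (simp add: F_def h_def)
    finally show ?thesis using True by (simp add: indicator_def)
  qed
  have "emeasure hmeasure (sector_triangle \<rho> a b) = (\<integral>\<^sup>+x. ennreal (h a x + h b x) * indicator {0..\<rho>} x \<partial>lborel)"
    by (subst emeasure_hmeasure_iterated) (simp_all add: inner)
  also have "\<dots> = ennreal ((H a \<rho> + H b \<rho>) - (H a 0 + H b 0))"
  proof (rule nn_integral_FTC_Icc)
    show "(\<lambda>x. h a x + h b x) \<in> borel_measurable borel" unfolding h_def by measurable
    fix x assume "x \<in> {0..\<rho>}"
    then have x: "0 \<le> x" "x < cos a" "x < cos b" using \<rho> by auto
    show "((\<lambda>x. H a x + H b x) has_real_derivative h a x + h b x) (at x)"
      unfolding H_def h_def using x a b by (intro DERIV_add arcsin_sector_deriv) auto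
    show "0 \<le> h a x + h b x" using h_nonneg x a b by simp
  qed (use \<rho> in auto)
  \<comment> \<open>The lower limit contributes the angles themselves, the term \<open>- t\<close>
    of \<open>right_triangle_area\<close>.\<close>
  also have "H a 0 + H b 0 = a + b"
    using a b by (simp add: H_def arcsin_sin)
  finally show ?thesis
    by (simp add: right_triangle_area_def H_def algebra_simps)
qed

text \<open>Dividing by \<open>sqrt (1 - \<rho>^2) \<le> 1\<close> can only enlarge the sine.
  Nonnegativity lets the value pass from \<open>ennreal\<close> back to the reals.\<close>

lemma right_triangle_area_nonneg:
  assumes t: "0 < t" "t < pi/2" and \<rho>: "0 < \<rho>" "\<rho> < cos t"
  shows "right_triangle_area \<rho> t \<ge> 0"
proof -
  have "\<rho>\<^sup>2 < (cos t)\<^sup>2" using \<rho> by (intro power_strict_mono) auto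
  then have q: "(sin t)\<^sup>2 < 1 - \<rho>\<^sup>2" by (simp add: cos_squared_eq)
  have s: "sin t > 0" using t by (simp add: sin_gt_zero)
  have lt: "sin t < sqrt (1 - \<rho>\<^sup>2)" using q by (intro real_less_rsqrt)
  define q where "q = sqrt (1 - \<rho>\<^sup>2)"
  have "sin t < q" "q \<le> 1" using lt by (simp_all add: q_def)
  then have "sin t \<le> sin t / q" "sin t / q \<le> 1"
    using s by (simp_all add: le_divide_eq divide_le_eq mult_left_le)
  then have "arcsin (sin t) \<le> arcsin (sin t / sqrt (1 - \<rho>\<^sup>2))"
    unfolding q_def[symmetric] using s by (intro arcsin_le_arcsin) auto
  then show ?thesis using t by (simp add: right_triangle_area_def arcsin_sin)
qed

lemma harea_sector_triangle:
  assumes "0 < a" "a < pi/2" "0 < b" "b < pi/2" "0 < \<rho>" "\<rho> < cos a" "\<rho> < cos b"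
  shows "harea (sector_triangle \<rho> a b) = right_triangle_area \<rho> a + right_triangle_area \<rho> b"
proof -
  have "sector_triangle \<rho> a b \<in> sets borel"
    unfolding sector_triangle_def by measurable
  then show ?thesis
    using emeasure_sector_triangle[of a b \<rho>] right_triangle_area_nonneg assms
    by (simp add: harea_eq_measure measure_def del: ennreal_plus)
qed

section \<open>Polygons with an incircle\<close>

lemma vertex_mod [simp]: "vertex P (i mod length P) = vertex P i"
  by (simp add: vertex_def)

lemma vertex_Suc_mod [simp]: "vertex P (Suc (i mod length P)) = vertex P (Suc i)"
  by (simp add: vertex_def mod_Suc_eq)

lemma side_mod [simp]: "side P (i mod length P) = side P i"
  by (simp add: side_def)

lemma set_eq_vertex_image: "set P = vertex P ` {..<length P}"
  by (auto simp: vertex_def set_conv_nth image_iff)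

lemma vertex_in_set: "P \<noteq> [] \<Longrightarrow> vertex P i \<in> set P"
  by (simp add: vertex_def)

lemma vertex_map: "P \<noteq> [] \<Longrightarrow> vertex (map g P) i = g (vertex P i)"
  by (simp add: vertex_def)

lemma hyp_ngon_nonempty: "hyp_ngon n P \<Longrightarrow> P \<noteq> []"
  by (auto simp: hyp_ngon_def)

lemma hyp_ngon_vertex_in_hplane: "hyp_ngon n P \<Longrightarrow> vertex P i \<in> hplane"
  using vertex_in_set[of P i] hyp_ngon_nonempty[of n P] unfolding hyp_ngon_def by blast

lemma hyp_ngon_not_collinear:
  assumes "hyp_ngon n P"
  shows "\<not> collinear {vertex P i, vertex P (Suc i), vertex P (Suc (Suc i))}"
proof -
  have n: "length P = n" "n > 0" using assms by (auto simp: hyp_ngon_def)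
  have "vertex P (Suc (Suc (i mod length P))) = vertex P (Suc (Suc i))"
    by (simp add: vertex_def mod_Suc_Suc_eq)
  then show ?thesis
    using assms n vertex_mod[of P i] vertex_Suc_mod[of P i] unfolding hyp_ngon_def
    by (metis mod_less_divisor)
qed

lemma hyp_ngon_Suc_neq: "hyp_ngon n P \<Longrightarrow> vertex P i \<noteq> vertex P (Suc i)"
  using hyp_ngon_not_collinear[of n P i] by (auto simp: insert_commute)

lemma hyp_ngon_side_subset: "hyp_ngon n P \<Longrightarrow> side P i \<subseteq> hplane"
  unfolding side_def using convex_hplane hyp_ngon_vertex_in_hplane by (metis closed_segment_subset)

lemma hyp_ngon_map:
  assumes g: "hisometry g" and P: "hyp_ngon n P"
  shows "hyp_ngon n (map g P)"
proof -
  note ne = hyp_ngon_nonempty[OF P]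
  note V = hyp_ngon_vertex_in_hplane[OF P]
  have inj: "inj_on g hplane" by (rule hisometry_inj[OF g])
  have side: "side (map g P) i = g ` side P i" for i
    unfolding side_def vertex_map[OF ne] by (rule hisometry_segment[OF g V V, symmetric])
  have sub: "side P i \<subseteq> hplane" for i
    by (rule hyp_ngon_side_subset[OF P])
  have P': "n \<ge> 3" "length P = n" "distinct P" "set P \<subseteq> hplane"
    using P unfolding hyp_ngon_def by simp_all
  have cross: "side P i \<inter> side P j \<subseteq> {vertex P i, vertex P (Suc i)} \<inter> {vertex P j, vertex P (Suc j)}"
    if "i < n" "j < n" "i \<noteq> j" for i j
    using P that unfolding hyp_ngon_def by simp
  show ?thesis
    unfolding hyp_ngon_def
  proof (intro conjI allI impI)
    show "n \<ge> 3" "length (map g P) = n" using P' by auto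
    show "distinct (map g P)"
      using P' inj_on_subset[OF inj] by (simp add: distinct_map)
    show "set (map g P) \<subseteq> hplane" using P'(4) hisometry_in[OF g] by auto
  next
    fix i j assume ij: "i < n" "j < n" "i \<noteq> j"
    have "side (map g P) i \<inter> side (map g P) j = g ` (side P i \<inter> side P j)"
      unfolding side by (rule inj_on_image_Int[OF inj sub sub, symmetric])
    also have "\<dots> \<subseteq> g ` ({vertex P i, vertex P (Suc i)} \<inter> {vertex P j, vertex P (Suc j)})"
      by (rule image_mono[OF cross[OF ij]])
    also have "\<dots> \<subseteq> {g (vertex P i), g (vertex P (Suc i))} \<inter> {g (vertex P j), g (vertex P (Suc j))}"
      by (rule Int_greatest; auto)
    finally show "side (map g P) i \<inter> side (map g P) j
        \<subseteq> {vertex (map g P) i, vertex (map g P) (Suc i)} \<inter> {vertex (map g P) j, vertex (map g P) (Suc j)}"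
      unfolding vertex_map[OF ne] .
  next
    fix i
    show "\<not> collinear {vertex (map g P) i, vertex (map g P) (Suc i), vertex (map g P) (Suc (Suc i))}"
      unfolding vertex_map[OF ne] hisometry_collinear_iff[OF g V V V] by (rule hyp_ngon_not_collinear[OF P])
  qed
qed

lemma incircle_map:
  assumes g: "hisometry g" and P: "hyp_ngon n P" and inc: "incircle P c r"
  shows "incircle (map g P) (g c) r"
proof -
  note ne = hyp_ngon_nonempty[OF P]
  note V = hyp_ngon_vertex_in_hplane[OF P]
  have inj: "inj_on g hplane" by (rule hisometry_inj[OF g])
  have c: "c \<in> hplane" "r > 0" using inc by (auto simp: incircle_def)
  show ?thesis
    unfolding incircle_def
  proof (intro conjI allI impI)
    show "g c \<in> hplane" "r > 0" using c hisometry_in[OF g] by auto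
    fix i assume "i < length (map g P)"
    then obtain p where p: "p \<in> side P i" "hline (vertex P i) (vertex P (Suc i)) \<inter> hcircle c r = {p}"
      using inc unfolding incircle_def by auto
    have "g p \<in> side (map g P) i"
      using p(1) unfolding side_def vertex_map[OF ne] hisometry_segment[OF g V V, symmetric] by simp
    moreover have "hline (vertex (map g P) i) (vertex (map g P) (Suc i)) \<inter> hcircle (g c) r = {g p}"
    proof -
      have sub: "hline (vertex P i) (vertex P (Suc i)) \<subseteq> hplane" "hcircle c r \<subseteq> hplane"
        by (auto simp: hline_def hcircle_def)
      show ?thesis
        unfolding vertex_map[OF ne] hisometry_hline[OF g V V hyp_ngon_Suc_neq[OF P]]
          hisometry_hcircle[OF g c(1)] inj_on_image_Int[OF inj sub, symmetric] p(2) by simp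
    qed
    ultimately show "\<exists>p\<in>side (map g P) i. hline (vertex (map g P) i) (vertex (map g P) (Suc i)) \<inter> hcircle (g c) r = {p}"
      by (rule bexI[rotated])
  qed
qed

section \<open>Tangents to a circle about the origin\<close>

lemma cosh_sq_tanh: "1 - (tanh r)\<^sup>2 = 1 / (cosh r)\<^sup>2" for r :: real
proof -
  have "(cosh r)\<^sup>2 - (sinh r)\<^sup>2 = 1" by (simp add: hyperbolic_pythagoras)
  moreover have "1 - (tanh r)\<^sup>2 = ((cosh r)\<^sup>2 - (sinh r)\<^sup>2) / (cosh r)\<^sup>2"
    by (simp add: tanh_def power_divide diff_divide_distrib)
  ultimately show ?thesis by simp
qed

lemma cosh_real_nonneg_eq_iff: "0 \<le> a \<Longrightarrow> 0 \<le> b \<Longrightarrow> cosh a = cosh b \<longleftrightarrow> a = b" for a b :: real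
  using cosh_real_nonneg_le_iff[of a b] cosh_real_nonneg_le_iff[of b a] by auto

lemma hcircle_0:
  assumes "r > 0" shows "hcircle 0 r = sphere 0 (tanh r)"
proof -
  have "x \<in> hplane \<and> hdist 0 x = r \<longleftrightarrow> norm x = tanh r" for x
  proof (cases "x \<in> hplane")
    case True
    have x: "(norm x)\<^sup>2 < 1" using True by (simp add: hplane_iff abs_square_less_1)
    have "hdist 0 x = r \<longleftrightarrow> cosh (hdist 0 x) = cosh r"
      using hdist_nonneg[OF zero_in_hplane True] assms by (simp add: cosh_real_nonneg_eq_iff)
    also have "\<dots> \<longleftrightarrow> 1 / sqrt (1 - (norm x)\<^sup>2) = cosh r"
      using True by (simp add: cosh_hdist lform_self)
    also have "\<dots> \<longleftrightarrow> (1 / sqrt (1 - (norm x)\<^sup>2))\<^sup>2 = (cosh r)\<^sup>2"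
      using x by (intro power2_eq_iff_nonneg[symmetric]) auto
    also have "\<dots> \<longleftrightarrow> 1 / (1 - (norm x)\<^sup>2) = 1 / (1 - (tanh r)\<^sup>2)"
      using x by (simp add: power_divide cosh_sq_tanh)
    also have "\<dots> \<longleftrightarrow> (norm x)\<^sup>2 = (tanh r)\<^sup>2" by auto
    also have "\<dots> \<longleftrightarrow> norm x = tanh r"
      using assms by (intro power2_eq_iff_nonneg) auto
    finally show ?thesis using True by simp
  next
    case False
    then show ?thesis using tanh_real_lt_1[of r] by (auto simp: hplane_iff)
  qed
  then show ?thesis by (simp add: hcircle_def set_eq_iff)
qed

text \<open>If p were not the foot of the perpendicular from 0, its mirror image in that foot would
  be a second common point of line and circle. So the line is perpendicular to the unit vector
  \<open>e = p / \<rho>\<close>; s and t are signed distances from p to the ends, of equal sign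
  because p lies on the segment.\<close>

lemma tangent_line_0:
  assumes ab: "a \<noteq> b" and \<rho>: "0 < \<rho>" "\<rho> < 1"
    and p: "p \<in> closed_segment a b" "hline a b \<inter> sphere 0 \<rho> = {p}"
  obtains e s t where "norm e = 1" "a = e * Complex \<rho> (- s)" "b = e * Complex \<rho> t" "s * t \<ge> 0"
proof -
  have norm_p: "norm p = \<rho>" using p(2) by (auto simp: dist_norm)
  define d where "d = b - a"
  have d: "inner d d > 0" using ab by (simp add: d_def)
  obtain l where l: "0 \<le> l" "l \<le> 1" "p = a + l *\<^sub>R d"
    using p(1) by (auto simp: in_segment d_def algebra_simps)
  have aff: "p + u *\<^sub>R d \<in> affine hull {a, b}" for u
  proof -
    have "p + u *\<^sub>R d = (1 - (l + u)) *\<^sub>R a + (l + u) *\<^sub>R b"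
      by (simp add: l(3) d_def algebra_simps)
    then show ?thesis unfolding affine_hull_2 by force
  qed
  \<comment> \<open>The nontrivial root of the quadratic equation for
    \<open>norm (p + u *\<^sub>R d) = \<rho>\<close>.\<close>
  define u where "u = - 2 * inner p d / inner d d"
  have "(norm (p + u *\<^sub>R d))\<^sup>2 = (norm p)\<^sup>2 + u * (2 * inner p d + u * inner d d)"
    by (simp add: power2_norm_eq_inner inner_add inner_commute[of d p] algebra_simps)
  also have "2 * inner p d + u * inner d d = 0" using d by (simp add: u_def)
  finally have "(norm (p + u *\<^sub>R d))\<^sup>2 = \<rho>\<^sup>2" using norm_p by simp
  then have "norm (p + u *\<^sub>R d) = \<rho>" using \<rho> by (simp add: power2_eq_iff_nonneg)
  then have "p + u *\<^sub>R d \<in> hline a b \<inter> sphere 0 \<rho>"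
    using aff[of u] \<rho> by (simp add: hline_def hplane_iff)
  then have "u *\<^sub>R d = 0" using p(2) by auto
  then have pd: "inner p d = 0" using d by (auto simp: u_def)
  define e where "e = p / of_real \<rho>"
  have e: "norm e = 1" using norm_p \<rho> by (simp add: e_def norm_divide)
  have pe: "p = of_real \<rho> * e" using \<rho> by (simp add: e_def)
  define k where "k = inner d (\<i> * e)"
  have e2: "(Re e)\<^sup>2 + (Im e)\<^sup>2 = 1" using e by (simp add: cmod_def)
  have ed: "Re e * Re d + Im e * Im d = 0"
  proof -
    have "\<rho> * (Re e * Re d + Im e * Im d) = 0"
      using pd by (simp add: pe inner_complex_def algebra_simps)
    then show ?thesis using \<rho> by simp
  qed
  have dk: "d = of_real k * (\<i> * e)"
  proof (rule complex_eqI)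
    have "Re d = Re d * ((Re e)\<^sup>2 + (Im e)\<^sup>2) - Re e * (Re e * Re d + Im e * Im d)" using e2 ed by simp
    then show "Re d = Re (of_real k * (\<i> * e))"
      by (simp add: k_def inner_complex_def power2_eq_square algebra_simps)
    have "Im d = Im d * ((Re e)\<^sup>2 + (Im e)\<^sup>2) - Im e * (Re e * Re d + Im e * Im d)" using e2 ed by simp
    then show "Im d = Im (of_real k * (\<i> * e))"
      by (simp add: k_def inner_complex_def power2_eq_square algebra_simps)
  qed
  show ?thesis
  proof
    show "norm e = 1" by (rule e)
    have "a = p - l *\<^sub>R d" using l by simp
    then show "a = e * Complex \<rho> (- (l * k))"
      by (simp add: pe dk complex_eq_iff algebra_simps)
    have "b = p + (1 - l) *\<^sub>R d" using l by (simp add: d_def algebra_simps)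
    then show "b = e * Complex \<rho> ((1 - l) * k)"
      by (simp add: pe dk complex_eq_iff algebra_simps)
    have "0 \<le> l * (1 - l) * (k * k)" using l by simp
    then show "l * k * ((1 - l) * k) \<ge> 0" by (simp only: mult_ac)
  qed
qed

lemma collinear_tangent_points:
  "collinear {e * Complex \<rho> x, e * Complex \<rho> y, e * Complex \<rho> z}"
  unfolding collinear_def
proof (intro exI[of _ "e * \<i>"] ballI)
  fix a b assume "a \<in> {e * Complex \<rho> x, e * Complex \<rho> y, e * Complex \<rho> z}"
    "b \<in> {e * Complex \<rho> x, e * Complex \<rho> y, e * Complex \<rho> z}"
  then obtain u v where "a = e * Complex \<rho> u" "b = e * Complex \<rho> v" by auto
  then have "a - b = (u - v) *\<^sub>R (e * \<i>)" by (simp add: complex_eq_iff algebra_simps)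
  then show "\<exists>c. a - b = c *\<^sub>R (e * \<i>)" ..
qed

text \<open>The two tangents from a vertex have equal length, so \<open>t i = s (Suc i)\<close> up
  to sign. The wrong sign would make the two points of tangency coincide and put three consecutive
  vertices on one line. Excluding it also shows that no length is zero, and then
  \<open>s i * s (Suc i) > 0\<close> propagates one orientation to all sides.\<close>

lemma tangential_vertices:
  assumes Q: "hyp_ngon n Q" and inc: "incircle Q 0 r"
  obtains e s where "\<And>i. norm (e i) = 1"
    "\<And>i. vertex Q i = e i * Complex (tanh r) (- s i)"
    "\<And>i. vertex Q (Suc i) = e i * Complex (tanh r) (s (Suc i))"
    "\<And>i. e (i + n) = e i" "\<And>i. s (i + n) = s i" "(\<forall>i. s i > 0) \<or> (\<forall>i. s i < 0)"
proof -
  define \<rho> where "\<rho> = tanh r"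
  have r: "r > 0" using inc by (simp add: incircle_def)
  then have \<rho>: "0 < \<rho>" "\<rho> < 1" by (simp_all add: \<rho>_def tanh_real_lt_1)
  have n: "length Q = n" "n > 0" using Q by (auto simp: hyp_ngon_def)
  have "\<exists>e s t. norm e = 1 \<and> vertex Q i = e * Complex \<rho> (- s) \<and> vertex Q (Suc i) = e * Complex \<rho> t \<and> s * t \<ge> 0"
    if i: "i < n" for i
  proof -
    obtain p where p: "p \<in> side Q i" "hline (vertex Q i) (vertex Q (Suc i)) \<inter> hcircle 0 r = {p}"
      using inc i n unfolding incircle_def by auto
    show ?thesis
      using tangent_line_0[OF hyp_ngon_Suc_neq[OF Q] \<rho>, of p i] p
      unfolding side_def hcircle_0[OF r] \<rho>_def[symmetric] by metis
  qed
  then obtain e' s' t' where est: "norm (e' i) = 1 \<and> vertex Q i = e' i * Complex \<rho> (- s' i)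
      \<and> vertex Q (Suc i) = e' i * Complex \<rho> (t' i) \<and> s' i * t' i \<ge> 0" if "i < n" for i
    by metis
  define e s t where "e i = e' (i mod n)" and "s i = s' (i mod n)" and "t i = t' (i mod n)" for i
  have e: "norm (e i) = 1" and v: "vertex Q i = e i * Complex \<rho> (- s i)"
    and v': "vertex Q (Suc i) = e i * Complex \<rho> (t i)" and st: "s i * t i \<ge> 0" for i
    using est[of "i mod n"] n vertex_mod[of Q i] vertex_Suc_mod[of Q i] by (simp_all add: e_def s_def t_def)
  have per: "e (i + n) = e i" "s (i + n) = s i" for i
    by (simp_all add: e_def s_def)
  have t_neq: "t i \<noteq> - s (Suc i)" for i
  proof
    assume t: "t i = - s (Suc i)"
    have "e i * Complex \<rho> (t i) = e (Suc i) * Complex \<rho> (- s (Suc i))"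
      using v v' by metis
    moreover have "Complex \<rho> (t i) \<noteq> 0" using \<rho> by (simp add: complex_eq_iff)
    ultimately have "e i = e (Suc i)" using t by simp
    then have "collinear {vertex Q i, vertex Q (Suc i), vertex Q (Suc (Suc i))}"
      using collinear_tangent_points[of "e i" \<rho> "- s i" "t i" "t (Suc i)"] v[of i] v'[of i] v'[of "Suc i"] by simp
    then show False using hyp_ngon_not_collinear[OF Q] by blast
  qed
  have ts: "t i = s (Suc i)" for i
  proof -
    have "norm (Complex \<rho> (t i)) = norm (Complex \<rho> (- s (Suc i)))"
      using arg_cong[OF v'[of i, unfolded v[of "Suc i"]], of norm] e by (simp add: norm_mult)
    then have "(t i)\<^sup>2 = (s (Suc i))\<^sup>2" by (simp add: cmod_def)
    then show ?thesis using t_neq[of i] by (simp add: power2_eq_iff)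
  qed
  have s_nz: "s (Suc i) \<noteq> 0" for i
    using t_neq[of i] ts[of i] by auto
  \<comment> \<open>Index 0 is no successor, but \<open>Suc (n - 1) = n\<close> is, and s has period
    n.\<close>
  have s0: "s 0 \<noteq> 0" using s_nz[of "n - 1"] per(2)[of 0] n by simp
  have s_nz': "s i \<noteq> 0" for i using s_nz s0 by (cases i) auto
  have ss: "s i * s (Suc i) > 0" for i
    using st[of i] s_nz'[of i] s_nz[of i] ts[of i] by (metis less_eq_real_def mult_eq_0_iff)
  have "(s i > 0) = (s 0 > 0)" for i
  proof (induction i)
    case (Suc i)
    then show ?case using ss[of i] by (auto simp: zero_less_mult_iff)
  qed simp
  then have "(\<forall>i. s i > 0) \<or> (\<forall>i. s i < 0)"
    using s_nz' by (metis linorder_neqE_linordered_idom)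
  then show ?thesis
    using that[of e s] e v v' ts per by (simp add: \<rho>_def)
qed

text \<open>Negative s means that the polygon runs clockwise; complex conjugation reverses the
  orientation and fixes the centre.\<close>

lemma tangential_vertices_oriented:
  assumes Q: "hyp_ngon n Q" and inc: "incircle Q 0 r"
  obtains h e s where "hisometry h" "hyp_ngon n (map h Q)" "h 0 = 0" "\<And>i. norm (e i) = 1"
    "\<And>i. vertex (map h Q) i = e i * Complex (tanh r) (- s i)"
    "\<And>i. vertex (map h Q) (Suc i) = e i * Complex (tanh r) (s (Suc i))"
    "\<And>i. e (i + n) = e i" "\<And>i. s (i + n) = s i" "\<And>i. s i > 0"
proof -
  obtain e s where es: "\<And>i. norm (e i) = 1"
    "\<And>i. vertex Q i = e i * Complex (tanh r) (- s i)"
    "\<And>i. vertex Q (Suc i) = e i * Complex (tanh r) (s (Suc i))"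
    "\<And>i. e (i + n) = e i" "\<And>i. s (i + n) = s i" "(\<forall>i. s i > 0) \<or> (\<forall>i. s i < 0)"
    using tangential_vertices[OF Q inc] by metis
  from es(6) show ?thesis
  proof
    assume "\<forall>i. s i > 0"
    moreover have "hisometry (\<lambda>x. x)" by (simp add: hisometry_def bij_betw_def)
    ultimately show ?thesis using that[of "\<lambda>x. x" e s] es Q by simp
  next
    assume s: "\<forall>i. s i < 0"
    have v: "vertex (map cnj Q) i = cnj (vertex Q i)" for i
      by (rule vertex_map[OF hyp_ngon_nonempty[OF Q]])
    show ?thesis
    proof (rule that[of cnj "\<lambda>i. cnj (e i)" "\<lambda>i. - s i"])
      show "vertex (map cnj Q) i = cnj (e i) * Complex (tanh r) (- (- s i))" for i
        unfolding v es(2)[of i] by (simp add: complex_eq_iff)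
      show "vertex (map cnj Q) (Suc i) = cnj (e i) * Complex (tanh r) (- s (Suc i))" for i
        unfolding v es(3)[of i] by (simp add: complex_eq_iff)
    qed (use es s hyp_ngon_map[OF hisometry_cnj Q] hisometry_cnj in auto)
  qed
qed

section \<open>Lifted angles and the winding number\<close>

lemma Complex_polar:
  assumes "0 < \<rho>" "t = arctan (s / \<rho>)"
  shows "Complex \<rho> s = of_real (\<rho> / cos t) * cis t" "Complex \<rho> (- s) = of_real (\<rho> / cos t) * cis (- t)"
proof -
  have c: "cos t > 0" using assms arctan_bounded[of "s / \<rho>"] by (auto intro!: cos_gt_zero_pi)
  have "tan t = s / \<rho>" using assms by (simp add: tan_arctan)
  then have "s = \<rho> * sin t / cos t" using assms(1) by (simp add: tan_def field_simps)
  then show "Complex \<rho> s = of_real (\<rho> / cos t) * cis t" "Complex \<rho> (- s) = of_real (\<rho> / cos t) * cis (- t)"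
    using c by (simp_all add: complex_eq_iff)
qed

text \<open>A polygon circumscribed about the Euclidean circle of radius \<open>\<rho>\<close> around the origin: \<open>\<phi> i\<close> is the
  polar angle of the point of tangency of side \<open>i\<close>, lifted to the real line, and \<open>\<theta> i\<close> is half the
  angle between consecutive points of tangency, so that vertex \<open>i\<close> has polar angle \<open>\<phi> i - \<theta> i\<close>;
  \<open>m\<close> is the winding number.\<close>

locale circumscribed =
  fixes n m :: nat and \<rho> :: real and \<phi> \<theta> :: "nat \<Rightarrow> real" and Q :: "complex list"
  assumes n: "n \<ge> 3" "length Q = n" and \<rho>: "0 < \<rho>" "\<rho> < 1"
    and \<theta>: "\<And>i. 0 < \<theta> i" "\<And>i. \<theta> i < pi/2" "\<And>i. \<rho> < cos (\<theta> i)" "\<And>i. \<theta> (i + n) = \<theta> i"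
    and \<phi>: "\<And>i. \<phi> (Suc i) = \<phi> i + 2 * \<theta> (Suc i)" "\<And>i. \<phi> (i + n) = \<phi> i + 2 * pi * real m"
    and vertex_eq: "\<And>i. vertex Q i = of_real (\<rho> / cos (\<theta> i)) * cis (\<phi> i - \<theta> i)"

lemma ex_circumscribed:
  assumes P: "hyp_ngon n P" and inc: "incircle P c r"
  obtains h m \<phi> \<theta> where "hisometry h" "h c = 0" "hyp_ngon n (map h P)" "circumscribed n m (tanh r) \<phi> \<theta> (map h P)"
proof -
  have c: "c \<in> hplane" and r: "r > 0" using inc by (auto simp: incircle_def)
  obtain g where g: "hisometry g" "g c = 0" by (rule ex_hisometry_to_0[OF c])
  let ?Q = "map g P"
  have Q: "hyp_ngon n ?Q" "incircle ?Q 0 r"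
    using hyp_ngon_map[OF g(1) P] incircle_map[OF g(1) P inc] g(2) by auto
  obtain h e s where h: "hisometry h" "hyp_ngon n (map h ?Q)" "h 0 = 0" and e: "\<And>i. norm (e i) = 1"
    and v: "\<And>i. vertex (map h ?Q) i = e i * Complex (tanh r) (- s i)"
    and v': "\<And>i. vertex (map h ?Q) (Suc i) = e i * Complex (tanh r) (s (Suc i))"
    and per: "\<And>i. e (i + n) = e i" "\<And>i. s (i + n) = s i" and s: "\<And>i. s i > 0"
    by (rule tangential_vertices_oriented[OF Q]) (rule that; (assumption | erule meta_spec))
  define \<rho> where "\<rho> = tanh r"
  have \<rho>: "0 < \<rho>" "\<rho> < 1" using r by (simp_all add: \<rho>_def tanh_real_lt_1)
  have n: "n \<ge> 3" "length P = n" using P by (auto simp: hyp_ngon_def)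
  define \<theta> where "\<theta> i = arctan (s i / \<rho>)" for i
  have \<theta>: "0 < \<theta> i" "\<theta> i < pi/2" for i
    using s[of i] \<rho> arctan_ubound[of "s i / \<rho>"] by (auto simp: \<theta>_def)
  have cos_pos: "cos (\<theta> i) > 0" for i using \<theta>[of i] by (intro cos_gt_zero_pi) auto
  \<comment> \<open>Only the first angle is taken from \<open>Arg\<close>; the others are
    accumulated on the real line, so the later sides involve no choice of branch.\<close>
  define \<phi> where "\<phi> i = Arg (e 0) + (\<Sum>j<i. 2 * \<theta> (Suc j))" for i
  have \<phi>_Suc: "\<phi> (Suc i) = \<phi> i + 2 * \<theta> (Suc i)" for i by (simp add: \<phi>_def)
  have e_eq: "e i = cis (\<phi> i)" for i
  proof (induction i)
    case 0
    show ?case using e[of 0] rcis_cmod_Arg[of "e 0"] by (simp add: \<phi>_def rcis_def)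
  next
    case (Suc i)
    have "e (Suc i) * Complex \<rho> (- s (Suc i)) = e i * Complex \<rho> (s (Suc i))"
      using v[of "Suc i"] v'[of i] unfolding \<rho>_def by metis
    then have "e (Suc i) * cis (- \<theta> (Suc i)) = e i * cis (\<theta> (Suc i))"
      unfolding Complex_polar[OF \<rho>(1) \<theta>_def] using cos_pos[of "Suc i"] \<rho> by (simp add: field_simps)
    then have "e (Suc i) * (cis (- \<theta> (Suc i)) * cis (\<theta> (Suc i))) = cis (\<phi> i) * (cis (\<theta> (Suc i)) * cis (\<theta> (Suc i)))"
      unfolding Suc by (simp only: mult.assoc[symmetric])
    then show ?case by (simp add: cis_mult \<phi>_Suc)
  qed
  have v_eq: "vertex (map h ?Q) i = of_real (\<rho> / cos (\<theta> i)) * cis (\<phi> i - \<theta> i)" for i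
  proof -
    have "vertex (map h ?Q) i = cis (\<phi> i) * (of_real (\<rho> / cos (\<theta> i)) * cis (- \<theta> i))"
      unfolding v e_eq \<rho>_def[symmetric] Complex_polar[OF \<rho>(1) \<theta>_def] ..
    also have "\<dots> = of_real (\<rho> / cos (\<theta> i)) * (cis (\<phi> i) * cis (- \<theta> i))" by (simp only: mult_ac)
    finally show ?thesis by (simp add: cis_mult)
  qed
  have "\<rho> < cos (\<theta> i)" for i
  proof -
    have "norm (vertex (map h ?Q) i) < 1"
      using hyp_ngon_vertex_in_hplane[OF h(2), of i] by (simp add: hplane_iff)
    then show ?thesis
      unfolding v_eq norm_mult norm_of_real norm_cis using cos_pos[of i] \<rho> by (simp add: divide_less_eq)
  qed
  moreover have \<theta>_per: "\<theta> (i + n) = \<theta> i" for i by (simp add: \<theta>_def per)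
  \<comment> \<open>The points of tangency have period n, so one round adds an integral multiple of
    \<open>2 * pi\<close>; it is a natural one because the \<theta> are positive.\<close>
  moreover obtain m where m: "\<phi> n = \<phi> 0 + 2 * pi * real m"
  proof -
    have "cis (\<phi> n) = cis (\<phi> 0)" using per(1)[of 0] unfolding e_eq by simp
    then have "cis (\<phi> n - \<phi> 0) = 1" by (simp flip: cis_divide)
    then have "cos (\<phi> n - \<phi> 0) = 1" by (simp add: complex_eq_iff)
    then obtain k :: int where k: "\<phi> n - \<phi> 0 = of_int k * 2 * pi"
      by (auto simp: cos_one_2pi_int)
    have "\<phi> n - \<phi> 0 \<ge> 0" unfolding \<phi>_def using \<theta>(1) by (simp add: sum_nonneg less_imp_le)
    then have "of_int k * (2 * pi) \<ge> 0" using k by simp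
    then have "k \<ge> 0" using pi_gt_zero by (simp add: zero_le_mult_iff del: pi_gt_zero)
    then have "\<phi> n = \<phi> 0 + 2 * pi * real (nat k)" using k by (simp add: diff_eq_eq mult_ac)
    then show ?thesis by (rule that)
  qed
  moreover have "\<phi> (i + n) = \<phi> i + 2 * pi * real m" for i
  proof (induction i)
    case (Suc i)
    then show ?case using \<phi>_Suc[of i] \<phi>_Suc[of "i + n"] \<theta>_per[of "Suc i"] by simp
  qed (use m in simp)
  ultimately have "circumscribed n m (tanh r) \<phi> \<theta> (map h ?Q)"
    using \<theta> \<phi>_Suc v_eq n \<rho> by unfold_locales (simp_all add: \<rho>_def)
  moreover have "map h ?Q = map (\<lambda>x. h (g x)) P" by simp
  ultimately show ?thesis
    using that[of "\<lambda>x. h (g x)" m \<phi> \<theta>] h g hisometry_compose[OF g(1) h(1)] by (simp add: o_def)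
qed

context circumscribed
begin

lemma \<phi>_strict_mono: "i < j \<Longrightarrow> \<phi> i < \<phi> j"
  by (rule lift_Suc_mono_less[of \<phi>]) (simp_all add: \<phi>(1) \<theta>(1))

lemma \<phi>_mono: "i \<le> j \<Longrightarrow> \<phi> i \<le> \<phi> j"
  using \<phi>_strict_mono by (cases "i = j") (auto simp: less_imp_le)

lemma \<phi>_add_mult: "\<phi> (i + q * n) = \<phi> i + real q * (2 * pi * real m)"
proof (induction q)
  case (Suc q)
  then show ?case using \<phi>(2)[of "i + q * n"] by (simp add: algebra_simps)
qed simp

lemma m_pos: "m > 0"
proof (rule ccontr)
  assume "\<not> m > 0"
  then have "\<phi> (0 + n) = \<phi> 0" using \<phi>(2)[of 0] by simp
  then show False using \<phi>_strict_mono[of 0 n] n by simp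
qed

lemma cos_pos: "cos (\<theta> i) > 0"
  using \<theta>(1,2)[of i] by (intro cos_gt_zero_pi) auto

text \<open>In the frame turned by \<open>\<phi> i\<close> the line of side i is
  \<open>Re = \<rho>\<close>, with vertex i below and the next vertex above the point of tangency.
  Arguments about a side use this frame.\<close>

lemma vertex_eq': "vertex Q i = cis (\<phi> i) * Complex \<rho> (- (\<rho> * tan (\<theta> i)))"
proof -
  have "\<theta> i = arctan (\<rho> * tan (\<theta> i) / \<rho>)"
    using \<rho> \<theta>(1,2)[of i] by (simp add: arctan_tan)
  then have "Complex \<rho> (- (\<rho> * tan (\<theta> i))) = of_real (\<rho> / cos (\<theta> i)) * cis (- \<theta> i)"
    by (rule Complex_polar(2)[OF \<rho>(1)])
  then have "cis (\<phi> i) * Complex \<rho> (- (\<rho> * tan (\<theta> i))) = of_real (\<rho> / cos (\<theta> i)) * (cis (\<phi> i) * cis (- \<theta> i))"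
    by (simp only: mult_ac)
  then show ?thesis by (simp add: vertex_eq cis_mult)
qed

lemma vertex_Suc_eq': "vertex Q (Suc i) = cis (\<phi> i) * Complex \<rho> (\<rho> * tan (\<theta> (Suc i)))"
proof -
  have "\<theta> (Suc i) = arctan (\<rho> * tan (\<theta> (Suc i)) / \<rho>)"
    using \<rho> \<theta>(1,2)[of "Suc i"] by (simp add: arctan_tan)
  then have "Complex \<rho> (\<rho> * tan (\<theta> (Suc i))) = of_real (\<rho> / cos (\<theta> (Suc i))) * cis (\<theta> (Suc i))"
    by (rule Complex_polar(1)[OF \<rho>(1)])
  then have "cis (\<phi> i) * Complex \<rho> (\<rho> * tan (\<theta> (Suc i))) = of_real (\<rho> / cos (\<theta> (Suc i))) * (cis (\<phi> i) * cis (\<theta> (Suc i)))"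
    by (simp only: mult_ac)
  also have "cis (\<phi> i) * cis (\<theta> (Suc i)) = cis (\<phi> (Suc i) - \<theta> (Suc i))" by (simp add: cis_mult \<phi>(1) add.commute)
  finally show ?thesis by (simp add: vertex_eq)
qed

lemma tangent_point_in_side:
  assumes "- tan (\<theta> i) \<le> t" "t \<le> tan (\<theta> (Suc i))"
  shows "cis (\<phi> i) * Complex \<rho> (\<rho> * t) \<in> side Q i"
proof -
  have pos: "tan (\<theta> i) > 0" "tan (\<theta> (Suc i)) > 0" using \<theta>(1,2) by (auto intro: tan_gt_zero)
  define u where "u = (t + tan (\<theta> i)) / (tan (\<theta> i) + tan (\<theta> (Suc i)))"
  have u: "0 \<le> u" "u \<le> 1" using assms pos by (auto simp: u_def divide_simps)
  have "u * (tan (\<theta> i) + tan (\<theta> (Suc i))) = t + tan (\<theta> i)" using pos by (simp add: u_def)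
  then have t: "t = (1 - u) * (- tan (\<theta> i)) + u * tan (\<theta> (Suc i))" by (simp add: algebra_simps)
  have "Complex \<rho> (\<rho> * t) = (1 - u) *\<^sub>R Complex \<rho> (- (\<rho> * tan (\<theta> i))) + u *\<^sub>R Complex \<rho> (\<rho> * tan (\<theta> (Suc i)))"
    unfolding t by (simp add: complex_eq_iff algebra_simps)
  then have "cis (\<phi> i) * Complex \<rho> (\<rho> * t) = (1 - u) *\<^sub>R vertex Q i + u *\<^sub>R vertex Q (Suc i)"
    unfolding vertex_Suc_eq' unfolding vertex_eq' by (simp only: distrib_left mult_scaleR_right)
  then show ?thesis unfolding side_def in_segment using u by blast
qed

text \<open>If the polygon wound around twice, take the longest gap \<open>[\<phi> (j - 1), \<phi> j]\<close> between points of
  tangency: a second sheet has a point of tangency in it, and the first such point \<open>\<phi> k\<close> belongs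
  to a side whose backward half meets side \<open>j - 1\<close> at an inner point.\<close>

lemma winding_number_1:
  assumes Q: "hyp_ngon n Q"
  shows "m = 1"
proof (rule ccontr)
  assume "m \<noteq> 1"
  then have m2: "m \<ge> 2" using m_pos by simp
  have "Max (\<theta> ` {1..n}) \<in> \<theta> ` {1..n}" using n by (intro Max_in) auto
  then obtain j where "j \<in> {1..n}" "\<theta> j = Max (\<theta> ` {1..n})" by auto
  then have j: "j \<in> {1..n}" "\<And>i. i \<in> {1..n} \<Longrightarrow> \<theta> i \<le> \<theta> j" by auto
  have max: "\<theta> i \<le> \<theta> j" if "i \<ge> 1" for i
    using that
  proof (induction i rule: less_induct)
    case (less i)
    show ?case
    proof (cases "i \<le> n")
      case False
      then show ?thesis using less.IH[of "i - n"] \<theta>(4)[of "i - n"] n by simp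
    qed (use less j in simp)
  qed
  define a where "a = j - 1"
  have ja: "j = Suc a" using j by (simp add: a_def)
  define L where "L = \<phi> a + 2 * pi"
  have "\<phi> (a + n) = \<phi> a + 2 * pi * real m" by (rule \<phi>(2))
  moreover have "2 * pi * 1 \<le> 2 * pi * real m" using m2 by (intro mult_left_mono) auto
  ultimately have ex: "L \<le> \<phi> (a + n)" by (simp add: L_def)
  define k where "k = (LEAST k. L \<le> \<phi> k)"
  have k: "L \<le> \<phi> k" unfolding k_def using ex by (rule LeastI)
  have k_least: "\<phi> i < L" if "i < k" for i
    using not_less_Least[of i "\<lambda>k. L \<le> \<phi> k"] that unfolding k_def by auto
  have ak: "a < k"
  proof (rule ccontr)
    assume "\<not> a < k"
    then have "\<phi> k \<le> \<phi> a" by (intro \<phi>_mono) simp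
    then show False using k pi_gt_zero unfolding L_def by linarith
  qed
  then obtain b where kb: "k = Suc b" by (cases k) auto
  have b: "\<phi> b < L" using k_least kb by simp
  \<comment> \<open>The tangents at \<open>\<phi> a\<close> and \<open>\<phi> k\<close> meet on the
    bisector of these directions, at angle \<delta> from each modulo \<open>2 * pi\<close>; for
    \<delta> = 0 they share their point of tangency.\<close>
  define \<delta> where "\<delta> = (\<phi> k - L) / 2"
  have \<phi>k: "\<phi> k = \<phi> a + 2 * \<delta> + 2 * pi" by (simp add: \<delta>_def L_def field_simps)
  have \<delta>: "0 \<le> \<delta>" "\<delta> < \<theta> k"
    using k b \<phi>(1)[of b] kb by (auto simp: \<delta>_def)
  \<comment> \<open>Maximality of \<open>\<theta> j\<close> enters here: it puts the intersection X
    inside the forward half of side a.\<close>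
  have \<delta>j: "\<delta> < \<theta> j" using \<delta> max[of k] kb by simp
  have tan: "tan \<delta> < tan (\<theta> k)" "tan \<delta> < tan (\<theta> j)"
    using \<delta> \<delta>j \<theta>(1,2)[of k] \<theta>(1,2)[of j] by (auto intro!: tan_monotone)
  have tan_\<delta>: "0 \<le> tan \<delta>"
    using \<delta> \<theta>(2)[of k] tan_gt_zero[of \<delta>] by (cases "\<delta> = 0") auto
  define X where "X = cis (\<phi> k) * Complex \<rho> (\<rho> * (- tan \<delta>))"
  have X': "X = cis (\<phi> a) * Complex \<rho> (\<rho> * tan \<delta>)"
  proof -
    have "\<delta> = arctan (\<rho> * tan \<delta> / \<rho>)"
      using \<rho> \<delta> \<theta>(2)[of k] by (simp add: arctan_tan)
    note C = Complex_polar[OF \<rho>(1) this]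
    have "X = cis (\<phi> k) * (of_real (\<rho> / cos \<delta>) * cis (- \<delta>))"
      unfolding X_def by (simp add: C(2))
    also have "\<dots> = of_real (\<rho> / cos \<delta>) * (cis (\<phi> k) * cis (- \<delta>))" by (simp only: mult_ac)
    also have "cis (\<phi> k) * cis (- \<delta>) = cis (\<phi> a) * cis \<delta> * cis (2 * pi)"
      by (simp add: cis_mult \<phi>k algebra_simps)
    also have "\<dots> = cis (\<phi> a) * cis \<delta>" by simp
    also have "of_real (\<rho> / cos \<delta>) * (cis (\<phi> a) * cis \<delta>) = cis (\<phi> a) * Complex \<rho> (\<rho> * tan \<delta>)"
      unfolding C(1) by (simp only: mult_ac)
    finally show ?thesis .
  qed
  have tpos: "0 < tan (\<theta> i)" for i using \<theta>(1,2)[of i] by (intro tan_gt_zero)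
  have Xk: "X \<in> side Q k"
    unfolding X_def using tan tan_\<delta> tpos[of "Suc k"] by (intro tangent_point_in_side) auto
  have Xa: "X \<in> side Q a"
    unfolding X' using tan tan_\<delta> tpos[of a] ja by (intro tangent_point_in_side) auto
  have "\<rho> * (- tan \<delta>) \<noteq> \<rho> * (- tan (\<theta> k))" "\<rho> * (- tan \<delta>) \<noteq> \<rho> * tan (\<theta> (Suc k))"
    unfolding mult_cancel_left using tan tan_\<delta> tpos[of "Suc k"] \<rho> by auto
  then have Xv: "X \<noteq> vertex Q k" "X \<noteq> vertex Q (Suc k)"
    unfolding X_def vertex_Suc_eq' unfolding vertex_eq' by simp_all
  \<comment> \<open>Sides k and a are different: with \<open>m \<ge> 2\<close> a return to the same
    side takes at least \<open>4 * pi\<close>, but \<open>\<phi> k\<close> exceeds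
    \<open>\<phi> a\<close> by less than \<open>3 * pi\<close>.\<close>
  have "k mod n \<noteq> a mod n"
  proof
    assume eq: "k mod n = a mod n"
    then obtain q where q: "k = a + q * n"
      using ak by (metis less_imp_le mod_eq_nat1E mult.commute)
    have "q \<ge> 1" using q ak by (cases q) auto
    then have "1 * (2 * pi * 2) \<le> real q * (2 * pi * real m)"
      using m2 by (intro mult_mono) auto
    then have "\<phi> k \<ge> \<phi> a + 4 * pi" using \<phi>_add_mult[of a q] q by simp
    moreover have "\<phi> k < \<phi> a + 3 * pi" using \<phi>k \<delta> \<theta>(2)[of k] by simp
    ultimately show False using pi_gt_zero by linarith
  qed
  moreover have "side Q (k mod n) \<inter> side Q (a mod n) \<subseteq> {vertex Q (k mod n), vertex Q (Suc (k mod n))}"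
    if "k mod n \<noteq> a mod n"
    using Q that n unfolding hyp_ngon_def by simp
  ultimately have "side Q k \<inter> side Q a \<subseteq> {vertex Q k, vertex Q (Suc k)}"
    using side_mod[of Q] vertex_mod[of Q k] vertex_Suc_mod[of Q k] n by simp
  then show False using Xk Xa Xv by auto
qed

end

section \<open>Polygons circumscribed about the origin\<close>

lemma cos_le_cos_of_between:
  assumes "0 \<le> t" "t \<le> x" "x \<le> 2 * pi - t"
  shows "cos x \<le> cos t"
proof (cases "x \<le> pi")
  case True
  then show ?thesis using assms by (intro cos_monotone_0_pi_le) auto
next
  case False
  have "cos (2 * pi - x) \<le> cos t" using assms False by (intro cos_monotone_0_pi_le) auto
  then show ?thesis by simp
qed

lemma inner_cis_eq_Re: "inner (cis a) z = Re (cis (- a) * z)"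
  by (simp add: inner_complex_def)

lemma cis_cancel [simp]: "cis a * (cis (- a) * z) = z" "cis (- a) * (cis a * z) = z"
  by (simp_all add: cis_mult flip: mult.assoc)

lemma ex_polar_in_interval:
  obtains \<alpha> where "\<psi> \<le> \<alpha>" "\<alpha> < \<psi> + 2 * pi" "z = of_real (norm z) * cis \<alpha>"
proof
  define k where "k = \<lfloor>(Arg z - \<psi>) / (2 * pi)\<rfloor>"
  define \<alpha> where "\<alpha> = Arg z - 2 * pi * of_int k"
  have "of_int k \<le> (Arg z - \<psi>) / (2 * pi)" "(Arg z - \<psi>) / (2 * pi) < of_int k + 1"
    unfolding k_def by linarith+
  then show "\<psi> \<le> \<alpha>" "\<alpha> < \<psi> + 2 * pi"
    by (simp_all add: \<alpha>_def field_simps)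
  have "cis \<alpha> = cis (Arg z) * cis (2 * pi * of_int (- k))"
    by (simp add: \<alpha>_def cis_mult)
  also have "cis (2 * pi * of_int (- k)) = 1"
    by (rule cis_multiple_2pi) auto
  finally show "z = of_real (norm z) * cis \<alpha>"
    using rcis_cmod_Arg[of z] by (simp add: rcis_def)
qed

lemma convexD_3:
  assumes "convex S" "x \<in> S" "y \<in> S" "z \<in> S" "0 \<le> u" "0 \<le> v" "0 \<le> w" "u + v + w = 1"
  shows "u *\<^sub>R x + v *\<^sub>R y + w *\<^sub>R z \<in> S"
proof -
  have "u *\<^sub>R x + v *\<^sub>R y + w *\<^sub>R z \<in> convex hull {x, y, z}"
    unfolding convex_hull_3 using assms by blast
  moreover have "convex hull {x, y, z} \<subseteq> S"
    using assms by (intro hull_minimal) auto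
  ultimately show ?thesis by blast
qed

text \<open>Both ends have real part \<rho>, so \<open>x + y \<le> 1\<close> says exactly that w has
  not passed the side line. This turns membership in a sector triangle into a convex combination
  with 0.\<close>

lemma sector_coordinates:
  assumes "0 < \<rho>" "0 < s" "0 < t" and w: "- (Re w * s) \<le> Im w" "Im w \<le> Re w * t"
  obtains x y where "0 \<le> x" "0 \<le> y" "Re w = (x + y) * \<rho>"
    "w = x *\<^sub>R Complex \<rho> (- (\<rho> * s)) + y *\<^sub>R Complex \<rho> (\<rho> * t)"
proof
  define x y where "x = (Re w * t - Im w) / (\<rho> * (s + t))" and "y = (Im w + Re w * s) / (\<rho> * (s + t))"
  show "0 \<le> x" "0 \<le> y" using assms by (auto simp: x_def y_def intro!: divide_nonneg_pos)
  have d: "\<rho> * (s + t) \<noteq> 0" using assms by simp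
  have "x + y = Re w * (s + t) / (\<rho> * (s + t))"
    by (simp add: x_def y_def add_divide_distrib[symmetric] algebra_simps)
  then show R: "Re w = (x + y) * \<rho>" using assms by simp
  have "y * t - x * s = Im w * (s + t) / (\<rho> * (s + t))"
    by (simp add: x_def y_def diff_divide_distrib[symmetric] algebra_simps)
  then have "Im w = (y * t - x * s) * \<rho>" using assms by simp
  then show "w = x *\<^sub>R Complex \<rho> (- (\<rho> * s)) + y *\<^sub>R Complex \<rho> (\<rho> * t)"
    using R by (simp add: complex_eq_iff algebra_simps)
qed

locale centred_polygon = circumscribed n 1 \<rho> \<phi> \<theta> Q for n \<rho> \<phi> \<theta> Q
begin

abbreviation "polyhull \<equiv> convex hull (set Q)"

text \<open>The lifted polar angle of vertex i; side i is seen from the centre between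
  \<open>\<psi> i\<close> and \<open>\<psi> (Suc i)\<close>.\<close>

definition \<psi> :: "nat \<Rightarrow> real" where "\<psi> i = \<phi> i - \<theta> i"

lemma \<psi>_Suc: "\<psi> (Suc i) = \<phi> i + \<theta> (Suc i)"
  by (simp add: \<psi>_def \<phi>(1))

lemma \<psi>_strict_mono: "i < j \<Longrightarrow> \<psi> i < \<psi> j"
proof (rule lift_Suc_mono_less[of \<psi>])
  fix i show "\<psi> i < \<psi> (Suc i)" using \<theta>(1)[of i] \<theta>(1)[of "Suc i"] by (simp only: \<psi>_Suc) (simp add: \<psi>_def)
qed

lemma \<psi>_mono: "i \<le> j \<Longrightarrow> \<psi> i \<le> \<psi> j"
  using \<psi>_strict_mono by (cases "i = j") (auto simp: less_imp_le)

lemma \<psi>_add_n: "\<psi> (i + n) = \<psi> i + 2 * pi"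
  by (simp add: \<psi>_def \<phi>(2) \<theta>(4))

lemma tan_pos: "0 < tan (\<theta> i)"
  using \<theta>(1,2) by (intro tan_gt_zero)

section \<open>Side lines as supporting lines; the hull cut into sectors\<close>

lemma Q_nonempty: "Q \<noteq> []" using n by auto

lemma vertex_in_hull: "vertex Q i \<in> polyhull"
  using vertex_in_set[OF Q_nonempty] hull_subset[of "set Q" convex] by blast

lemma vertex_add_n: "vertex Q (i + n) = vertex Q i"
  using n by (simp add: vertex_def)

text \<open>Vertex j has modulus \<open>\<rho> / cos (\<theta> j)\<close>, so its angle with the
  normal of side i must be at least \<open>\<theta> j\<close>. As i runs from j to
  \<open>j + n - 1\<close>, the difference of lifted angles runs from \<open>\<theta> j\<close> to
  \<open>2 * pi - \<theta> j\<close>.\<close>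

lemma vertex_below_tangent:
  assumes "j \<le> i" "i < j + n" "0 < j"
  shows "inner (cis (\<phi> i)) (vertex Q j) \<le> \<rho>"
proof -
  have "\<phi> j \<le> \<phi> i" using assms by (intro \<phi>_mono)
  moreover have "\<phi> i \<le> \<phi> (j - 1 + n)" using assms by (intro \<phi>_mono) simp
  then have "\<phi> i \<le> \<phi> j - 2 * \<theta> j + 2 * pi"
    using \<phi>(1)[of "j - 1"] \<phi>(2)[of "j - 1"] assms by simp
  ultimately have "cos (\<phi> i - (\<phi> j - \<theta> j)) \<le> cos (\<theta> j)"
    using \<theta>(1)[of j] by (intro cos_le_cos_of_between) auto
  moreover have "cis (- \<phi> i) * vertex Q j = of_real (\<rho> / cos (\<theta> j)) * (cis (- \<phi> i) * cis (\<phi> j - \<theta> j))"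
    unfolding vertex_eq by (simp only: mult_ac)
  then have "inner (cis (\<phi> i)) (vertex Q j) = \<rho> / cos (\<theta> j) * cos (\<phi> j - \<theta> j - \<phi> i)"
    unfolding inner_cis_eq_Re cis_mult by (simp add: algebra_simps)
  moreover have "cos (\<phi> j - \<theta> j - \<phi> i) = cos (\<phi> i - (\<phi> j - \<theta> j))"
    using cos_minus[of "\<phi> j - \<theta> j - \<phi> i"] by (simp add: algebra_simps)
  ultimately show ?thesis using cos_pos[of j] \<rho> by (simp add: divide_le_eq)
qed

text \<open>Every vertex has an index j with \<open>j \<le> i < j + n\<close>. The bound
  \<open>n \<le> i\<close> makes j positive, so that side \<open>j - 1\<close> exists; this is why
  one turn is indexed by \<open>{n..<2 * n}\<close>.\<close>

lemma hull_below_tangent: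
  assumes "n \<le> i" "z \<in> polyhull"
  shows "inner (cis (\<phi> i)) z \<le> \<rho>"
proof -
  have "set Q \<subseteq> {z. inner (cis (\<phi> i)) z \<le> \<rho>}"
  proof
    fix x assume "x \<in> set Q"
    then obtain k where k: "k < n" "x = vertex Q k"
      using n by (auto simp: set_eq_vertex_image)
    define q where "q = (i - k) div n"
    define j where "j = k + q * n"
    have e: "i = j + (i - k) mod n"
      using assms k by (simp add: j_def q_def)
    have "(i - k) mod n < n" using n by simp
    moreover have "vertex Q j = x" using n k by (simp add: j_def vertex_def)
    moreover have "0 < j" using e calculation(1) assms by linarith
    ultimately show "x \<in> {z. inner (cis (\<phi> i)) z \<le> \<rho>}"
      using vertex_below_tangent[of j i] e by simp
  qed
  then have "polyhull \<subseteq> {z. inner (cis (\<phi> i)) z \<le> \<rho>}"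
    by (intro hull_minimal convex_halfspace_le)
  then show ?thesis using assms by auto
qed

text \<open>The least k whose \<open>\<psi> k\<close> exceeds the polar angle of z ends the sector
  of z.\<close>

lemma ex_sector:
  obtains i where "i \<in> {n..<2 * n}"
    "- (Re (cis (- \<phi> i) * z) * tan (\<theta> i)) \<le> Im (cis (- \<phi> i) * z)"
    "Im (cis (- \<phi> i) * z) \<le> Re (cis (- \<phi> i) * z) * tan (\<theta> (Suc i))"
proof -
  obtain \<alpha> where \<alpha>: "\<psi> n \<le> \<alpha>" "\<alpha> < \<psi> n + 2 * pi" "z = of_real (norm z) * cis \<alpha>"
    by (rule ex_polar_in_interval)
  have ex: "\<alpha> < \<psi> (n + n)" using \<alpha> by (simp add: \<psi>_add_n)
  define k where "k = (LEAST k. \<alpha> < \<psi> k)"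
  have k: "\<alpha> < \<psi> k" unfolding k_def using ex by (rule LeastI)
  have kn: "k \<le> n + n" unfolding k_def using ex by (rule Least_le)
  have "n < k"
  proof (rule ccontr)
    assume "\<not> n < k"
    then have "\<psi> k \<le> \<psi> n" by (intro \<psi>_mono) simp
    then show False using \<alpha> k by simp
  qed
  then obtain i where i: "k = Suc i" "n \<le> i" by (cases k) auto
  have "\<not> \<alpha> < \<psi> i" using not_less_Least[of i "\<lambda>k. \<alpha> < \<psi> k"] i unfolding k_def by auto
  then have d: "- \<theta> i \<le> \<alpha> - \<phi> i" "\<alpha> - \<phi> i \<le> \<theta> (Suc i)"
    using k unfolding i(1) \<psi>_Suc by (simp_all add: \<psi>_def)
  define d where "d = \<alpha> - \<phi> i"
  have bounds: "- (pi/2) < - \<theta> i" "\<theta> (Suc i) < pi/2" using \<theta>(2)[of i] \<theta>(2)[of "Suc i"] by auto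
  have cd: "cos d > 0" using d bounds by (intro cos_gt_zero_pi) (auto simp: d_def)
  have tan: "- tan (\<theta> i) \<le> tan d" "tan d \<le> tan (\<theta> (Suc i))"
    using d bounds tan_mono_le_eq[of "- \<theta> i" d] tan_mono_le_eq[of d "\<theta> (Suc i)"] \<theta>(1)[of i] \<theta>(1)[of "Suc i"]
    by (auto simp: d_def)
  have "cis (- \<phi> i) * z = of_real (norm z) * (cis (- \<phi> i) * cis \<alpha>)"
    by (subst \<alpha>(3)) (simp only: mult_ac)
  then have w: "Re (cis (- \<phi> i) * z) = norm z * cos d" "Im (cis (- \<phi> i) * z) = norm z * cos d * tan d"
    using cd by (simp_all only: cis_mult) (simp_all add: d_def tan_def)
  have r: "norm z * cos d \<ge> 0" using cd by simp
  show ?thesis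
  proof (rule that[of i])
    show "i \<in> {n..<2 * n}" using i kn by auto
    show "- (Re (cis (- \<phi> i) * z) * tan (\<theta> i)) \<le> Im (cis (- \<phi> i) * z)"
      using mult_left_mono[OF tan(1) r] unfolding w by simp
    show "Im (cis (- \<phi> i) * z) \<le> Re (cis (- \<phi> i) * z) * tan (\<theta> (Suc i))"
      using mult_left_mono[OF tan(2) r] unfolding w by simp
  qed
qed

lemma sector_combination:
  assumes "- (Re (cis (- \<phi> i) * z) * tan (\<theta> i)) \<le> Im (cis (- \<phi> i) * z)"
    "Im (cis (- \<phi> i) * z) \<le> Re (cis (- \<phi> i) * z) * tan (\<theta> (Suc i))"
  obtains x y where "0 \<le> x" "0 \<le> y" "Re (cis (- \<phi> i) * z) = (x + y) * \<rho>"
    "z = x *\<^sub>R vertex Q i + y *\<^sub>R vertex Q (Suc i)"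
proof -
  obtain x y where xy: "0 \<le> x" "0 \<le> y" "Re (cis (- \<phi> i) * z) = (x + y) * \<rho>"
    "cis (- \<phi> i) * z = x *\<^sub>R Complex \<rho> (- (\<rho> * tan (\<theta> i))) + y *\<^sub>R Complex \<rho> (\<rho> * tan (\<theta> (Suc i)))"
    by (rule sector_coordinates[OF \<rho>(1) tan_pos tan_pos assms])
  have "z = cis (\<phi> i) * (cis (- \<phi> i) * z)" by simp
  also have "\<dots> = x *\<^sub>R vertex Q i + y *\<^sub>R vertex Q (Suc i)"
    unfolding xy(4) vertex_Suc_eq' unfolding vertex_eq' by (simp only: distrib_left mult_scaleR_right)
  finally show ?thesis using that xy by blast
qed

text \<open>The point opposite to vertex 0 lies in some sector and so is a nonnegative combination
  of two vertices; moving everything to one side and dividing by the total weight gives 0.\<close>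

lemma zero_in_hull: "0 \<in> polyhull"
proof -
  obtain i where i: "i \<in> {n..<2 * n}"
    "- (Re (cis (- \<phi> i) * (- vertex Q 0)) * tan (\<theta> i)) \<le> Im (cis (- \<phi> i) * (- vertex Q 0))"
    "Im (cis (- \<phi> i) * (- vertex Q 0)) \<le> Re (cis (- \<phi> i) * (- vertex Q 0)) * tan (\<theta> (Suc i))"
    by (rule ex_sector)
  obtain x y where xy: "0 \<le> x" "0 \<le> y" "- vertex Q 0 = x *\<^sub>R vertex Q i + y *\<^sub>R vertex Q (Suc i)"
    by (rule sector_combination[OF i(2,3)])
  define s where "s = 1 + x + y"
  have s: "s > 0" using xy by (simp add: s_def)
  have c: "(1/s) *\<^sub>R vertex Q 0 + (x/s) *\<^sub>R vertex Q i + (y/s) *\<^sub>R vertex Q (Suc i) \<in> polyhull"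
    using s xy vertex_in_hull
    by (intro convexD_3[OF convex_convex_hull]) (auto simp: s_def add_divide_distrib[symmetric])
  have "(1/s) *\<^sub>R vertex Q 0 + (x/s) *\<^sub>R vertex Q i + (y/s) *\<^sub>R vertex Q (Suc i)
      = (1/s) *\<^sub>R (vertex Q 0 + (x *\<^sub>R vertex Q i + y *\<^sub>R vertex Q (Suc i)))"
    by (simp add: scaleR_add_right)
  also have "\<dots> = 0" unfolding xy(3)[symmetric] by simp
  finally show ?thesis using c by simp
qed

lemma sector_subset_hull:
  assumes "w \<in> sector_triangle \<rho> (\<theta> i) (\<theta> (Suc i))"
  shows "cis (\<phi> i) * w \<in> polyhull"
proof -
  have "- (Re (cis (- \<phi> i) * (cis (\<phi> i) * w)) * tan (\<theta> i)) \<le> Im (cis (- \<phi> i) * (cis (\<phi> i) * w))"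
    "Im (cis (- \<phi> i) * (cis (\<phi> i) * w)) \<le> Re (cis (- \<phi> i) * (cis (\<phi> i) * w)) * tan (\<theta> (Suc i))"
    using assms unfolding cis_cancel by (simp_all add: sector_triangle_def)
  then obtain x y where xy: "0 \<le> x" "0 \<le> y" "Re (cis (- \<phi> i) * (cis (\<phi> i) * w)) = (x + y) * \<rho>"
    "cis (\<phi> i) * w = x *\<^sub>R vertex Q i + y *\<^sub>R vertex Q (Suc i)"
    by (rule sector_combination)
  note xy(3)[unfolded cis_cancel]
  moreover have "Re w \<le> \<rho>" using assms by (simp add: sector_triangle_def)
  ultimately have "(x + y) * \<rho> \<le> 1 * \<rho>" by simp
  then have "x + y \<le> 1" using \<rho> by (auto simp only: mult_le_cancel_right)
  then have "(1 - x - y) *\<^sub>R 0 + x *\<^sub>R vertex Q i + y *\<^sub>R vertex Q (Suc i) \<in> polyhull"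
    using xy(1,2) vertex_in_hull zero_in_hull by (intro convexD_3[OF convex_convex_hull]) auto
  then show ?thesis unfolding xy(4) by simp
qed

lemma hull_sector:
  assumes z: "z \<in> polyhull"
  obtains i where "i \<in> {n..<2 * n}" "cis (- \<phi> i) * z \<in> sector_triangle \<rho> (\<theta> i) (\<theta> (Suc i))"
proof -
  obtain i where i: "i \<in> {n..<2 * n}"
    "- (Re (cis (- \<phi> i) * z) * tan (\<theta> i)) \<le> Im (cis (- \<phi> i) * z)"
    "Im (cis (- \<phi> i) * z) \<le> Re (cis (- \<phi> i) * z) * tan (\<theta> (Suc i))"
    by (rule ex_sector)
  obtain x y where xy: "0 \<le> x" "0 \<le> y" "Re (cis (- \<phi> i) * z) = (x + y) * \<rho>"
    by (rule sector_combination[OF i(2,3)])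
  have "Re (cis (- \<phi> i) * z) \<ge> 0" unfolding xy(3) using xy \<rho> by simp
  moreover have "Re (cis (- \<phi> i) * z) \<le> \<rho>"
    using hull_below_tangent[of i z] i z by (simp only: inner_cis_eq_Re) auto
  ultimately show ?thesis using that[of i] i by (simp add: sector_triangle_def)
qed

lemma hull_eq_Union_sectors:
  "polyhull = (\<Union>i\<in>{n..<2 * n}. (\<lambda>w. cis (\<phi> i) * w) ` sector_triangle \<rho> (\<theta> i) (\<theta> (Suc i)))"
proof (intro equalityI subsetI)
  fix z assume "z \<in> polyhull"
  then obtain i where i: "i \<in> {n..<2 * n}" "cis (- \<phi> i) * z \<in> sector_triangle \<rho> (\<theta> i) (\<theta> (Suc i))"
    by (rule hull_sector)
  have "z = cis (\<phi> i) * (cis (- \<phi> i) * z)" by simp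
  then show "z \<in> (\<Union>i\<in>{n..<2 * n}. (\<lambda>w. cis (\<phi> i) * w) ` sector_triangle \<rho> (\<theta> i) (\<theta> (Suc i)))"
    using i by blast
qed (use sector_subset_hull in auto)

lemma ball_subset_hull: "ball 0 \<rho> \<subseteq> polyhull"
proof
  fix z :: complex assume "z \<in> ball 0 \<rho>"
  then have z: "norm z < \<rho>" by simp
  obtain i where i: "i \<in> {n..<2 * n}"
    "- (Re (cis (- \<phi> i) * z) * tan (\<theta> i)) \<le> Im (cis (- \<phi> i) * z)"
    "Im (cis (- \<phi> i) * z) \<le> Re (cis (- \<phi> i) * z) * tan (\<theta> (Suc i))"
    by (rule ex_sector)
  obtain x y where xy: "0 \<le> x" "0 \<le> y" "Re (cis (- \<phi> i) * z) = (x + y) * \<rho>"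
    by (rule sector_combination[OF i(2,3)])
  have "0 \<le> Re (cis (- \<phi> i) * z)" unfolding xy(3) using xy \<rho> by simp
  moreover have "Re (cis (- \<phi> i) * z) \<le> \<rho>"
    using complex_Re_le_cmod[of "cis (- \<phi> i) * z"] z by (simp add: norm_mult)
  ultimately have "cis (\<phi> i) * (cis (- \<phi> i) * z) \<in> polyhull"
    using i by (intro sector_subset_hull) (simp add: sector_triangle_def)
  then show "z \<in> polyhull" by simp
qed

section \<open>The polygon as the frontier of its hull\<close>

lemma compact_hull: "compact polyhull"
  by (intro compact_convex_hull finite_imp_compact) simp

lemma hull_subset_hplane: "polyhull \<subseteq> hplane"
proof (rule hull_minimal[where S=convex and t=hplane, OF subsetI convex_hplane])
  fix x assume "x \<in> set Q"
  then obtain k where k: "x = vertex Q k" by (auto simp: set_eq_vertex_image)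
  have "norm x = \<rho> / cos (\<theta> k)"
    unfolding k vertex_eq using cos_pos[of k] \<rho> by (simp add: norm_mult norm_divide)
  then show "x \<in> hplane" using cos_pos[of k] \<theta>(3)[of k] by (simp add: hplane_iff)
qed

text \<open>Points of side i attain the bound \<rho> of the linear functional given by
  \<open>cis (\<phi> i)\<close>, so any step in that direction leaves the hull.\<close>

lemma boundary_subset_frontier: "boundary Q \<subseteq> frontier polyhull"
proof
  fix z assume "z \<in> boundary Q"
  then obtain k where "z \<in> side Q k" by (auto simp: boundary_def)
  then have z: "z \<in> closed_segment (vertex Q (k + n)) (vertex Q (Suc (k + n)))"
    using vertex_add_n[of k] vertex_add_n[of "Suc k"] by (simp add: side_def)
  define i where "i = k + n"
  have zH: "z \<in> polyhull"
    using z vertex_in_hull convex_convex_hull by (meson closed_segment_subset subsetD)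
  have "inner (cis (\<phi> i)) (vertex Q i) = \<rho>"
    unfolding inner_cis_eq_Re vertex_eq' by simp
  moreover have "inner (cis (\<phi> i)) (vertex Q (Suc i)) = \<rho>"
    unfolding inner_cis_eq_Re vertex_Suc_eq' by simp
  moreover obtain u where u: "z = (1 - u) *\<^sub>R vertex Q i + u *\<^sub>R vertex Q (Suc i)"
    using z by (auto simp: in_segment i_def)
  ultimately have zi: "inner (cis (\<phi> i)) z = \<rho>"
    by (simp add: u inner_add_right algebra_simps)
  have "z \<notin> interior polyhull"
  proof
    assume "z \<in> interior polyhull"
    then obtain e where e: "e > 0" "ball z e \<subseteq> polyhull" by (auto simp: mem_interior)
    have "z + (e/2) *\<^sub>R cis (\<phi> i) \<in> ball z e" using e by (simp add: dist_norm)
    then have "inner (cis (\<phi> i)) (z + (e/2) *\<^sub>R cis (\<phi> i)) \<le> \<rho>"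
      using e by (intro hull_below_tangent) (auto simp: i_def)
    moreover have "inner (cis (\<phi> i)) (cis (\<phi> i)) = 1" by (simp add: dot_square_norm)
    ultimately show False using zi e by (simp add: inner_add_right)
  qed
  then show "z \<in> frontier polyhull"
    using zH compact_hull by (simp add: frontier_def compact_imp_closed)
qed

text \<open>A point with \<open>0 < Re w < \<rho>\<close> can be stretched from 0 to the side line
  without leaving the hull. It is then a proper contraction of a hull point towards the interior
  point 0, hence interior. So a frontier point has \<open>Re w = \<rho>\<close> and lies on a
  side.\<close>

lemma frontier_subset_boundary: "frontier polyhull \<subseteq> boundary Q"
proof
  fix z assume "z \<in> frontier polyhull"
  then have z: "z \<in> polyhull" "z \<notin> interior polyhull"
    using compact_hull by (auto simp: frontier_def compact_imp_closed)
  obtain i where i: "i \<in> {n..<2 * n}" "cis (- \<phi> i) * z \<in> sector_triangle \<rho> (\<theta> i) (\<theta> (Suc i))"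
    using z(1) by (rule hull_sector)
  define w where "w = cis (- \<phi> i) * z"
  have zw: "z = cis (\<phi> i) * w" by (simp add: w_def)
  have w: "0 \<le> Re w" "Re w \<le> \<rho>" "- (Re w * tan (\<theta> i)) \<le> Im w" "Im w \<le> Re w * tan (\<theta> (Suc i))"
    using i(2) by (auto simp: sector_triangle_def w_def)
  have int0: "0 \<in> interior polyhull"
    using ball_subset_hull \<rho> by (auto simp: mem_interior)
  have "Re w = \<rho>"
  proof (rule ccontr)
    assume "Re w \<noteq> \<rho>"
    then have less: "Re w < \<rho>" using w by simp
    show False
    proof (cases "Re w = 0")
      case True
      then have "w = 0" using w by (simp add: complex_eq_iff)
      then show False using int0 z zw by simp
    next
      case False
      then have pos: "Re w > 0" using w by simp
      define z0 where "z0 = (\<rho> / Re w) *\<^sub>R z"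
      have "(\<rho> / Re w) *\<^sub>R w \<in> sector_triangle \<rho> (\<theta> i) (\<theta> (Suc i))"
        using pos w \<rho> mult_left_mono[OF w(3), of "\<rho> / Re w"] mult_left_mono[OF w(4), of "\<rho> / Re w"]
        by (simp add: sector_triangle_def)
      from sector_subset_hull[OF this] have "z0 \<in> polyhull"
        by (simp add: z0_def zw)
      then have "z0 - (1 - Re w / \<rho>) *\<^sub>R (z0 - 0) \<in> interior polyhull"
        using int0 less pos \<rho> by (intro mem_interior_convex_shrink) auto
      moreover have "z0 - (1 - Re w / \<rho>) *\<^sub>R (z0 - 0) = z"
        using pos \<rho> by (simp add: z0_def algebra_simps)
      ultimately show False using z by simp
    qed
  qed
  then have "w = Complex \<rho> (\<rho> * (Im w / \<rho>))" using \<rho> by (simp add: complex_eq_iff)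
  then have "z = cis (\<phi> i) * Complex \<rho> (\<rho> * (Im w / \<rho>))" using zw by simp
  also have "\<dots> \<in> side Q i"
    using w \<rho> \<open>Re w = \<rho>\<close> by (intro tangent_point_in_side) (auto simp: field_simps)
  finally have "z \<in> side Q (i mod n)" using side_mod[of Q i] n by simp
  then show "z \<in> boundary Q"
    unfolding boundary_def by (rule UN_I[rotated]) (use n in simp)
qed

lemma boundary_eq_frontier: "boundary Q = frontier polyhull"
  using boundary_subset_frontier frontier_subset_boundary by blast

section \<open>The area as a sum over sectors\<close>

lemma sum_\<theta>: "(\<Sum>i<n. \<theta> i) = pi"
proof -
  have "\<phi> k = \<phi> 0 + 2 * (\<Sum>i<k. \<theta> (Suc i))" for k
    by (induction k) (simp_all add: \<phi>(1))
  from this[of n] have "(\<Sum>i<n. \<theta> (Suc i)) = pi" using \<phi>(2)[of 0] by simp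
  moreover have "\<theta> 0 + (\<Sum>i<n. \<theta> (Suc i)) = (\<Sum>i<n. \<theta> i) + \<theta> n"
    by (simp flip: sum.lessThan_Suc_shift)
  ultimately show ?thesis using \<theta>(4)[of 0] by simp
qed

lemma rotated_sector_angle:
  assumes "cis (- \<phi> i) * z \<in> sector_triangle \<rho> (\<theta> i) (\<theta> (Suc i))"
  obtains \<alpha> where "\<psi> i \<le> \<alpha>" "\<alpha> \<le> \<psi> (Suc i)" "z = of_real (norm z) * cis \<alpha>"
proof (cases "z = 0")
  case True
  then show ?thesis using that[of "\<psi> i"] \<psi>_mono[of i "Suc i"] by simp
next
  case False
  define w where "w = cis (- \<phi> i) * z"
  have w: "0 \<le> Re w" "- (Re w * tan (\<theta> i)) \<le> Im w" "Im w \<le> Re w * tan (\<theta> (Suc i))"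
    using assms by (auto simp: sector_triangle_def w_def)
  have zw: "z = cis (\<phi> i) * w" by (simp add: w_def)
  have "w \<noteq> 0" using False zw by auto
  then have pos: "Re w > 0" using w by (cases "Re w = 0") (auto simp: complex_eq_iff)
  define d where "d = arctan (Im w / Re w)"
  have wd: "w = of_real (Re w / cos d) * cis d"
    using Complex_polar(1)[OF pos d_def] by simp
  have cd: "cos d > 0"
    using arctan_bounded[of "Im w / Re w"] unfolding d_def by (intro cos_gt_zero_pi) auto
  have "norm z = norm w" by (simp add: zw norm_mult)
  also have "\<dots> = Re w / cos d" using arg_cong[OF wd, of norm] pos cd by (simp add: norm_mult norm_divide)
  finally have nz: "norm z = Re w / cos d" .
  have "arctan (- tan (\<theta> i)) \<le> d" "d \<le> arctan (tan (\<theta> (Suc i)))"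
    unfolding d_def arctan_le_iff using w pos by (simp_all add: le_divide_eq divide_le_eq mult.commute)
  then have d: "- \<theta> i \<le> d" "d \<le> \<theta> (Suc i)"
    using \<theta>(1,2)[of i] \<theta>(1,2)[of "Suc i"] by (simp_all add: arctan_minus arctan_tan)
  have "z = of_real (norm z) * (cis (\<phi> i) * cis d)"
    unfolding nz by (subst zw, subst wd) (simp only: mult_ac)
  then show ?thesis
    using that[of "\<phi> i + d"] d by (simp add: cis_mult \<psi>_Suc) (simp add: \<psi>_def)
qed

text \<open>Full lines through the centre and the vertices, written as hyperplanes since these are
  negligible; they contain all overlaps of sectors.\<close>

definition rays :: "complex set" where
  "rays = (\<Union>i\<in>{n..2 * n}. {z. inner (cis (\<psi> i + pi/2)) z = 0})"

lemma AE_not_in_rays: "AE z in lborel. z \<notin> rays"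
proof -
  have "negligible rays"
    unfolding rays_def by (intro negligible_Union) (auto intro!: negligible_hyperplane)
  moreover have "rays \<in> sets lborel"
    unfolding rays_def by (auto intro!: sets.finite_UN borel_closed closed_hyperplane)
  ultimately have "rays \<in> null_sets lborel"
    by (simp add: negligible_iff_null_sets null_sets_completion_iff)
  then show ?thesis by (rule AE_not_in)
qed

lemma ray_in_rays:
  assumes "z = of_real (norm z) * cis (\<psi> i)" "i \<in> {n..2 * n}"
  shows "z \<in> rays"
proof -
  have "inner (cis (\<psi> i + pi/2)) z = Re (of_real (norm z) * (cis (- (\<psi> i + pi/2)) * cis (\<psi> i)))"
    unfolding inner_cis_eq_Re by (subst assms(1)) (simp only: mult_ac)
  also have "\<dots> = 0" unfolding cis_mult by (simp add: cos_diff)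
  finally show ?thesis using assms(2) unfolding rays_def by blast
qed

text \<open>Both sectors lie within one turn, so the two lifted angles of z differ by 0 or
  \<open>2 * pi\<close>. Either value forces one of them to its extreme, the direction of a
  vertex.\<close>

lemma sectors_overlap_in_rays:
  assumes ij: "n \<le> i" "i < j" "j < 2 * n"
    and zi: "cis (- \<phi> i) * z \<in> sector_triangle \<rho> (\<theta> i) (\<theta> (Suc i))"
    and zj: "cis (- \<phi> j) * z \<in> sector_triangle \<rho> (\<theta> j) (\<theta> (Suc j))"
  shows "z \<in> rays"
proof -
  obtain a where a: "\<psi> i \<le> a" "a \<le> \<psi> (Suc i)" "z = of_real (norm z) * cis a"
    by (rule rotated_sector_angle[OF zi])
  obtain b where b: "\<psi> j \<le> b" "b \<le> \<psi> (Suc j)" "z = of_real (norm z) * cis b"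
    by (rule rotated_sector_angle[OF zj])
  have m: "\<psi> (Suc i) \<le> \<psi> j" using ij by (intro \<psi>_mono) simp
  have M: "\<psi> (Suc j) \<le> \<psi> i + 2 * pi"
    unfolding \<psi>_add_n[symmetric] using ij by (intro \<psi>_mono) simp
  show ?thesis
  proof (cases "z = 0")
    case True
    then show ?thesis using ray_in_rays[of z n] by simp
  next
    case False
    have "of_real (norm z) * cis a = of_real (norm z) * cis b" using a(3) b(3) by metis
    then have "cis b = cis a" using False by simp
    then have "cis (b - a) = 1" by (simp flip: cis_divide)
    then have "cos (b - a) = 1" by (simp add: complex_eq_iff)
    then obtain k :: int where k: "b - a = of_int k * 2 * pi"
      by (auto simp: cos_one_2pi_int)
    have ba: "0 \<le> b - a" "b - a \<le> 2 * pi" using a b m M by auto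
    have "0 * (2 * pi) \<le> of_int k * (2 * pi)" "of_int k * (2 * pi) \<le> 1 * (2 * pi)" using ba k by auto
    then have "0 \<le> real_of_int k" "real_of_int k \<le> 1"
      unfolding mult_le_cancel_right using pi_gt_zero by auto
    then have "k = 0 \<or> k = 1" by linarith
    then show ?thesis
    proof
      assume "k = 0"
      then have "b = \<psi> j" using k a b m by simp
      then show ?thesis using b(3) ij by (intro ray_in_rays[of z j]) auto
    next
      assume "k = 1"
      then have "a = \<psi> i" using k a b M by simp
      then show ?thesis using a(3) ij by (intro ray_in_rays[of z i]) auto
    qed
  qed
qed

lemma harea_hull: "harea polyhull = 2 * (\<Sum>i<n. right_triangle_area \<rho> (\<theta> i))"
proof -
  define T where "T i = sector_triangle \<rho> (\<theta> i) (\<theta> (Suc i))" for i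
  define C where "C i = (\<lambda>w. cis (\<phi> i) * w) ` T i" for i
  define I where "I = {n..<2 * n}"
  have I: "finite I" by (simp add: I_def)
  have hull: "polyhull = (\<Union>i\<in>I. C i)"
    unfolding hull_eq_Union_sectors C_def T_def I_def ..
  have C_iff: "z \<in> C i \<longleftrightarrow> cis (- \<phi> i) * z \<in> T i" for z i
    unfolding C_def by (metis (no_types, lifting) cis_cancel image_iff)
  have TH: "T i \<subseteq> hplane" for i
  proof
    fix w assume "w \<in> T i"
    then have "cis (\<phi> i) * w \<in> hplane" using sector_subset_hull hull_subset_hplane by (auto simp: T_def)
    then show "w \<in> hplane" by (simp add: hplane_iff norm_mult)
  qed
  have "closed (T i)" for i
    unfolding T_def sector_triangle_def
    by (intro closed_Collect_conj closed_Collect_le continuous_intros)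
  moreover have "bounded (T i)" for i
    using TH[of i] bounded_ball[of "0::complex" 1] unfolding hplane_def by (rule bounded_subset[rotated])
  ultimately have T: "compact (T i)" for i by (simp add: compact_eq_bounded_closed)
  have C: "compact (C i)" "C i \<subseteq> hplane" "harea (C i) = right_triangle_area \<rho> (\<theta> i) + right_triangle_area \<rho> (\<theta> (Suc i))" for i
    using hisometry_compact_image[OF hisometry_rotation T TH, of "\<phi> i" i]
      harea_hisometry[OF hisometry_rotation T TH, of "\<phi> i" i] harea_sector_triangle[of "\<theta> i" "\<theta> (Suc i)" \<rho>] \<theta> \<rho>
    by (simp_all add: C_def T_def)
  have int: "integrable lborel (\<lambda>z. indicator (C i) z *\<^sub>R hdensity z)" for i
    using C(1,2)[of i] by (intro borel_integrable_compact continuous_on_subset[OF continuous_on_hdensity])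
  \<comment> \<open>Off a null set each point of the hull belongs to exactly one sector, so areas
    add.\<close>
  have ind: "indicator polyhull z = (\<Sum>i\<in>I. indicator (C i) z :: real)" if z: "z \<notin> rays" for z
  proof (cases "z \<in> polyhull")
    case False
    then have "\<And>i. i \<in> I \<Longrightarrow> z \<notin> C i" using hull by auto
    then show ?thesis using False by simp
  next
    case True
    then obtain i where i: "i \<in> I" "z \<in> C i" using hull by auto
    have "z \<notin> C j" if "j \<in> I" "j \<noteq> i" for j
    proof
      assume "z \<in> C j"
      then show False
        using i that z sectors_overlap_in_rays[of i j z] sectors_overlap_in_rays[of j i z]
        unfolding C_iff T_def I_def by (cases "i < j") auto
    qed
    then have "(\<Sum>j\<in>I. indicator (C j) z :: real) = (\<Sum>j\<in>I. if j = i then 1 else 0)"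
      using i by (intro sum.cong) auto
    then show ?thesis using True i I by simp
  qed
  have [measurable]: "polyhull \<in> sets borel" using compact_hull by (rule borel_compact)
  have [measurable]: "C i \<in> sets borel" for i using C(1) by (rule borel_compact)
  have per: "\<theta> (a - n) = \<theta> a" "\<theta> (Suc (a - n)) = \<theta> (Suc a)" if "n \<le> a" for a
    using \<theta>(4)[of "a - n"] \<theta>(4)[of "Suc (a - n)"] that by simp_all
  have harea: "harea S = (\<integral>z. indicator S z *\<^sub>R hdensity z \<partial>lborel)" for S
    by (simp add: harea_def set_lebesgue_integral_def hdensity_def)
  have "harea polyhull = (\<integral>z. (\<Sum>i\<in>I. indicator (C i) z *\<^sub>R hdensity z) \<partial>lborel)"
    unfolding harea using AE_not_in_rays
    by (intro integral_cong_AE) (auto elim!: eventually_mono simp: ind sum_distrib_right)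
  also have "\<dots> = (\<Sum>i\<in>I. harea (C i))"
    unfolding harea using int by (intro Bochner_Integration.integral_sum)
  also have "\<dots> = (\<Sum>i\<in>I. right_triangle_area \<rho> (\<theta> i) + right_triangle_area \<rho> (\<theta> (Suc i)))"
    by (simp add: C(3))
  also have "\<dots> = (\<Sum>i<n. right_triangle_area \<rho> (\<theta> i) + right_triangle_area \<rho> (\<theta> (Suc i)))"
    by (rule sum.reindex_bij_witness[of _ "\<lambda>i. i + n" "\<lambda>i. i - n"])
      (auto simp: I_def per)
  \<comment> \<open>Each angle occurs twice, after one point of tangency and before the next;
    periodicity closes the shifted sum.\<close>
  also have "\<dots> = 2 * (\<Sum>i<n. right_triangle_area \<rho> (\<theta> i))"
  proof -
    have "right_triangle_area \<rho> (\<theta> 0) + (\<Sum>i<n. right_triangle_area \<rho> (\<theta> (Suc i)))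
        = (\<Sum>i<n. right_triangle_area \<rho> (\<theta> i)) + right_triangle_area \<rho> (\<theta> n)"
      using sum.lessThan_Suc_shift[of "\<lambda>i. right_triangle_area \<rho> (\<theta> i)" n] by simp
    then show ?thesis using \<theta>(4)[of 0] by (simp add: sum.distrib)
  qed
  finally show ?thesis .
qed

text \<open>The two neighbours of a vertex may be replaced by the points of tangency, since only directions matter.\<close>

lemma hangle_vertex:
  "hangle (vertex Q (Suc i)) (vertex Q i - vertex Q (Suc i)) (vertex Q (Suc (Suc i)) - vertex Q (Suc i))
    = arccos (2 * (sin (\<theta> (Suc i)))\<^sup>2 / (1 - \<rho>\<^sup>2) - 1)"
proof -
  define t where "t = \<theta> (Suc i)"
  define p where "p j = of_real \<rho> * cis (\<phi> j)" for j
  define x where "x = vertex Q (Suc i)"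
  have p: "p j = cis (\<phi> j) * Complex \<rho> 0" for j by (simp add: p_def complex_eq_iff)
  have t1: "vertex Q i - x = ((tan (\<theta> i) + tan t) / tan t) *\<^sub>R (p i - x)"
  proof -
    have "Complex \<rho> (- (\<rho> * tan (\<theta> i))) - Complex \<rho> (\<rho> * tan t)
        = ((tan (\<theta> i) + tan t) / tan t) *\<^sub>R (Complex \<rho> 0 - Complex \<rho> (\<rho> * tan t))"
      using tan_pos[of "Suc i"] by (simp add: complex_eq_iff t_def field_simps)
    then have "cis (\<phi> i) * (Complex \<rho> (- (\<rho> * tan (\<theta> i))) - Complex \<rho> (\<rho> * tan t))
        = ((tan (\<theta> i) + tan t) / tan t) *\<^sub>R (cis (\<phi> i) * (Complex \<rho> 0 - Complex \<rho> (\<rho> * tan t)))"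
      by (simp only: mult_scaleR_right)
    then show ?thesis
      unfolding x_def vertex_Suc_eq' p unfolding vertex_eq' t_def right_diff_distrib .
  qed
  have t2: "vertex Q (Suc (Suc i)) - x = ((tan (\<theta> (Suc (Suc i))) + tan t) / tan t) *\<^sub>R (p (Suc i) - x)"
  proof -
    have "Complex \<rho> (\<rho> * tan (\<theta> (Suc (Suc i)))) - Complex \<rho> (- (\<rho> * tan t))
        = ((tan (\<theta> (Suc (Suc i))) + tan t) / tan t) *\<^sub>R (Complex \<rho> 0 - Complex \<rho> (- (\<rho> * tan t)))"
      using tan_pos[of "Suc i"] by (simp add: complex_eq_iff t_def field_simps)
    then have "cis (\<phi> (Suc i)) * (Complex \<rho> (\<rho> * tan (\<theta> (Suc (Suc i)))) - Complex \<rho> (- (\<rho> * tan t)))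
        = ((tan (\<theta> (Suc (Suc i))) + tan t) / tan t) *\<^sub>R (cis (\<phi> (Suc i)) * (Complex \<rho> 0 - Complex \<rho> (- (\<rho> * tan t))))"
      by (simp only: mult_scaleR_right)
    then show ?thesis
      unfolding x_def vertex_Suc_eq'[of "Suc i"] vertex_eq'[of "Suc i"] p t_def right_diff_distrib .
  qed
  have "hangle x (vertex Q i - x) (vertex Q (Suc (Suc i)) - x) = hangle x (p i - x) (p (Suc i) - x)"
    unfolding t1 t2 using tan_pos by (intro hangle_scaleR) (simp_all add: t_def add_pos_pos)
  also have "\<dots> = arccos (2 * (sin t)\<^sup>2 / (1 - \<rho>\<^sup>2) - 1)"
  proof -
    define c where "c = cos t"
    have c: "c > 0" "\<rho> < c" using cos_pos[of "Suc i"] \<theta>(3)[of "Suc i"] by (auto simp: c_def t_def)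
    have c1: "c < 1"
      using cos_monotone_0_pi[of 0 t] \<theta>(1,2)[of "Suc i"] by (simp add: c_def t_def)
    define q where "q = 1 - \<rho>\<^sup>2"
    have q: "q > 0" using \<rho> by (simp add: q_def abs_square_less_1)
    have xh: "x \<in> hplane" using vertex_in_hull hull_subset_hplane by (auto simp: x_def)
    have xe: "x = of_real (\<rho> / c) * cis (\<psi> (Suc i))" by (simp add: x_def vertex_eq \<psi>_def c_def t_def)
    have inner_cis: "inner (of_real a * cis u) (of_real b * cis v) = a * b * cos (u - v)" for a b u v
      by (simp add: inner_complex_def cos_diff algebra_simps)
    have L: "lform x x = 1 - \<rho>\<^sup>2 / c\<^sup>2" "lform x (p i) = q" "lform x (p (Suc i)) = q"
      "lform (p i) (p i) = q" "lform (p (Suc i)) (p (Suc i)) = q" "lform (p i) (p (Suc i)) = 1 - \<rho>\<^sup>2 * (2 * c\<^sup>2 - 1)"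
    proof -
      have d: "\<psi> (Suc i) - \<phi> i = t" "\<psi> (Suc i) - \<phi> (Suc i) = - t" "\<phi> i - \<phi> (Suc i) = - (2 * t)"
        using \<phi>(1)[of i] by (simp_all add: \<psi>_def t_def)
      show "lform x x = 1 - \<rho>\<^sup>2 / c\<^sup>2" "lform x (p i) = q" "lform x (p (Suc i)) = q"
      "lform (p i) (p i) = q" "lform (p (Suc i)) (p (Suc i)) = q" "lform (p i) (p (Suc i)) = 1 - \<rho>\<^sup>2 * (2 * c\<^sup>2 - 1)"
        using c unfolding lform_def xe p_def inner_cis d
        by (simp_all add: q_def power2_eq_square cos_double_cos flip: c_def)
    qed
    define k where "k = 1 / c\<^sup>2 - 1"
    have k: "k > 0" using c c1 by (simp add: k_def divide_simps power_less_one_iff)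
    have H: "hmetric x (p i - x) (p i - x) = q * (\<rho>\<^sup>2 * k) / (lform x x)\<^sup>2"
       "hmetric x (p (Suc i) - x) (p (Suc i) - x) = q * (\<rho>\<^sup>2 * k) / (lform x x)\<^sup>2"
       "hmetric x (p i - x) (p (Suc i) - x) = (1 + \<rho>\<^sup>2 - 2 * c\<^sup>2) * (\<rho>\<^sup>2 * k) / (lform x x)\<^sup>2"
    proof -
      have 1: "q * q - q * (1 - \<rho>\<^sup>2 / c\<^sup>2) = q * (\<rho>\<^sup>2 * k)"
        using c by (simp add: q_def k_def) (simp add: field_simps)
      have 2: "q * q - (1 - \<rho>\<^sup>2 * (2 * c\<^sup>2 - 1)) * (1 - \<rho>\<^sup>2 / c\<^sup>2) = (1 + \<rho>\<^sup>2 - 2 * c\<^sup>2) * (\<rho>\<^sup>2 * k)"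
        using c by (simp add: q_def k_def) (simp add: field_simps)
      show "hmetric x (p i - x) (p i - x) = q * (\<rho>\<^sup>2 * k) / (lform x x)\<^sup>2"
       "hmetric x (p (Suc i) - x) (p (Suc i) - x) = q * (\<rho>\<^sup>2 * k) / (lform x x)\<^sup>2"
       "hmetric x (p i - x) (p (Suc i) - x) = (1 + \<rho>\<^sup>2 - 2 * c\<^sup>2) * (\<rho>\<^sup>2 * k) / (lform x x)\<^sup>2"
        unfolding hmetric_eq_lform[OF xh] L using 1 2 by simp_all
    qed
    \<comment> \<open>Up to this common factor both squared lengths are q and the mixed value is
      \<open>1 + \<rho>^2 - 2 * c^2\<close>.\<close>
    define h where "h = \<rho>\<^sup>2 * k / (lform x x)\<^sup>2"
    have h: "h > 0" using \<rho> k lform_pos[OF xh xh] by (simp add: h_def)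
    have "hmetric x (p i - x) (p (Suc i) - x) /
       (sqrt (hmetric x (p i - x) (p i - x)) * sqrt (hmetric x (p (Suc i) - x) (p (Suc i) - x)))
       = ((1 + \<rho>\<^sup>2 - 2 * c\<^sup>2) * h) / (sqrt (q * h) * sqrt (q * h))"
      unfolding H by (simp add: h_def)
    also have "\<dots> = (1 + \<rho>\<^sup>2 - 2 * c\<^sup>2) / q" using h q by simp
    \<comment> \<open>For \<open>\<rho> = tanh r\<close> this says that half the interior angle has
      cosine \<open>cosh r * sin t\<close>.\<close>
    also have "\<dots> = 2 * (sin t)\<^sup>2 / q - 1"
      using q by (simp add: sin_squared_eq c_def divide_simps) (simp add: q_def)
    finally show ?thesis unfolding hangle_def q_def by simp
  qed
  finally show ?thesis by (simp add: x_def t_def)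
qed

end

section \<open>Return to the original polygon\<close>

lemma (in centred_polygon) \<theta>_mod: "\<theta> (i mod n) = \<theta> i"
proof (induction i rule: less_induct)
  case (less i)
  show ?case
  proof (cases "i < n")
    case False
    then have "\<theta> ((i - n) mod n) = \<theta> (i - n)" using less[of "i - n"] n by simp
    then show ?thesis using False \<theta>(4)[of "i - n"] by (simp add: le_mod_geq)
  qed simp
qed

text \<open>The image of an open set is its preimage under the inverse isometry, which is continuous
  on the open disc.\<close>

lemma hisometry_interior:
  assumes h: "hisometry h" and S: "S \<subseteq> hplane"
  shows "h ` interior S = interior (h ` S)"
proof -
  have sub: "f ` interior A \<subseteq> interior (f ` A)" if f: "hisometry f" and A: "A \<subseteq> hplane" for f A
  proof -
    obtain g where g: "hisometry g" "\<And>x. x \<in> hplane \<Longrightarrow> g (f x) = x" "\<And>x. x \<in> hplane \<Longrightarrow> f (g x) = x"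
      using hisometry_inverse[OF f] by metis
    have iA: "interior A \<subseteq> hplane" using A interior_subset by blast
    have "f ` interior A = hplane \<inter> g -` interior A"
    proof (intro equalityI subsetI)
      fix y assume "y \<in> hplane \<inter> g -` interior A"
      then show "y \<in> f ` interior A" using g(3)[of y] by (metis IntE image_eqI vimageE)
    qed (use iA hisometry_in[OF f] g(2) in auto)
    moreover have "open (hplane \<inter> g -` interior A)"
      by (intro continuous_open_preimage hisometry_continuous g open_hplane open_interior)
    ultimately show ?thesis
      by (intro interior_maximal) (auto intro: image_mono interior_subset[THEN subsetD])
  qed
  obtain g where g: "hisometry g" "\<And>x. x \<in> hplane \<Longrightarrow> g (h x) = x" "\<And>x. x \<in> hplane \<Longrightarrow> h (g x) = x"
    using hisometry_inverse[OF h] by metis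
  have hS: "h ` S \<subseteq> hplane" using S hisometry_in[OF h] by auto
  have "g ` h ` S = S" using S g(2) by (force simp: image_image)
  then have "g ` interior (h ` S) \<subseteq> interior S" using sub[OF g(1) hS] by simp
  then have "h ` g ` interior (h ` S) \<subseteq> h ` interior S" by (rule image_mono)
  moreover have "h ` g ` interior (h ` S) = interior (h ` S)"
    using g(3) hS interior_subset[of "h ` S"] by (force simp: image_image)
  ultimately show ?thesis using sub[OF h S] by auto
qed

lemma ex_centred_polygon:
  assumes P: "hyp_ngon n P" and inc: "incircle P c r"
  obtains h \<phi> \<theta> where "hisometry h" "centred_polygon n (tanh r) \<phi> \<theta> (map h P)"
proof -
  obtain h m \<phi> \<theta> where h: "hisometry h" "hyp_ngon n (map h P)" "circumscribed n m (tanh r) \<phi> \<theta> (map h P)"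
    by (rule ex_circumscribed[OF P inc])
  have "m = 1" using circumscribed.winding_number_1[OF h(3,2)] .
  then show ?thesis using that[OF h(1)] h(3) by (simp add: centred_polygon_def)
qed

text \<open>The boundary of P and the frontier of its hull have the same image under the injective
  map that centres P, so they agree; the inside of the frontier of a bounded convex set is its
  interior.\<close>

lemma region_eq_convex_hull:
  assumes P: "hyp_ngon n P" and "tangential P"
  shows "region P = convex hull (set P)"
proof -
  obtain c r where inc: "incircle P c r" using assms by (auto simp: tangential_def)
  obtain h \<phi> \<theta> where h: "hisometry h" and cp: "centred_polygon n (tanh r) \<phi> \<theta> (map h P)"
    by (rule ex_centred_polygon[OF P inc])
  interpret centred_polygon n "tanh r" \<phi> \<theta> "map h P" by (rule cp)
  note ne = hyp_ngon_nonempty[OF P]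
  note V = hyp_ngon_vertex_in_hplane[OF P]
  define H where "H = convex hull (set P)"
  have PH: "set P \<subseteq> hplane" using P by (simp add: hyp_ngon_def)
  have HH: "H \<subseteq> hplane"
    unfolding H_def by (rule hull_minimal[where S=convex and t=hplane, OF PH convex_hplane])
  have hH: "h ` H = convex hull (set (map h P))"
    unfolding H_def using hisometry_convex_hull[OF h PH] by simp
  have cH: "compact H" unfolding H_def by (intro compact_convex_hull finite_imp_compact) simp
  have inj: "inj_on h hplane" by (rule hisometry_inj[OF h])
  have "boundary P \<subseteq> hplane"
    unfolding boundary_def using hyp_ngon_side_subset[OF P] by blast
  moreover have "h ` boundary P = boundary (map h P)"
    unfolding boundary_def image_UN side_def vertex_map[OF ne]
    using hisometry_segment[OF h V V] by simp
  moreover have "h ` frontier H = boundary (map h P)"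
  proof -
    have "h ` frontier H = h ` (H - interior H)"
      using cH by (simp add: frontier_def compact_imp_closed)
    also have "\<dots> = h ` H - h ` interior H"
      using HH interior_subset[of H] by (intro inj_on_image_set_diff[OF inj]) auto
    also have "\<dots> = convex hull (set (map h P)) - interior (convex hull (set (map h P)))"
      unfolding hisometry_interior[OF h HH] hH ..
    also have "\<dots> = frontier (convex hull (set (map h P)))"
      using compact_hull by (simp add: frontier_def compact_imp_closed)
    finally show ?thesis by (simp add: boundary_eq_frontier)
  qed
  moreover have "frontier H \<subseteq> hplane"
    using HH cH by (auto simp: frontier_def compact_imp_closed)
  ultimately have b: "boundary P = frontier H"
    using inj by (metis inj_on_image_eq_iff)
  have "inside (frontier H) = interior H"
    using cH by (intro inside_frontier_eq_interior) (auto simp: H_def compact_imp_bounded)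
  then have "region P = frontier H \<union> interior H" by (simp add: region_def b)
  also have "\<dots> = H"
    using cH interior_subset[of H] by (auto simp: frontier_def compact_imp_closed)
  finally show ?thesis by (simp add: H_def)
qed

lemma arccos_eq_arcsin: "\<bar>x\<bar> \<le> 1 \<Longrightarrow> arccos x = pi / 2 - arcsin x"
  using arccos_cos[of "pi / 2 - arcsin x"] arcsin_bounded[of x] sin_arcsin[of x]
  by (simp add: abs_le_iff cos_diff)

lemma one_div_sqrt_tanh: "1 / sqrt (1 - (tanh r)\<^sup>2) = cosh r" for r :: real
  by (simp add: cosh_sq_tanh real_sqrt_divide)

text \<open>\<open>\<theta> i\<close> is half the angle at the
  centre between the points of tangency of the two sides at vertex \<open>i\<close>.\<close>

definition central_half_angles :: "nat \<Rightarrow> real \<Rightarrow> complex list \<Rightarrow> (nat \<Rightarrow> real) \<Rightarrow> bool" where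
  "central_half_angles n r P \<theta> \<longleftrightarrow>
    (\<forall>i. 0 < \<theta> i \<and> \<theta> i < pi / 2 \<and> cosh r * sin (\<theta> i) < 1) \<and> (\<Sum>i<n. \<theta> i) = pi \<and>
    Area P = 2 * (\<Sum>i<n. arcsin (cosh r * sin (\<theta> i))) - 2 * pi \<and>
    (\<forall>i<n. interior_angle P i = arccos (2 * (cosh r * sin (\<theta> i))\<^sup>2 - 1)) \<and>
    ((\<forall>i<n. \<theta> i = pi / n) \<longrightarrow> (\<exists>h t. hisometry h \<and>
      (\<forall>i. h (vertex P i) = of_real (tanh r / cos (pi / n)) * cis (t + 2 * pi * real i / real n))))"

text \<open>Area and angles are computed on the centred copy and carried back. The inequalities
  below use P only through these numbers; the last clause of the predicate records the position of
  the vertices when all \<theta> i agree, for the case of equality.\<close>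

lemma ex_central_half_angles:
  assumes P: "hyp_ngon n P" and inc: "incircle P c r"
  shows "\<exists>\<theta>. central_half_angles n r P \<theta>"
proof -
  obtain h \<phi> \<theta> where h: "hisometry h" and cp: "centred_polygon n (tanh r) \<phi> \<theta> (map h P)"
    by (rule ex_centred_polygon[OF P inc])
  interpret centred_polygon n "tanh r" \<phi> \<theta> "map h P" by (rule cp)
  note ne = hyp_ngon_nonempty[OF P]
  note V = hyp_ngon_vertex_in_hplane[OF P]
  have lenP: "length P = n" using n by simp
  have PH: "set P \<subseteq> hplane" using P by (simp add: hyp_ngon_def)
  have region: "region P = convex hull (set P)"
    using region_eq_convex_hull[OF P] inc by (auto simp: tangential_def)
  have sub: "convex hull (set P) \<subseteq> hplane"
    by (rule hull_minimal[where S=convex and t=hplane, OF PH convex_hplane])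
  have comp: "compact (convex hull (set P))"
    by (intro compact_convex_hull finite_imp_compact) simp
  \<comment> \<open>A restatement of \<open>tanh r < cos (\<theta> i)\<close>, that is, of vertex i
    lying in the open disc.\<close>
  have less1: "cosh r * sin (\<theta> i) < 1" for i
  proof -
    have s: "sin (\<theta> i) > 0" using \<theta>(1,2)[of i] by (intro sin_gt_zero) auto
    have "(tanh r)\<^sup>2 < (cos (\<theta> i))\<^sup>2" using \<theta>(3)[of i] \<rho> by (intro power_strict_mono) auto
    then have "(sin (\<theta> i))\<^sup>2 < 1 / (cosh r)\<^sup>2" using cosh_sq_tanh[of r] by (simp add: cos_squared_eq)
    then have "(cosh r * sin (\<theta> i))\<^sup>2 < 1" by (simp add: power_mult_distrib field_simps)
    then show ?thesis by (simp add: power_less_one_iff abs_square_less_1)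
  qed
  have tri: "right_triangle_area (tanh r) t = arcsin (cosh r * sin t) - t" for t
    unfolding right_triangle_area_def one_div_sqrt_tanh[of r, symmetric] by simp
  have "Area P = harea (h ` (convex hull (set P)))"
    unfolding Area_def region using harea_hisometry[OF h comp sub] by simp
  also have "h ` (convex hull (set P)) = convex hull (set (map h P))"
    using hisometry_convex_hull[OF h PH] by simp
  also have "harea \<dots> = 2 * (\<Sum>i<n. arcsin (cosh r * sin (\<theta> i))) - 2 * pi"
    unfolding harea_hull tri by (simp add: sum_subtractf sum_\<theta> right_diff_distrib)
  finally have area: "Area P = 2 * (\<Sum>i<n. arcsin (cosh r * sin (\<theta> i))) - 2 * pi" .
  have angle: "interior_angle P i = arccos (2 * (cosh r * sin (\<theta> i))\<^sup>2 - 1)" if i: "i < n" for i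
  proof -
    \<comment> \<open>The predecessor of i, shifted by n as in \<open>interior_angle\<close> so that
      i = 0 is covered.\<close>
    define j where "j = i + n - 1"
    have j: "Suc j = i + n" using n by (simp add: j_def)
    define x where "x = vertex P i"
    define a where "a = vertex P j"
    define b where "b = vertex P (Suc i)"
    have xj: "vertex P (Suc j) = x" "vertex P (Suc (Suc j)) = b"
      using lenP by (simp_all add: j x_def b_def vertex_def) (metis add_Suc mod_add_self2)
    have inH: "vertex P l \<in> region P" for l
      using vertex_in_set[OF ne] hull_subset[of "set P" convex] unfolding region by blast
    \<comment> \<open>For \<open>t < 1/2\<close> the tested point is a convex combination of x, a
      and b, so the test in \<open>interior_angle\<close> succeeds and no angle is reflex.\<close>
    have "\<forall>\<^sub>F t::real in at_right 0. t < 1/2"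
      unfolding eventually_at_right_field by (intro exI[of _ "1/2"]) auto
    then have "\<forall>\<^sub>F t in at_right 0. x + t *\<^sub>R ((a - x) + (b - x)) \<in> region P"
      using eventually_at_right_less[of 0]
    proof eventually_elim
      case (elim t)
      have "(1 - 2 * t) *\<^sub>R x + t *\<^sub>R a + t *\<^sub>R b \<in> region P"
        unfolding region using elim inH[unfolded region]
        by (intro convexD_3[OF convex_convex_hull]) (auto simp: x_def a_def b_def)
      also have "(1 - 2 * t) *\<^sub>R x + t *\<^sub>R a + t *\<^sub>R b = x + t *\<^sub>R ((a - x) + (b - x))"
        by (simp add: algebra_simps flip: scaleR_2)
      finally show ?case .
    qed
    then have "interior_angle P i = hangle x (a - x) (b - x)"
      unfolding interior_angle_def Let_def lenP by (simp add: x_def a_def b_def j_def)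
    also have "\<dots> = hangle (h x) (h a - h x) (h b - h x)"
      unfolding x_def a_def b_def by (rule hisometry_hangle[OF h V V V, symmetric])
    also have "\<dots> = arccos (2 * (sin (\<theta> (Suc j)))\<^sup>2 / (1 - (tanh r)\<^sup>2) - 1)"
      using hangle_vertex[of j] unfolding vertex_map[OF ne] xj a_def .
    also have "\<dots> = arccos (2 * (cosh r * sin (\<theta> i))\<^sup>2 - 1)"
      unfolding j \<theta>(4) cosh_sq_tanh by (simp add: power_mult_distrib mult_ac)
    finally show ?thesis .
  qed
  have reg: "\<forall>i. h (vertex P i) = of_real (tanh r / cos (pi / n)) * cis (\<phi> 0 - pi / n + 2 * pi * real i / real n)"
    if "\<forall>i<n. \<theta> i = pi / n"
  proof
    fix i
    have \<theta>_eq: "\<theta> j = pi / n" for j using that \<theta>_mod[of j] n by (metis mod_less_divisor not_gr_zero not_numeral_le_zero)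
    have "\<phi> j = \<phi> 0 + 2 * pi * real j / real n" for j
      by (induction j) (simp_all add: \<phi>(1) \<theta>_eq add_divide_distrib distrib_left)
    from this[of i] have e: "\<phi> i - \<theta> i = \<phi> 0 - pi / n + 2 * pi * real i / real n"
      by (simp add: \<theta>_eq)
    show "h (vertex P i) = of_real (tanh r / cos (pi / n)) * cis (\<phi> 0 - pi / n + 2 * pi * real i / real n)"
      using vertex_eq[of i] unfolding vertex_map[OF ne] e by (simp only: \<theta>_eq)
  qed
  show ?thesis
    unfolding central_half_angles_def
  proof (intro exI[of _ \<theta>] conjI impI allI)
    assume "\<forall>i<n. \<theta> i = pi / n"
    then show "\<exists>h t. hisometry h \<and>
      (\<forall>i. h (vertex P i) = of_real (tanh r / cos (pi / n)) * cis (t + 2 * pi * real i / real n))"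
      using h reg by blast
  qed (use \<theta>(1,2) less1 sum_\<theta> area angle in blast)+
qed

lemma central_half_anglesD:
  assumes "central_half_angles n r P \<theta>"
  shows "0 < \<theta> i" "\<theta> i < pi / 2" "cosh r * sin (\<theta> i) < 1" "(\<Sum>i<n. \<theta> i) = pi"
    "Area P = 2 * (\<Sum>i<n. arcsin (cosh r * sin (\<theta> i))) - 2 * pi"
    "i < n \<Longrightarrow> interior_angle P i = arccos (2 * (cosh r * sin (\<theta> i))\<^sup>2 - 1)"
    "(\<forall>i<n. \<theta> i = pi / n) \<Longrightarrow> \<exists>h t. hisometry h \<and>
      (\<forall>i. h (vertex P i) = of_real (tanh r / cos (pi / n)) * cis (t + 2 * pi * real i / real n))"
  using assms unfolding central_half_angles_def by blast+

section \<open>The extremal problem\<close>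

lemma cosh_mult_sin_eq_of_arccos_eq:
  fixes a b :: real
  assumes "0 < a" "a < 1" "0 < b" "b < 1" "arccos (2 * a\<^sup>2 - 1) = arccos (2 * b\<^sup>2 - 1)"
  shows "a = b"
proof -
  have "a\<^sup>2 \<le> 1" "b\<^sup>2 \<le> 1" using assms by (simp_all add: power_le_one)
  then have "\<bar>2 * a\<^sup>2 - 1\<bar> \<le> 1 \<and> \<bar>2 * b\<^sup>2 - 1\<bar> \<le> 1" by (auto simp: abs_le_iff)
  then have "2 * a\<^sup>2 - 1 = 2 * b\<^sup>2 - 1" using assms(5) arccos_eq_iff by blast
  then show ?thesis using assms by (simp add: power2_eq_iff_nonneg)
qed

lemma sin_pos_acute: "0 < x \<Longrightarrow> x < pi / 2 \<Longrightarrow> 0 < sin x"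
  by (intro sin_gt_zero) auto

text \<open>The interior angles determine the numbers \<open>cosh r * sin (\<theta> i)\<close>, and these determine \<open>cosh r\<close>
  because the \<open>\<theta> i\<close> have fixed sum.\<close>

lemma central_half_angles_radius_le:
  assumes \<theta>: "central_half_angles n r P \<theta>" and \<theta>': "central_half_angles n r' P \<theta>'" and n: "n > 0"
  shows "cosh r' \<le> cosh r"
proof (rule ccontr)
  assume "\<not> cosh r' \<le> cosh r"
  then have less: "cosh r < cosh r'" by simp
  have "\<theta>' i < \<theta> i" if i: "i < n" for i
  proof -
    have b: "0 < \<theta> i" "\<theta> i < pi / 2" "cosh r * sin (\<theta> i) < 1"
      "0 < \<theta>' i" "\<theta>' i < pi / 2" "cosh r' * sin (\<theta>' i) < 1"
      by (rule central_half_anglesD[OF \<theta>] central_half_anglesD[OF \<theta>'])+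
    have ang: "arccos (2 * (cosh r * sin (\<theta> i))\<^sup>2 - 1) = arccos (2 * (cosh r' * sin (\<theta>' i))\<^sup>2 - 1)"
      using central_half_anglesD(6)[OF \<theta> i] central_half_anglesD(6)[OF \<theta>' i] by (rule trans[OF sym])
    have s: "0 < sin (\<theta> i)" "0 < sin (\<theta>' i)" using b by (auto intro: sin_pos_acute)
    have "cosh r * sin (\<theta> i) = cosh r' * sin (\<theta>' i)"
      by (rule cosh_mult_sin_eq_of_arccos_eq[OF _ b(3) _ b(6) ang]) (use s in simp_all)
    moreover have "cosh r * sin (\<theta>' i) < cosh r' * sin (\<theta>' i)"
      by (rule mult_strict_right_mono[OF less s(2)])
    ultimately have "cosh r * sin (\<theta>' i) < cosh r * sin (\<theta> i)" by linarith
    then have "sin (\<theta>' i) < sin (\<theta> i)" by simp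
    then show ?thesis
      using sin_mono_less_eq[of "\<theta>' i" "\<theta> i"] b(1,2,4,5) by simp
  qed
  then have "(\<Sum>i<n. \<theta>' i) < (\<Sum>i<n. \<theta> i)"
    using n by (intro sum_strict_mono) (simp_all add: lessThan_empty_iff)
  then show False using central_half_anglesD(4)[OF \<theta>] central_half_anglesD(4)[OF \<theta>'] by simp
qed

text \<open>Two incircles might have different centres and so different half angles; what they share
  is the list of interior angles of P.\<close>

lemma incircle_radius_unique:
  assumes P: "hyp_ngon n P" and "incircle P c r" "incircle P c' r'"
  shows "r = r'"
proof -
  obtain \<theta> \<theta>' where \<theta>: "central_half_angles n r P \<theta>" "central_half_angles n r' P \<theta>'"
    using ex_central_half_angles[OF P assms(2)] ex_central_half_angles[OF P assms(3)] by (elim exE)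
  have "n > 0" using P by (simp add: hyp_ngon_def)
  then have "cosh r = cosh r'"
    using central_half_angles_radius_le[OF \<theta>] central_half_angles_radius_le[OF \<theta>(2,1)] by simp
  moreover have "r > 0" "r' > 0" using assms by (auto simp: incircle_def)
  ultimately show ?thesis by (simp add: cosh_real_nonneg_eq_iff)
qed

lemma inradius_eq:
  assumes "hyp_ngon n P" "incircle P c r"
  shows "inradius P = r"
  unfolding inradius_def using assms incircle_radius_unique by (intro the_equality) blast+

lemma incircle_inradius:
  assumes "hyp_ngon n P" "tangential P"
  obtains c where "incircle P c (inradius P)" "inradius P > 0"
  using assms inradius_eq unfolding tangential_def incircle_def by metis

section \<open>Jensen over the half angles and over the inradii\<close>

lemma mean_arcsin_mult_sin:
  fixes n :: nat
  assumes n: "n > 0" and C: "C > 1"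
    and \<theta>: "\<And>i. i < n \<Longrightarrow> 0 < \<theta> i" "\<And>i. i < n \<Longrightarrow> \<theta> i < pi / 2" "\<And>i. i < n \<Longrightarrow> C * sin (\<theta> i) < 1"
      "(\<Sum>i<n. \<theta> i) = pi"
  shows "C * sin (pi / n) < 1" "n * arcsin (C * sin (pi / n)) \<le> (\<Sum>i<n. arcsin (C * sin (\<theta> i)))"
    "(\<Sum>i<n. arcsin (C * sin (\<theta> i))) = n * arcsin (C * sin (pi / n)) \<longleftrightarrow> (\<forall>i<n. \<theta> i = pi / n)"
proof -
  let ?S = "{x. 0 < x \<and> x < pi/2 \<and> C * sin x < 1}"
  have m: "pi / n = (\<Sum>i<n. \<theta> i) / card {..<n}" using \<theta>(4) by simp
  have mem: "\<theta> i \<in> ?S" if "i \<in> {..<n}" for i using \<theta> that by simp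
  have ne: "{..<n} \<noteq> {}" using n by (simp add: lessThan_empty_iff)
  have der: "((\<lambda>x. arcsin (C * sin x)) has_real_derivative C * cos x / sqrt (1 - (C * sin x)\<^sup>2)) (at x)"
    if "x \<in> ?S" for x using that C by (intro arcsin_mult_sin_deriv) auto
  have mono: "C * cos x / sqrt (1 - (C * sin x)\<^sup>2) < C * cos y / sqrt (1 - (C * sin y)\<^sup>2)"
    if "x \<in> ?S" "y \<in> ?S" "x < y" for x y
    using that C by (intro arcsin_mult_sin_deriv_mono) auto
  note J = strict_Jensen_mean[OF convex_arcsin_mult_sin_domain[OF C] finite_lessThan ne mem der mono m]
  show "C * sin (pi / n) < 1" "n * arcsin (C * sin (pi / n)) \<le> (\<Sum>i<n. arcsin (C * sin (\<theta> i)))"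
    "(\<Sum>i<n. arcsin (C * sin (\<theta> i))) = n * arcsin (C * sin (pi / n)) \<longleftrightarrow> (\<forall>i<n. \<theta> i = pi / n)"
    using J by auto
qed

text \<open>Here s stands for \<open>sin (pi / n)\<close>. The first claim, that the mean radius
  stays in the domain, makes the bound of the theorem meaningful.\<close>

lemma mean_arcsin_mult_cosh:
  assumes k: "finite I" "I \<noteq> {}" and s: "0 < s"
    and r: "\<And>i. i \<in> I \<Longrightarrow> 0 < r i" "\<And>i. i \<in> I \<Longrightarrow> s * cosh (r i) < (1::real)"
    and T: "T = (\<Sum>i\<in>I. r i)"
  shows "s * cosh (T / card I) < 1"
    "card I * arcsin (s * cosh (T / card I)) \<le> (\<Sum>i\<in>I. arcsin (s * cosh (r i)))"
    "(\<Sum>i\<in>I. arcsin (s * cosh (r i))) = card I * arcsin (s * cosh (T / card I)) \<longleftrightarrow> (\<forall>i\<in>I. r i = T / card I)"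
proof -
  let ?S = "{x. 0 < x \<and> s * cosh x < 1}"
  have m: "T / card I = (\<Sum>i\<in>I. r i) / card I" using T by simp
  have mem: "r i \<in> ?S" if "i \<in> I" for i using r that by simp
  have der: "((\<lambda>x. arcsin (s * cosh x)) has_real_derivative s * sinh x / sqrt (1 - (s * cosh x)\<^sup>2)) (at x)"
    if "x \<in> ?S" for x using that s by (intro arcsin_mult_cosh_deriv) auto
  have mono: "s * sinh x / sqrt (1 - (s * cosh x)\<^sup>2) < s * sinh y / sqrt (1 - (s * cosh y)\<^sup>2)"
    if "x \<in> ?S" "y \<in> ?S" "x < y" for x y
    using that s by (intro arcsin_mult_cosh_deriv_mono) auto
  note J = strict_Jensen_mean[OF convex_arcsin_mult_cosh_domain[OF s] k mem der mono m]
  show "s * cosh (T / card I) < 1"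
    "card I * arcsin (s * cosh (T / card I)) \<le> (\<Sum>i\<in>I. arcsin (s * cosh (r i)))"
    "(\<Sum>i\<in>I. arcsin (s * cosh (r i))) = card I * arcsin (s * cosh (T / card I)) \<longleftrightarrow> (\<forall>i\<in>I. r i = T / card I)"
    using J by auto
qed

text \<open>The Gauss-Bonnet area of the regular n-gon of inradius r; with
  \<open>arcsin x = pi / 2 - arccos x\<close> it reads
  \<open>(n - 2) * pi - 2 * n * arccos x\<close>.\<close>

definition regular_area :: "nat \<Rightarrow> real \<Rightarrow> real" where
  "regular_area n r = 2 * (n * arcsin (cosh r * sin (pi / n))) - 2 * pi"

lemma cosh_gt_1: "r > 0 \<Longrightarrow> cosh r > 1" for r :: real
  using cosh_real_strict_mono[of 0 r] by simp

lemma Area_ge_regular_area: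
  assumes P: "hyp_ngon n P" and inc: "incircle P c r"
  shows "sin (pi / n) * cosh r < 1" "regular_area n r \<le> Area P"
proof -
  obtain \<theta> where D: "central_half_angles n r P \<theta>"
    using ex_central_half_angles[OF P inc] by blast
  note \<theta> = central_half_anglesD(1-4)[OF D]
  note area = central_half_anglesD(5)[OF D]
  have r: "cosh r > 1" using inc by (intro cosh_gt_1) (simp add: incircle_def)
  have n: "n > 0" using P by (simp add: hyp_ngon_def)
  note J = mean_arcsin_mult_sin[OF n r \<theta>]
  show "sin (pi / n) * cosh r < 1" using J(1) by (simp add: mult.commute)
  show "regular_area n r \<le> Area P" using J(2) by (simp add: area regular_area_def)
qed

text \<open>Equal interior angles give equal \<open>cosh r * sin (\<theta> i)\<close>, hence equal
  acute \<theta> i; having sum pi, they are all \<open>pi / n\<close>.\<close>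

lemma regular_Area:
  assumes P: "hyp_ngon n P" and inc: "incircle P c r" and "regular P"
  shows "Area P = regular_area n r"
proof -
  obtain \<theta> where D: "central_half_angles n r P \<theta>"
    using ex_central_half_angles[OF P inc] by blast
  note \<theta> = central_half_anglesD(1-4)[OF D]
  note area = central_half_anglesD(5)[OF D]
  note ang = central_half_anglesD(6)[OF D]
  have n: "n > 0" "length P = n" using P by (auto simp: hyp_ngon_def)
  have eq: "\<theta> i = \<theta> 0" if i: "i < n" for i
  proof -
    have s: "0 < sin (\<theta> i)" "0 < sin (\<theta> 0)" by (rule sin_pos_acute[OF \<theta>(1,2)])+
    have "interior_angle P i = interior_angle P 0" using assms(3) i n unfolding regular_def by blast
    then have a: "arccos (2 * (cosh r * sin (\<theta> i))\<^sup>2 - 1) = arccos (2 * (cosh r * sin (\<theta> 0))\<^sup>2 - 1)"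
      unfolding ang[OF i] ang[OF n(1)] .
    have "cosh r * sin (\<theta> i) = cosh r * sin (\<theta> 0)"
      by (rule cosh_mult_sin_eq_of_arccos_eq[OF _ \<theta>(3) _ \<theta>(3) a]) (use s in simp_all)
    then have "sin (\<theta> i) = sin (\<theta> 0)" by simp
    then show ?thesis
      by (rule sin_inj_pi[rotated 4]) (use \<theta>(1,2)[of i] \<theta>(1,2)[of 0] in simp_all)
  qed
  have "(\<Sum>i<n. \<theta> i) = (\<Sum>i<n. \<theta> 0)" by (rule sum.cong[OF refl], rule eq) simp
  then have "real n * \<theta> 0 = pi" using \<theta>(4) by simp
  then have "\<theta> 0 = pi / n" using n by (simp add: field_simps)
  then have all: "\<forall>i<n. \<theta> i = pi / n" using eq by (intro allI impI) (rule trans)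
  have r: "cosh r > 1" using inc by (intro cosh_gt_1) (simp add: incircle_def)
  have "(\<Sum>i<n. arcsin (cosh r * sin (\<theta> i))) = n * arcsin (cosh r * sin (pi / n))"
    unfolding mean_arcsin_mult_sin(3)[OF n(1) r \<theta>] by (rule all)
  then show ?thesis unfolding area regular_area_def by (rule arg_cong)
qed

section \<open>The case of equality\<close>

lemma extremal_normal_form:
  assumes P: "hyp_ngon n P" and inc: "incircle P c r" and area: "Area P = regular_area n r"
  shows "\<exists>h t. hisometry h \<and>
      (\<forall>i. h (vertex P i) = of_real (tanh r / cos (pi / n)) * cis (t + 2 * pi * real i / real n))"
    "\<And>i. i < n \<Longrightarrow> interior_angle P i = arccos (2 * (cosh r * sin (pi / n))\<^sup>2 - 1)"
proof -
  obtain \<theta> where D: "central_half_angles n r P \<theta>"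
    using ex_central_half_angles[OF P inc] by blast
  note \<theta> = central_half_anglesD(1-4)[OF D]
  note A = central_half_anglesD(5)[OF D]
  have r: "cosh r > 1" using inc by (intro cosh_gt_1) (simp add: incircle_def)
  have n: "n > 0" using P by (simp add: hyp_ngon_def)
  have eq: "\<forall>i<n. \<theta> i = pi / n"
    using mean_arcsin_mult_sin(3)[OF n r \<theta>] area by (simp add: A regular_area_def)
  then show "\<exists>h t. hisometry h \<and>
      (\<forall>i. h (vertex P i) = of_real (tanh r / cos (pi / n)) * cis (t + 2 * pi * real i / real n))"
    by (rule central_half_anglesD(7)[OF D])
  show "interior_angle P i = arccos (2 * (cosh r * sin (pi / n))\<^sup>2 - 1)" if "i < n" for i
    using central_half_anglesD(6)[OF D that] eq that by simp
qed

text \<open>In the normal form consecutive vertices differ by a fixed rotation, which gives equal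
  sides; the interior angles are known from the half angles.\<close>

lemma extremal_regular:
  assumes P: "hyp_ngon n P" and inc: "incircle P c r" and area: "Area P = regular_area n r"
  shows "regular P"
proof -
  obtain h t where h: "hisometry h"
    and v: "\<And>i. h (vertex P i) = of_real (tanh r / cos (pi / n)) * cis (t + 2 * pi * real i / real n)"
    using extremal_normal_form(1)[OF assms] by blast
  note ang = extremal_normal_form(2)[OF assms]
  have n: "n > 0" "length P = n" using P by (auto simp: hyp_ngon_def)
  note V = hyp_ngon_vertex_in_hplane[OF P]
  define R where "R = tanh r / cos (pi / n)"
  have inner_cis: "inner (of_real R * cis a) (of_real R * cis b) = R * R * cos (b - a)" for a b
    by (simp add: inner_complex_def cos_diff algebra_simps)
  have "hdist (vertex P i) (vertex P (Suc i)) = arcosh ((1 - R * R * cos (2 * pi / n)) / (sqrt (1 - R\<^sup>2) * sqrt (1 - R\<^sup>2)))" for i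
  proof -
    have "hdist (vertex P i) (vertex P (Suc i)) = hdist (h (vertex P i)) (h (vertex P (Suc i)))"
      using h V by (simp add: hisometry_def)
    also have "\<dots> = arcosh ((1 - R * R * cos (2 * pi / n)) / (sqrt (1 - R\<^sup>2) * sqrt (1 - R\<^sup>2)))"
    proof -
      have "t + 2 * pi * real (Suc i) / n - (t + 2 * pi * real i / n) = 2 * pi / n"
        using n by (simp add: field_simps)
      then show ?thesis
        unfolding v hdist_def R_def[symmetric] inner_cis by (simp add: norm_mult)
    qed
    finally show ?thesis .
  qed
  then show ?thesis unfolding regular_def n(2) using ang by simp
qed

text \<open>The two normal forms differ by the rotation through \<open>t' - t\<close>. Going from P
  to its normal form, turning, and undoing \<open>h'\<close> sends vertex i to vertex i, and the
  hulls follow the vertices.\<close>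

lemma extremal_isometric:
  assumes P: "hyp_ngon n P" and inc: "incircle P c r" and "Area P = regular_area n r"
    and P': "hyp_ngon n P'" and inc': "incircle P' c' r" and "Area P' = regular_area n r"
  shows "isometric P P'"
proof -
  obtain h t where h: "hisometry h"
    and v: "\<And>i. h (vertex P i) = of_real (tanh r / cos (pi / n)) * cis (t + 2 * pi * real i / real n)"
    using extremal_normal_form(1)[OF assms(1-3)] by blast
  obtain h' t' where h': "hisometry h'"
    and v': "\<And>i. h' (vertex P' i) = of_real (tanh r / cos (pi / n)) * cis (t' + 2 * pi * real i / real n)"
    using extremal_normal_form(1)[OF assms(4-6)] by blast
  obtain g where g: "hisometry g" "\<And>x. x \<in> hplane \<Longrightarrow> g (h' x) = x"
    using hisometry_inverse[OF h'] by metis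
  define F where "F x = g (cis (t' - t) * h x)" for x
  have F: "hisometry F"
    unfolding F_def by (rule hisometry_compose[OF hisometry_compose[OF h hisometry_rotation] g(1)])
  have FV: "F (vertex P i) = vertex P' i" for i
  proof -
    have "cis (t' - t) * h (vertex P i)
        = of_real (tanh r / cos (pi / n)) * (cis (t' - t) * cis (t + 2 * pi * real i / real n))"
      unfolding v by (simp only: mult_ac)
    also have "\<dots> = h' (vertex P' i)" unfolding v' cis_mult by (simp add: add.assoc)
    finally show ?thesis using g(2) hyp_ngon_vertex_in_hplane[OF P'] by (simp add: F_def)
  qed
  have len: "length P = n" "length P' = n" using P P' by (auto simp: hyp_ngon_def)
  have "F ` set P = set P'"
    unfolding set_eq_vertex_image len image_image FV ..
  moreover have "set P \<subseteq> hplane" using P by (simp add: hyp_ngon_def)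
  moreover have "tangential P" "tangential P'" using inc inc' by (auto simp: tangential_def)
  ultimately have "F ` region P = region P'"
    using region_eq_convex_hull[OF P] region_eq_convex_hull[OF P'] hisometry_convex_hull[OF F] by simp
  then show ?thesis using F by (auto simp: isometric_def)
qed

text \<open>Serves the converse direction, where the polygons are compared with a regular one only
  through congruent regions.\<close>

lemma isometric_Area:
  assumes P: "hyp_ngon n P" "tangential P" and "isometric P Q"
  shows "Area P = Area Q"
proof -
  obtain f where f: "hisometry f" "f ` region P = region Q"
    using assms by (auto simp: isometric_def)
  have "set P \<subseteq> hplane" using P by (simp add: hyp_ngon_def)
  then have "convex hull (set P) \<subseteq> hplane"
    by (rule hull_minimal[where S=convex and t=hplane, OF _ convex_hplane])
  moreover have "compact (convex hull (set P))"
    by (intro compact_convex_hull finite_imp_compact) simp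
  ultimately have "harea (f ` region P) = harea (region P)"
    unfolding region_eq_convex_hull[OF P] by (intro harea_hisometry f)
  then show ?thesis by (simp add: Area_def f(2))
qed

theorem theorem1p9:
  fixes n k :: nat and T :: real and P :: "nat \<Rightarrow> complex list"
  assumes "n \<ge> 3" and "k \<ge> 1"
    and "\<And>i. i \<in> {1..k} \<Longrightarrow> hyp_ngon n (P i)"
    and "\<And>i. i \<in> {1..k} \<Longrightarrow> tangential (P i)"
    and "(\<Sum>i=1..k. inradius (P i)) = T"
  shows "(\<Sum>i=1..k. Area (P i)) \<ge>
           real k * (real n - 2) * pi - 2 * real n * real k * arccos (sin (pi / n) * cosh (T / k)) \<and>
         ((\<Sum>i=1..k. Area (P i)) =
           real k * (real n - 2) * pi - 2 * real n * real k * arccos (sin (pi / n) * cosh (T / k))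
          \<longleftrightarrow> (\<exists>Q. hyp_ngon n Q \<and> regular Q \<and> tangential Q \<and> inradius Q = T / k \<and>
                 (\<forall>i\<in>{1..k}. isometric (P i) Q)))"
proof -
  define s where "s = sin (pi / n)"
  define r where "r i = inradius (P i)" for i
  have "0 < pi / n" "pi / n < pi" using assms(1) by (auto simp: divide_less_eq)
  then have s: "s > 0" unfolding s_def by (intro sin_gt_zero)
  have "\<exists>c. incircle (P i) c (r i)" if "i \<in> {1..k}" for i
    using incircle_inradius[OF assms(3,4)[OF that]] unfolding r_def by blast
  then obtain c where inc: "incircle (P i) (c i) (r i)" if "i \<in> {1..k}" for i by metis
  have r: "r i > 0" "s * cosh (r i) < 1" "regular_area n (r i) \<le> Area (P i)" if "i \<in> {1..k}" for i
    using inc[OF that] Area_ge_regular_area[OF assms(3)[OF that] inc[OF that]]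
    by (auto simp: incircle_def s_def)
  have I: "finite {1..k}" "{1..k} \<noteq> {}" "card {1..k} = k" using assms(2) by auto
  have T: "T = (\<Sum>i\<in>{1..k}. r i)" using assms(5) by (simp add: r_def)
  note J = mean_arcsin_mult_cosh[OF I(1,2) s r(1,2) T, unfolded I(3)]
  define B where "B = real k * regular_area n (T / k)"
  have sum_reg: "(\<Sum>i=1..k. regular_area n (r i)) = 2 * n * (\<Sum>i=1..k. arcsin (s * cosh (r i))) - k * (2 * pi)"
    by (simp add: regular_area_def s_def sum_subtractf sum_distrib_left mult_ac)
  have B_eq: "B = 2 * n * (k * arcsin (s * cosh (T / k))) - k * (2 * pi)"
    by (simp add: B_def regular_area_def s_def right_diff_distrib mult_ac)
  \<comment> \<open>Replacing arccos by its complement turns the stated bound into k times the area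
    of the regular n-gon of inradius T / k.\<close>
  have bound: "real k * (real n - 2) * pi - 2 * real n * real k * arccos (sin (pi / n) * cosh (T / k)) = B"
  proof -
    have "\<bar>s * cosh (T / k)\<bar> \<le> 1" using J(1) s by (simp add: abs_mult less_imp_le)
    note a = arccos_eq_arcsin[OF this]
    show ?thesis
      unfolding B_eq s_def[symmetric] a by (simp add: algebra_simps)
  qed
  \<comment> \<open>The bound factors through the regular n-gons of the individual inradii:
    averaging the radii is this step, averaging the angles the next. Equality in the theorem forces
    equality in both.\<close>
  have B_le: "B \<le> (\<Sum>i=1..k. regular_area n (r i))"
    using mult_left_mono[OF J(2), of "2 * real n"] by (simp only: sum_reg B_eq) simp
  have le: "(\<Sum>i=1..k. regular_area n (r i)) \<le> (\<Sum>i=1..k. Area (P i))"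
    using r(3) by (rule sum_mono)
  have iff: "(\<Sum>i=1..k. Area (P i)) = B \<longleftrightarrow> (\<exists>Q. hyp_ngon n Q \<and> regular Q \<and> tangential Q \<and> inradius Q = T / k \<and>
                 (\<forall>i\<in>{1..k}. isometric (P i) Q))"
  proof
    assume eq: "(\<Sum>i=1..k. Area (P i)) = B"
    then have "(\<Sum>i=1..k. regular_area n (r i)) = B" using B_le le by simp
    then have "real n * (\<Sum>i=1..k. arcsin (s * cosh (r i))) = real n * (k * arcsin (s * cosh (T / k)))"
      unfolding sum_reg B_eq by simp
    then have "(\<Sum>i=1..k. arcsin (s * cosh (r i))) = k * arcsin (s * cosh (T / k))"
      using assms(1) by simp
    then have rT: "r i = T / k" if "i \<in> {1..k}" for i using J(3) that by blast
    have "(\<Sum>i=1..k. Area (P i) - regular_area n (r i)) = 0"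
      using eq B_le le by (simp add: sum_subtractf)
    then have "\<forall>i\<in>{1..k}. Area (P i) - regular_area n (r i) = 0"
      using r(3) by (subst (asm) sum_nonneg_eq_0_iff) auto
    then have area: "Area (P i) = regular_area n (T / k)" if "i \<in> {1..k}" for i
      using rT that by force
    have inc': "incircle (P i) (c i) (T / k)" if "i \<in> {1..k}" for i using inc[OF that] rT[OF that] by simp
    have 1: "1 \<in> {1..k}" using assms(2) by simp
    \<comment> \<open>\<open>P 1\<close> itself serves as the regular model Q, so that no regular
      n-gon has to be constructed.\<close>
    have "regular (P 1)" by (rule extremal_regular[OF assms(3) inc' area]) (use 1 in simp_all)
    moreover have "isometric (P i) (P 1)" if "i \<in> {1..k}" for i
      by (rule extremal_isometric[OF assms(3)[OF that] inc'[OF that] area[OF that] assms(3)[OF 1] inc'[OF 1] area[OF 1]])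
    ultimately show "\<exists>Q. hyp_ngon n Q \<and> regular Q \<and> tangential Q \<and> inradius Q = T / k \<and>
                 (\<forall>i\<in>{1..k}. isometric (P i) Q)"
      using assms(3,4)[OF 1] rT[OF 1] by (intro exI[of _ "P 1"]) (simp add: r_def)
  next
    assume "\<exists>Q. hyp_ngon n Q \<and> regular Q \<and> tangential Q \<and> inradius Q = T / k \<and>
                 (\<forall>i\<in>{1..k}. isometric (P i) Q)"
    then obtain Q where Q: "hyp_ngon n Q" "regular Q" "tangential Q" "inradius Q = T / k"
      "\<And>i. i \<in> {1..k} \<Longrightarrow> isometric (P i) Q" by blast
    obtain d where "incircle Q d (T / k)"
      using incircle_inradius[OF Q(1,3)] unfolding Q(4) by blast
    then have "Area Q = regular_area n (T / k)" using regular_Area[OF Q(1)] Q(2) by blast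
    then have "Area (P i) = regular_area n (T / k)" if "i \<in> {1..k}" for i
      using isometric_Area[OF assms(3,4)[OF that] Q(5)[OF that]] by simp
    then show "(\<Sum>i=1..k. Area (P i)) = B" by (simp add: B_def)
  qed
  show ?thesis
    unfolding bound by (rule conjI[OF order_trans[OF B_le le] iff])
qed

end
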